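(* Let $H$ be a factorisable quasitriangular Hopf algebra with universal R-matrix $\mathcal R$, in nondegenerate duality with a Hopf algebra $H^*$, with $D(H)$, $H^{\mathrm{cop}}\blacktriangleright\!\!\!\triangleleft H$, their actions, $Q$, $\theta$, $\theta_1$, $\chi_B$ as in the context. Then the covariant system $(D(H),H)$, viewed via $Q$ as a covariant system $(D(H),\underline{H^*})$, is isomorphic to the twisting by $\chi_B=\mathcal R_{23}^{-1}$ of the covariant system $(H^{\mathrm{cop}}\blacktriangleright\!\!\!\triangleleft H,H^* )$, the isomorphism at the level of Hopf algebras being $\theta: D(H)\to (H^{\mathrm{cop}}\blacktriangleright\!\!\!\triangleleft H)_{\chi_B}$, $$\theta(h\otimes a)=h_{(1)}\mathcal Q^{-[2]}Sh_{(2)}\otimes h_{(3)}\mathcal R^{[1]}\langle a,\mathcal Q^{-[1]}\mathcal R^{[2]}\rangle .$$ Moreover, $H^{\mathrm{cop}}\blacktriangleright\!\!\!\triangleleft H$ has two quasitriangular structures given by $(\theta_1\otimes\theta_1)(\mathcal R_{13}^{-1}\mathcal R_{24})$ and $(\theta_1\otimes\theta_1)(\mathcal R_{31}\mathcal R_{24})$.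
   Context: Notation: Sweedler notation $\Delta h=h_{(1)}\otimes h_{(2)}$, antipode $S$, pairing $\langle\ ,\ \rangle$ between $H$ and $H^*$; for $x,y\in H^*$, $\mathcal R(x,y)=\langle x,\mathcal R^{[1]}\rangle\langle y,\mathcal R^{[2]}\rangle$. $\mathcal Q=\mathcal R_{21}\mathcal R$, with inverse $\mathcal Q^{-1}=\mathcal Q^{-[1]}\otimes\mathcal Q^{-[2]}$, and $Q:H^*\to H$, $Q(a)=\langle a,\mathcal Q^{[1]}\rangle\mathcal Q^{[2]}$. $H$ is factorisable if $Q$ is a linear isomorphism. Subscripts $\mathcal R_{ij}$ denote $\mathcal R$ placed in tensor factors $i,j$. Quantum double: $D(H)=H\bowtie H^{*\mathrm{op}}$ on $H\otimes H^*$, tensor product coproduct, product $(h\otimes a)(g\otimes b)=hg_{(2)}\otimes b\,a_{(2)}\langle g_{(1)},a_{(1)}\rangle\langle Sg_{(3)},a_{(3)}\rangle$; it acts on the algebra $H$ by $(h\otimes a)\triangleright\phi=\langle\phi_{(1)},a\rangle h_{(1)}\phi_{(2)}Sh_{(2)}$. $\underline{H^*}$: the vector space $H^*$ with product $a\,\underline{\cdot}\,b=a_{(2)}b_{(2)}\mathcal R((Sa_{(1)})a_{(3)},Sb_{(1)})$; $D(H)$ acts on it by $(h\otimes a)\triangleright b=b_{(3)}\langle h,(Sb_{(2)})b_{(4)}\rangle\mathcal R(a_{(1)},b_{(1)})\mathcal R(b_{(5)},a_{(2)})$, and $Q$ is an isomorphism of covariant algebras $\underline{H^*}\to H$ intertwining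 these two actions of $D(H)$. Bicrossproduct (mirror product) $H^{\mathrm{cop}}\blacktriangleright\!\!\!\triangleleft H$: vector space $H\otimes H$ (first factor regarded as $H^{\mathrm{cop}}$) with product $(\phi\otimes h)(\psi\otimes g)=\phi\,(h_{(1)}\psi Sh_{(2)})\otimes h_{(3)}g$ and coproduct $\Delta(\phi\otimes h)=\phi_{(2)}\otimes h_{(2)}\otimes\phi_{(1)}h_{(1)}Sh_{(3)}\otimes h_{(4)}$ (coproducts of $H$). It acts covariantly on the algebra $H^*$ by $(\phi\otimes h)\triangleright a=\langle Sh_{(1)}S\phi,a_{(1)}\rangle\,a_{(2)}\,\langle h_{(2)},a_{(3)}\rangle$. The map $\theta_1:H^{\mathrm{cop}}\otimes H\to H^{\mathrm{cop}}\blacktriangleright\!\!\!\triangleleft H$, $\theta_1(\phi\otimes h)=\phi Sh_{(1)}\otimes h_{(2)}$, is a Hopf algebra isomorphism from the tensor product Hopf algebra; $\theta=\theta_1\theta_2$ in the paper's notation. Twisting: for a Hopf algebra $K$ and a 2-cocycle $\chi\in K\otimes K$ (i.e. $\chi_{12}(\Delta\otimes\mathrm{id})\chi=\chi_{23}(\mathrm{id}\otimes\Delta)\chi$, $(\epsilon\otimes\mathrm{id})\chi=1$), $K_\chi$ is $K$ with coproduct $\Delta_\chi=\chi(\Delta\,\cdot)\chi^{-1}$ (and R-matrix $\chi_{21}\mathcal R\chi^{-1}$ when quasitriangular); if $K$ acts covariantly on an algebra $A$ then $K_\chi$ acts covariantly (same action) on $A_\chi$, the vector space $A$ with product $a\cdot_\chi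 b=\cdot(\chi^{-1}\triangleright(a\otimes b))$. Here $\chi_B=\mathcal R_{23}^{-1}\in(H^{\mathrm{cop}}\blacktriangleright\!\!\!\triangleleft H)^{\otimes 2}$, i.e. $1\otimes\mathcal R^{-[1]}\otimes\mathcal R^{-[2]}\otimes 1$. An isomorphism of covariant systems $(K,A)\cong(K',A')$ is a Hopf algebra isomorphism $K\to K'$ together with an algebra isomorphism $A\to A'$ intertwining the actions. *)

theory Defs
  imports Main
begin

text \<open>Finite-dimensional model. A (bi)algebra over a field 'k with a basis indexed by the
finite type 'i is given by structure constants. Vectors are coordinate functions 'i => 'k,
and the tensor product of spaces with bases 'i and 'j is identified with 'i \<times> 'j => 'k.
The dual H* carries the dual basis, so an element a of H* is given by its values a i on
the basis vectors e_i of H.\<close>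

record ('i, 'k) bialg =
  mc :: "'i \<Rightarrow> 'i \<Rightarrow> 'i \<Rightarrow> 'k"   (* e_a e_b = sum_c mc a b c e_c *)
  uc :: "'i \<Rightarrow> 'k"                (* 1 = sum_c uc c e_c *)
  dc :: "'i \<Rightarrow> 'i \<Rightarrow> 'i \<Rightarrow> 'k"   (* Delta e_a = sum_{b,c} dc a b c e_b (x) e_c *)
  ec :: "'i \<Rightarrow> 'k"                (* epsilon e_a = ec a *)

definition bv :: "'i \<Rightarrow> 'i \<Rightarrow> 'k::field" where
  "bv a = (\<lambda>j. if j = a then 1 else 0)"

definition mul :: "('i::finite, 'k::field) bialg \<Rightarrow> ('i \<Rightarrow> 'k) \<Rightarrow> ('i \<Rightarrow> 'k) \<Rightarrow> ('i \<Rightarrow> 'k)" where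
  "mul K x y = (\<lambda>c. \<Sum>a\<in>UNIV. \<Sum>b\<in>UNIV. x a * y b * mc K a b c)"

definition one :: "('i::finite, 'k::field) bialg \<Rightarrow> ('i \<Rightarrow> 'k)" where
  "one K = uc K"

definition cop :: "('i::finite, 'k::field) bialg \<Rightarrow> ('i \<Rightarrow> 'k) \<Rightarrow> ('i \<times> 'i \<Rightarrow> 'k)" where
  "cop K x = (\<lambda>(b, c). \<Sum>a\<in>UNIV. x a * dc K a b c)"

definition cou :: "('i::finite, 'k::field) bialg \<Rightarrow> ('i \<Rightarrow> 'k) \<Rightarrow> 'k" where
  "cou K x = (\<Sum>a\<in>UNIV. x a * ec K a)"

definition cop3 :: "('i::finite, 'k::field) bialg \<Rightarrow> ('i \<Rightarrow> 'k) \<Rightarrow> ('i \<times> 'i \<times> 'i \<Rightarrow> 'k)" where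
  "cop3 K x = (\<lambda>(p, q, r). \<Sum>d\<in>UNIV. cop K x (d, r) * dc K d p q)"

definition cop4 :: "('i::finite, 'k::field) bialg \<Rightarrow> ('i \<Rightarrow> 'k) \<Rightarrow> ('i \<times> 'i \<times> 'i \<times> 'i \<Rightarrow> 'k)" where
  "cop4 K x = (\<lambda>(p, q, r, s). \<Sum>d\<in>UNIV. cop3 K x (d, r, s) * dc K d p q)"

definition cop5 :: "('i::finite, 'k::field) bialg \<Rightarrow> ('i \<Rightarrow> 'k) \<Rightarrow> ('i \<times> 'i \<times> 'i \<times> 'i \<times> 'i \<Rightarrow> 'k)" where
  "cop5 K x = (\<lambda>(p, q, r, s, t). \<Sum>d\<in>UNIV. cop4 K x (d, r, s, t) * dc K d p q)"

definition tv :: "('i \<Rightarrow> 'k::field) \<Rightarrow> ('j \<Rightarrow> 'k) \<Rightarrow> ('i \<times> 'j \<Rightarrow> 'k)" where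
  "tv x y = (\<lambda>(a, b). x a * y b)"

definition tens :: "('i, 'k::field) bialg \<Rightarrow> ('j, 'k) bialg \<Rightarrow> ('i \<times> 'j, 'k) bialg" where
  "tens K L = \<lparr> mc = (\<lambda>(a, a') (b, b') (c, c'). mc K a b c * mc L a' b' c'),
                uc = tv (uc K) (uc L),
                dc = (\<lambda>(a, a') (b, b') (c, c'). dc K a b c * dc L a' b' c'),
                ec = tv (ec K) (ec L) \<rparr>"

definition tensmap :: "(('i::finite \<Rightarrow> 'k::field) \<Rightarrow> ('i' \<Rightarrow> 'k)) \<Rightarrow> (('j::finite \<Rightarrow> 'k) \<Rightarrow> ('j' \<Rightarrow> 'k))
     \<Rightarrow> ('i \<times> 'j \<Rightarrow> 'k) \<Rightarrow> ('i' \<times> 'j' \<Rightarrow> 'k)" where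
  "tensmap f g T = (\<lambda>(p, q). \<Sum>(a, b)\<in>UNIV. T (a, b) * f (bv a) p * g (bv b) q)"

definition flip :: "('i \<times> 'j \<Rightarrow> 'k) \<Rightarrow> ('j \<times> 'i \<Rightarrow> 'k)" where
  "flip T = (\<lambda>(a, b). T (b, a))"

definition lin :: "(('i \<Rightarrow> 'k::field) \<Rightarrow> ('j \<Rightarrow> 'k)) \<Rightarrow> bool" where
  "lin f \<longleftrightarrow> (\<forall>x y. f (\<lambda>j. x j + y j) = (\<lambda>j. f x j + f y j))
            \<and> (\<forall>c x. f (\<lambda>j. c * x j) = (\<lambda>j. c * f x j))"

definition is_bialg :: "('i::finite, 'k::field) bialg \<Rightarrow> bool" where
  "is_bialg K \<longleftrightarrow>
     (\<forall>x y z. mul K (mul K x y) z = mul K x (mul K y z)) \<and>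
     (\<forall>x. mul K (one K) x = x \<and> mul K x (one K) = x) \<and>
     (\<forall>x. (\<lambda>((a, b), c). \<Sum>d\<in>UNIV. cop K x (d, c) * dc K d a b)
         = (\<lambda>((a, b), c). \<Sum>d\<in>UNIV. cop K x (a, d) * dc K d b c)) \<and>
     (\<forall>x. (\<lambda>c. \<Sum>b\<in>UNIV. cop K x (b, c) * ec K b) = x \<and>
          (\<lambda>b. \<Sum>c\<in>UNIV. cop K x (b, c) * ec K c) = x) \<and>
     (\<forall>x y. cop K (mul K x y) = mul (tens K K) (cop K x) (cop K y)) \<and>
     cop K (one K) = one (tens K K) \<and>
     (\<forall>x y. cou K (mul K x y) = cou K x * cou K y) \<and>
     cou K (one K) = 1"

definition app :: "('i::finite \<Rightarrow> 'i \<Rightarrow> 'k::field) \<Rightarrow> ('i \<Rightarrow> 'k) \<Rightarrow> ('i \<Rightarrow> 'k)" where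
  "app s x = (\<lambda>b. \<Sum>a\<in>UNIV. x a * s a b)"

definition is_antipode :: "('i::finite, 'k::field) bialg \<Rightarrow> ('i \<Rightarrow> 'i \<Rightarrow> 'k) \<Rightarrow> bool" where
  "is_antipode K s \<longleftrightarrow>
     (\<forall>x. (\<lambda>j. \<Sum>(b, c)\<in>UNIV. cop K x (b, c) * mul K (app s (bv b)) (bv c) j) = (\<lambda>j. cou K x * one K j) \<and>
          (\<lambda>j. \<Sum>(b, c)\<in>UNIV. cop K x (b, c) * mul K (bv b) (app s (bv c)) j) = (\<lambda>j. cou K x * one K j))"

definition is_hopf :: "('i::finite, 'k::field) bialg \<Rightarrow> bool" where
  "is_hopf K \<longleftrightarrow> is_bialg K \<and> (\<exists>s. is_antipode K s)"

text \<open>The antipode (unique when it exists).\<close>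
definition antip :: "('i::finite, 'k::field) bialg \<Rightarrow> ('i \<Rightarrow> 'k) \<Rightarrow> ('i \<Rightarrow> 'k)" where
  "antip K = app (SOME s. is_antipode K s)"

definition hopf_iso :: "('i::finite, 'k::field) bialg \<Rightarrow> ('j::finite, 'k) bialg \<Rightarrow> (('i \<Rightarrow> 'k) \<Rightarrow> ('j \<Rightarrow> 'k)) \<Rightarrow> bool" where
  "hopf_iso K L f \<longleftrightarrow> is_hopf K \<and> is_hopf L \<and> lin f \<and> bij f \<and>
     (\<forall>x y. f (mul K x y) = mul L (f x) (f y)) \<and> f (one K) = one L \<and>
     (\<forall>x. cop L (f x) = tensmap f f (cop K x)) \<and> (\<forall>x. cou L (f x) = cou K x) \<and>
     (\<forall>x. f (antip K x) = antip L (f x))"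

definition alg_iso :: "(('i \<Rightarrow> 'k::field) \<Rightarrow> ('i \<Rightarrow> 'k) \<Rightarrow> ('i \<Rightarrow> 'k)) \<Rightarrow> ('i \<Rightarrow> 'k)
     \<Rightarrow> (('j \<Rightarrow> 'k) \<Rightarrow> ('j \<Rightarrow> 'k) \<Rightarrow> ('j \<Rightarrow> 'k)) \<Rightarrow> ('j \<Rightarrow> 'k) \<Rightarrow> (('i \<Rightarrow> 'k) \<Rightarrow> ('j \<Rightarrow> 'k)) \<Rightarrow> bool" where
  "alg_iso mA uA mB uB g \<longleftrightarrow> lin g \<and> bij g \<and> (\<forall>x y. g (mA x y) = mB (g x) (g y)) \<and> g uA = uB"

definition covsys_iso where
  "covsys_iso K mA uA actA L mB uB actB f g \<longleftrightarrow>
     hopf_iso K L f \<and> alg_iso mA uA mB uB g \<and> (\<forall>x a. g (actA x a) = actB (f x) (g a))"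

definition dualH :: "('i, 'k) bialg \<Rightarrow> ('i, 'k) bialg" where
  "dualH H = \<lparr> mc = (\<lambda>a b c. dc H c a b), uc = ec H, dc = (\<lambda>a b c. mc H b c a), ec = uc H \<rparr>"

definition pair :: "('i::finite \<Rightarrow> 'k::field) \<Rightarrow> ('i \<Rightarrow> 'k) \<Rightarrow> 'k" where
  "pair a h = (\<Sum>i\<in>UNIV. a i * h i)"

definition op_of :: "('i, 'k) bialg \<Rightarrow> ('i, 'k) bialg" where
  "op_of K = K\<lparr> mc := (\<lambda>a b c. mc K b a c) \<rparr>"

definition cop_of :: "('i, 'k) bialg \<Rightarrow> ('i, 'k) bialg" where
  "cop_of K = K\<lparr> dc := (\<lambda>a b c. dc K a c b) \<rparr>"

definition inv_el :: "('i::finite, 'k::field) bialg \<Rightarrow> ('i \<Rightarrow> 'k) \<Rightarrow> ('i \<Rightarrow> 'k)" where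
  "inv_el K t = (SOME u. mul K t u = one K \<and> mul K u t = one K)"

definition qt :: "('i::finite, 'k::field) bialg \<Rightarrow> ('i \<times> 'i \<Rightarrow> 'k) \<Rightarrow> bool" where
  "qt K R \<longleftrightarrow>
     (\<exists>Ri. mul (tens K K) R Ri = one (tens K K) \<and> mul (tens K K) Ri R = one (tens K K)) \<and>
     (\<forall>x. mul (tens K K) (flip (cop K x)) R = mul (tens K K) R (cop K x)) \<and>
     (\<lambda>((a, b), c). \<Sum>d\<in>UNIV. R (d, c) * dc K d a b)
        = mul (tens (tens K K) K) (\<lambda>((a, b), c). R (a, c) * uc K b) (\<lambda>((a, b), c). uc K a * R (b, c)) \<and>
     (\<lambda>(a, (b, c)). \<Sum>d\<in>UNIV. R (a, d) * dc K d b c)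
        = mul (tens K (tens K K)) (\<lambda>(a, (b, c)). R (a, c) * uc K b) (\<lambda>(a, (b, c)). R (a, b) * uc K c)"

definition Qel :: "('i::finite, 'k::field) bialg \<Rightarrow> ('i \<times> 'i \<Rightarrow> 'k) \<Rightarrow> ('i \<times> 'i \<Rightarrow> 'k)" where
  "Qel H R = mul (tens H H) (flip R) R"

definition Qmap :: "('i::finite, 'k::field) bialg \<Rightarrow> ('i \<times> 'i \<Rightarrow> 'k) \<Rightarrow> ('i \<Rightarrow> 'k) \<Rightarrow> ('i \<Rightarrow> 'k)" where
  "Qmap H R a = (\<lambda>j. \<Sum>p\<in>UNIV. a p * Qel H R (p, j))"

definition factorisable :: "('i::finite, 'k::field) bialg \<Rightarrow> ('i \<times> 'i \<Rightarrow> 'k) \<Rightarrow> bool" where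
  "factorisable H R \<longleftrightarrow> bij (Qmap H R)"

definition Rform :: "('i \<times> 'i \<Rightarrow> 'k) \<Rightarrow> ('i::finite \<Rightarrow> 'k::field) \<Rightarrow> ('i \<Rightarrow> 'k) \<Rightarrow> 'k" where
  "Rform R x y = (\<Sum>(a, b)\<in>UNIV. x a * y b * R (a, b))"

definition dprod :: "('i::finite, 'k::field) bialg \<Rightarrow> 'i \<Rightarrow> 'i \<Rightarrow> 'i \<Rightarrow> 'i \<Rightarrow> ('i \<times> 'i \<Rightarrow> 'k)" where
  "dprod H h a g b = (\<lambda>c. \<Sum>(x, y, z)\<in>UNIV. \<Sum>(u, v, w)\<in>UNIV.
      cop3 H (bv g) (x, y, z) * cop3 (dualH H) (bv a) (u, v, w) *
      pair (bv u) (bv x) * pair (bv w) (antip H (bv z)) *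
      tv (mul H (bv h) (bv y)) (mul (dualH H) (bv b) (bv v)) c)"

definition dbl :: "('i::finite, 'k::field) bialg \<Rightarrow> ('i \<times> 'i, 'k) bialg" where
  "dbl H = (tens H (op_of (dualH H)))\<lparr> mc := (\<lambda>(h, a) (g, b) c. dprod H h a g b c) \<rparr>"

definition umul :: "('i::finite, 'k::field) bialg \<Rightarrow> ('i \<times> 'i \<Rightarrow> 'k) \<Rightarrow> ('i \<Rightarrow> 'k) \<Rightarrow> ('i \<Rightarrow> 'k) \<Rightarrow> ('i \<Rightarrow> 'k)" where
  "umul H R a b = (\<lambda>j. \<Sum>(a1, a2, a3)\<in>UNIV. \<Sum>(b1, b2)\<in>UNIV.
      cop3 (dualH H) a (a1, a2, a3) * cop (dualH H) b (b1, b2) *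
      Rform R (mul (dualH H) (antip (dualH H) (bv a1)) (bv a3)) (antip (dualH H) (bv b1)) *
      mul (dualH H) (bv a2) (bv b2) j)"

definition uact :: "('i::finite, 'k::field) bialg \<Rightarrow> ('i \<times> 'i \<Rightarrow> 'k) \<Rightarrow> ('i \<times> 'i \<Rightarrow> 'k) \<Rightarrow> ('i \<Rightarrow> 'k) \<Rightarrow> ('i \<Rightarrow> 'k)" where
  "uact H R X b = (\<lambda>j. \<Sum>(h, a)\<in>UNIV. X (h, a) *
      (\<Sum>(a1, a2)\<in>UNIV. \<Sum>(b1, b2, b3, b4, b5)\<in>UNIV.
        cop (dualH H) (bv a) (a1, a2) * cop5 (dualH H) b (b1, b2, b3, b4, b5) *
        pair (mul (dualH H) (antip (dualH H) (bv b2)) (bv b4)) (bv h) *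
        Rform R (bv a1) (bv b1) * Rform R (bv b5) (bv a2) * bv b3 j))"

definition bprod :: "('i::finite, 'k::field) bialg \<Rightarrow> 'i \<Rightarrow> 'i \<Rightarrow> 'i \<Rightarrow> 'i \<Rightarrow> ('i \<times> 'i \<Rightarrow> 'k)" where
  "bprod H f h p g = (\<lambda>c. \<Sum>(x, y, z)\<in>UNIV. cop3 H (bv h) (x, y, z) *
      tv (mul H (bv f) (mul H (mul H (bv x) (bv p)) (antip H (bv y)))) (mul H (bv z) (bv g)) c)"

definition bcop :: "('i::finite, 'k::field) bialg \<Rightarrow> 'i \<Rightarrow> 'i \<Rightarrow> (('i \<times> 'i) \<times> ('i \<times> 'i) \<Rightarrow> 'k)" where
  "bcop H f h = (\<lambda>c. \<Sum>(f1, f2)\<in>UNIV. \<Sum>(h1, h2, h3, h4)\<in>UNIV.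
      cop H (bv f) (f1, f2) * cop4 H (bv h) (h1, h2, h3, h4) *
      tv (tv (bv f2) (bv h2)) (tv (mul H (mul H (bv f1) (bv h1)) (antip H (bv h3))) (bv h4)) c)"

definition bicross :: "('i::finite, 'k::field) bialg \<Rightarrow> ('i \<times> 'i, 'k) bialg" where
  "bicross H = \<lparr> mc = (\<lambda>(f, h) (p, g) c. bprod H f h p g c),
                 uc = tv (uc H) (uc H),
                 dc = (\<lambda>(f, h) p q. bcop H f h (p, q)),
                 ec = tv (ec H) (ec H) \<rparr>"

definition bact :: "('i::finite, 'k::field) bialg \<Rightarrow> ('i \<times> 'i \<Rightarrow> 'k) \<Rightarrow> ('i \<Rightarrow> 'k) \<Rightarrow> ('i \<Rightarrow> 'k)" where
  "bact H X a = (\<lambda>j. \<Sum>(f, h)\<in>UNIV. X (f, h) *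
      (\<Sum>(x, y)\<in>UNIV. \<Sum>(u, v, w)\<in>UNIV.
        cop H (bv h) (x, y) * cop3 (dualH H) a (u, v, w) *
        pair (bv u) (mul H (antip H (bv x)) (antip H (bv f))) * bv v j * pair (bv w) (bv y)))"

definition twist_bialg :: "('i::finite, 'k::field) bialg \<Rightarrow> ('i \<times> 'i \<Rightarrow> 'k) \<Rightarrow> ('i, 'k) bialg" where
  "twist_bialg K chi = K\<lparr> dc := (\<lambda>p q r.
      mul (tens K K) (mul (tens K K) chi (cop K (bv p))) (inv_el (tens K K) chi) (q, r)) \<rparr>"

definition twist_mul :: "('i::finite, 'k::field) bialg \<Rightarrow> (('j \<Rightarrow> 'k) \<Rightarrow> ('j \<Rightarrow> 'k) \<Rightarrow> ('j \<Rightarrow> 'k))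
     \<Rightarrow> (('i \<Rightarrow> 'k) \<Rightarrow> ('j \<Rightarrow> 'k) \<Rightarrow> ('j \<Rightarrow> 'k)) \<Rightarrow> ('i \<times> 'i \<Rightarrow> 'k)
     \<Rightarrow> ('j \<Rightarrow> 'k) \<Rightarrow> ('j \<Rightarrow> 'k) \<Rightarrow> ('j \<Rightarrow> 'k)" where
  "twist_mul K mA act chi a b = (\<lambda>j. \<Sum>(P, Q)\<in>UNIV.
      inv_el (tens K K) chi (P, Q) * mA (act (bv P) a) (act (bv Q) b) j)"

definition chiB :: "('i::finite, 'k::field) bialg \<Rightarrow> ('i \<times> 'i \<Rightarrow> 'k) \<Rightarrow> (('i \<times> 'i) \<times> ('i \<times> 'i) \<Rightarrow> 'k)" where
  "chiB H R = (\<lambda>((f, h), (f', h')). uc H f * inv_el (tens H H) R (h, f') * uc H h')"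

definition theta :: "('i::finite, 'k::field) bialg \<Rightarrow> ('i \<times> 'i \<Rightarrow> 'k) \<Rightarrow> ('i \<times> 'i \<Rightarrow> 'k) \<Rightarrow> ('i \<times> 'i \<Rightarrow> 'k)" where
  "theta H R X = (\<lambda>c. \<Sum>(h, a)\<in>UNIV. X (h, a) *
      (\<Sum>(x, y, z)\<in>UNIV. \<Sum>(q1, q2)\<in>UNIV. \<Sum>(r1, r2)\<in>UNIV.
        cop3 H (bv h) (x, y, z) * inv_el (tens H H) (Qel H R) (q1, q2) * R (r1, r2) *
        pair (bv a) (mul H (bv q1) (bv r2)) *
        tv (mul H (mul H (bv x) (bv q2)) (antip H (bv y))) (mul H (bv z) (bv r1)) c))"

definition theta1 :: "('i::finite, 'k::field) bialg \<Rightarrow> ('i \<times> 'i \<Rightarrow> 'k) \<Rightarrow> ('i \<times> 'i \<Rightarrow> 'k)" where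
  "theta1 H X = (\<lambda>c. \<Sum>(f, h)\<in>UNIV. X (f, h) *
      (\<Sum>(x, y)\<in>UNIV. cop H (bv h) (x, y) * tv (mul H (bv f) (antip H (bv x))) (bv y) c))"

definition tens4 :: "('i::finite, 'k::field) bialg \<Rightarrow> (('i \<times> 'i) \<times> ('i \<times> 'i), 'k) bialg" where
  "tens4 H = tens (tens (cop_of H) H) (tens (cop_of H) H)"

definition R13inv :: "('i::finite, 'k::field) bialg \<Rightarrow> ('i \<times> 'i \<Rightarrow> 'k) \<Rightarrow> (('i \<times> 'i) \<times> ('i \<times> 'i) \<Rightarrow> 'k)" where
  "R13inv H R = (\<lambda>((p, q), (r, s)). inv_el (tens H H) R (p, r) * uc H q * uc H s)"

definition R24 :: "('i::finite, 'k::field) bialg \<Rightarrow> ('i \<times> 'i \<Rightarrow> 'k) \<Rightarrow> (('i \<times> 'i) \<times> ('i \<times> 'i) \<Rightarrow> 'k)" where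
  "R24 H R = (\<lambda>((p, q), (r, s)). uc H p * R (q, s) * uc H r)"

definition R31 :: "('i::finite, 'k::field) bialg \<Rightarrow> ('i \<times> 'i \<Rightarrow> 'k) \<Rightarrow> (('i \<times> 'i) \<times> ('i \<times> 'i) \<Rightarrow> 'k)" where
  "R31 H R = (\<lambda>((p, q), (r, s)). R (r, p) * uc H q * uc H s)"

end

theory Submission
  imports Complex_Main Defs "HOL-Library.Function_Algebras"
begin

text \<open>The whole argument takes place in the tensor product Hopf algebra \<open>T\<close> of \<open>H\<^sup>c\<^sup>o\<^sup>p\<close> and \<open>H\<close>.
The inverse of \<open>theta1\<close>, mapping \<open>f \<otimes> h\<close> to \<open>(f \<otimes> 1) \<Delta>(h)\<close>, is an isomorphism of Hopf algebras from the
bicrossproduct to \<open>T\<close>. Following \<open>theta\<close> by it one gets the map sending \<open>h \<otimes> a\<close> to \<open>\<Delta>(h)\<close> times the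
contraction of the third leg of \<open>L = R\<^sub>3\<^sub>1\<^sup>-\<^sup>1 R\<^sub>2\<^sub>3\<close> with \<open>a\<close>. That map is multiplicative because
\<open>(id \<otimes> \<Delta>) L = L\<^sub>1\<^sub>2\<^sub>4 L\<^sub>1\<^sub>2\<^sub>3\<close> and \<open>L (g\<^sub>1 \<otimes> g\<^sub>2 \<otimes> g\<^sub>3) = (g\<^sub>2 \<otimes> g\<^sub>3 \<otimes> g\<^sub>1) L\<close>; it respects the twisted
coproduct by the Yang-Baxter equation; the inverse of \<open>L\<close> yields the antipode of the double; and it is onto
since \<open>R\<^sub>3\<^sub>,\<^sub>1\<^sub>2 L = R\<^sub>3\<^sub>2 R\<^sub>2\<^sub>3\<close>, whose slices exhaust \<open>1 \<otimes> H\<close> when \<open>H\<close> is factorisable.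
Factorisability also makes \<open>S\<close> bijective, because \<open>S \<otimes> S\<close> maps \<open>R\<^sub>2\<^sub>1 R\<close> to \<open>R R\<^sub>2\<^sub>1\<close>; hence \<open>H\<^sup>c\<^sup>o\<^sup>p\<close> is a
Hopf algebra.\<close>

section \<open>Linear maps in coordinates\<close>

text \<open>Where \<open>L\<close> comes from: \<open>theta\<close> contains the inverse of
  \<open>Q\<close>, which is R^{-1} R_21^{-1}. Undoing \<open>theta1\<close> applies the coproduct
  to the first leg of the other R, the hexagon identity turns this into R_13 R_23, and R_13 cancels
  one factor of the inverse of \<open>Q\<close>. The rest is \<open>L\<close>. The obstacle is that
  at the outset neither the double nor the twisted bicrossproduct is known to be a Hopf algebra, and
  each has the axioms that are laborious for the other. The double has the coproduct of a plain
  tensor product, so its coassociativity is immediate, while for a twisted coproduct it would take a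
  cocycle computation. A twist leaves the product alone, so associativity is immediate there and
  laborious for the double. A bijection that respects all operations is therefore built before
  either side is known to be Hopf, and it carries axioms in both directions. On the module side,
  undoing \<open>theta1\<close> turns the action on H^* into p \<mapsto> S(u) p v inside the
  pairing. The algebra isomorphism is then the identity of H^*, and both remaining claims compare
  pairings with a test vector p.\<close>

definition scal :: "'k::field \<Rightarrow> ('a \<Rightarrow> 'k) \<Rightarrow> 'a \<Rightarrow> 'k" (infixr "\<odot>" 75) where
  "c \<odot> x = (\<lambda>j. c * x j)"

text \<open>Sweedler notation: if \<open>t\<close> is a sum of tensors \<open>t\<^sub>1 \<otimes> t\<^sub>2\<close> then \<open>ev t F\<close> stands for the sum of the
\<open>F t\<^sub>1 t\<^sub>2\<close>. As \<open>F\<close> only meets basis vectors, rebracketing such sums does not need \<open>F\<close> to be bilinear.\<close>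

definition ev :: "('a::finite \<times> 'b::finite \<Rightarrow> 'k::field)
    \<Rightarrow> (('a \<Rightarrow> 'k) \<Rightarrow> ('b \<Rightarrow> 'k) \<Rightarrow> ('c \<Rightarrow> 'k)) \<Rightarrow> 'c \<Rightarrow> 'k" where
  "ev t F = (\<Sum>p\<in>UNIV. t p \<odot> F (bv (fst p)) (bv (snd p)))"

text \<open>Rules that peel one operation off a term. Most identities below are multilinear and are
  extended from basis vectors or pure tensors; \<open>(intro lins)+\<close> discharges the linearity
  goals that arise.\<close>

named_theorems lins

lemma sum_fun_apply [simp]: "(\<Sum>a\<in>A. f a) j = (\<Sum>a\<in>A. f a j :: 'k::comm_monoid_add)"
  by (induction A rule: infinite_finite_induct) auto

lemma scal_apply [simp]: "(c \<odot> x) j = c * x j"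
  by (simp add: scal_def)

lemma scal_scal [simp]: "c \<odot> d \<odot> x = (c * d) \<odot> x"
  by (simp add: scal_def mult.assoc)

lemma scal_one [simp]: "1 \<odot> x = x"
  by (simp add: scal_def)

lemma scal_add: "c \<odot> (x + y) = c \<odot> x + c \<odot> y"
  by (auto simp: scal_def algebra_simps)

lemma add_scal: "(c + d) \<odot> x = c \<odot> x + d \<odot> x"
  by (auto simp: scal_def algebra_simps)

lemma scal_sum: "c \<odot> (\<Sum>a\<in>A. f a) = (\<Sum>a\<in>A. c \<odot> f a)"
  by (rule ext) (simp add: sum_distrib_left)

lemma sum_scal: "(\<Sum>a\<in>A. f a) \<odot> v = (\<Sum>a\<in>A. f a \<odot> v)"
  by (rule ext) (simp add: sum_distrib_right)

lemma lin_iff: "lin f \<longleftrightarrow> (\<forall>x y. f (x + y) = f x + f y) \<and> (\<forall>c x. f (c \<odot> x) = c \<odot> f x)"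
  unfolding lin_def plus_fun_def scal_def by simp

lemma linI: "(\<And>x y. f (x + y) = f x + f y) \<Longrightarrow> (\<And>c x. f (c \<odot> x) = c \<odot> f x) \<Longrightarrow> lin f"
  by (simp add: lin_iff)

lemma lin_add: "lin f \<Longrightarrow> f (x + y) = f x + f y" by (simp add: lin_iff)
lemma lin_scal: "lin f \<Longrightarrow> f (c \<odot> x) = c \<odot> f x" by (simp add: lin_iff)

lemma lin_zero: "lin f \<Longrightarrow> f 0 = 0"
  using lin_scal[of f 0 0] by (simp add: scal_def zero_fun_def)

lemma lin_sum: "lin f \<Longrightarrow> f (\<Sum>a\<in>A. g a) = (\<Sum>a\<in>A. f (g a))"
  by (induction A rule: infinite_finite_induct) (auto simp: lin_add lin_zero)

lemma lin_compose: "lin h \<Longrightarrow> lin f \<Longrightarrow> lin (\<lambda>x. h (f x))"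
  by (simp add: lin_iff)

lemma lin_id [lins]: "lin (\<lambda>x. x)" by (simp add: lin_iff)
lemma lin_id' [lins]: "lin id" by (simp add: lin_iff)

lemma lin_scal_body [lins]: "lin f \<Longrightarrow> lin (\<lambda>x. c \<odot> f x)"
  by (simp add: lin_iff scal_add mult.commute)

lemma lin_sum_body: "(\<And>a. lin (f a)) \<Longrightarrow> lin (\<lambda>x. \<Sum>a\<in>A. f a x)"
  by (simp add: lin_iff sum.distrib scal_sum)

lemma sum_UNIV_pair: "(\<Sum>p\<in>UNIV. f p) = (\<Sum>a\<in>UNIV. \<Sum>b\<in>UNIV. f (a, b))"
  by (simp add: sum.cartesian_product flip: UNIV_Times_UNIV)

lemma ev_sum: "ev t F = (\<Sum>a\<in>UNIV. \<Sum>b\<in>UNIV. t (a, b) \<odot> F (bv a) (bv b))"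
  by (simp add: ev_def sum_UNIV_pair)

lemma ev_apply: "ev t F j = (\<Sum>a\<in>UNIV. \<Sum>b\<in>UNIV. t (a, b) * F (bv a) (bv b) j)"
  by (simp add: ev_sum)

lemma lin_ev_arg [lins]: "lin f \<Longrightarrow> lin (\<lambda>x. ev (f x) F)"
  unfolding ev_def by (simp add: lin_iff add_scal sum.distrib scal_sum)

lemma lin_ev_body [lins]: "(\<And>a b. lin (\<lambda>x. F x a b)) \<Longrightarrow> lin (\<lambda>x. ev t (F x))"
  unfolding ev_def by (intro lin_sum_body lin_scal_body)

lemma ev_lin: assumes "lin f" shows "f (ev t F) = ev t (\<lambda>a b. f (F a b))"
  unfolding ev_def by (simp add: lin_sum[OF assms] lin_scal[OF assms] del: scal_apply sum_fun_apply)

lemma ev_scal: "c \<odot> ev t F = ev t (\<lambda>a b. c \<odot> F a b)"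
  by (rule ev_lin[of "\<lambda>x. c \<odot> x"]) (intro lins)

lemma ev_scal_arg [simp]: "ev (c \<odot> t) F = c \<odot> ev t F"
  by (rule lin_scal[of "\<lambda>t. ev t F"]) (intro lins)

lemma ev_swap: "ev t (\<lambda>a b. ev s (\<lambda>c d. F a b c d)) = ev s (\<lambda>c d. ev t (\<lambda>a b. F a b c d))"
  unfolding ev_def scal_sum by (subst sum.swap) (simp add: mult.commute)

lemma ev_ev: "ev (ev t G) F = ev t (\<lambda>a b. ev (G a b) F)"
  by (rule ev_lin[of "\<lambda>x. ev x F"]) (intro lins)

lemma ev_cong: "(\<And>a b. F (bv a) (bv b) = G (bv a) (bv b)) \<Longrightarrow> ev t F = ev t G"
  by (simp add: ev_def)

lemma vec_expand: "x = (\<Sum>a\<in>UNIV. x a \<odot> bv a)" for x :: "'a::finite \<Rightarrow> 'k::field"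
  by (rule ext) (simp add: bv_def if_distrib cong: if_cong)

lemma lin_expand:
  fixes x :: "'a::finite \<Rightarrow> 'k::field"
  assumes "lin f" shows "f x = (\<Sum>a\<in>UNIV. x a \<odot> f (bv a))"
proof -
  have "f x = f (\<Sum>a\<in>UNIV. x a \<odot> bv a)" using vec_expand[of x] by simp
  then show ?thesis by (simp only: lin_sum[OF assms] lin_scal[OF assms])
qed

lemma lin_eqI:
  fixes x :: "'a::finite \<Rightarrow> 'k::field"
  assumes "lin f" "lin g" "\<And>a. f (bv a) = g (bv a)" shows "f x = g x"
  by (simp only: lin_expand[OF assms(1), of x] lin_expand[OF assms(2), of x] assms(3))

lemma bv_pair: "bv (a, b) = tv (bv a) (bv b)"
  by (auto simp: bv_def tv_def)

lemma tv_apply [simp]: "tv x y (a, b) = x a * y b"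
  by (simp add: tv_def)

lemma lin_eq_tvI:
  fixes x :: "'a::finite \<times> 'b::finite \<Rightarrow> 'k::field"
  assumes "lin f" "lin g" "\<And>a b. f (tv a b) = g (tv a b)"
  shows "f x = g x"
proof (rule lin_eqI[OF assms(1,2)])
  show "f (bv p) = g (bv p)" for p
    using assms(3) by (cases p) (simp add: bv_pair)
qed

lemma lin_tv_l [lins]: "lin f \<Longrightarrow> lin (\<lambda>x. tv (f x) y)"
  by (auto simp: lin_iff tv_def fun_eq_iff algebra_simps)

lemma lin_tv_r [lins]: "lin f \<Longrightarrow> lin (\<lambda>x. tv y (f x))"
  by (auto simp: lin_iff tv_def fun_eq_iff algebra_simps)

lemma ev_tv_id [simp]: "ev t tv = t"
  unfolding ev_def by (simp only: bv_pair[symmetric] prod.collapse vec_expand[symmetric])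

lemma ev_tv_id' [simp]: "ev t (\<lambda>a. tv a) = t" "ev t (\<lambda>a b. tv a b) = t"
  by simp_all

text \<open>Here bilinearity of \<open>F\<close> is essential: \<open>ev\<close> sums over basis
  vectors only, and this evaluates it at a pure tensor of arbitrary vectors.\<close>

lemma ev_tv:
  assumes "\<And>a. lin (F a)" "\<And>b. lin (\<lambda>a. F a b)"
  shows "ev (tv x y) F = F x y"
proof -
  have "F x y = (\<Sum>a\<in>UNIV. x a \<odot> F (bv a) y)" by (rule lin_expand[OF assms(2)])
  also have "\<dots> = (\<Sum>a\<in>UNIV. x a \<odot> (\<Sum>b\<in>UNIV. y b \<odot> F (bv a) (bv b)))"
    by (simp only: lin_expand[OF assms(1), of _ y])
  finally show ?thesis by (simp only: ev_sum scal_sum scal_scal tv_apply)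
qed

lemma mul_sum: "mul K x y = (\<Sum>a\<in>UNIV. \<Sum>b\<in>UNIV. (x a * y b) \<odot> mc K a b)"
  by (rule ext) (simp add: mul_def)

lemma lin_mul_l [lins]: "lin f \<Longrightarrow> lin (\<lambda>x. mul K (f x) y)"
  unfolding mul_sum by (simp add: lin_iff add_scal distrib_right sum.distrib scal_sum mult.assoc)

lemma lin_mul_r [lins]: "lin f \<Longrightarrow> lin (\<lambda>x. mul K y (f x))"
  unfolding mul_sum by (simp add: lin_iff add_scal distrib_left distrib_right sum.distrib scal_sum mult_ac)

lemma sum_bv [simp]: "(\<Sum>a\<in>UNIV. bv p a * f a) = f p" for p :: "'a::finite"
  unfolding bv_def by (subst sum.cong[OF refl, where h = "\<lambda>a. if a = p then f a else 0"]) auto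

lemma mul_bv: "mul K (bv a) (bv b) = mc K a b"
  by (rule ext) (simp add: mul_def mult.assoc flip: sum_distrib_left)

lemma mul_scal_l [simp]: "mul K (c \<odot> x) y = c \<odot> mul K x y"
  by (rule lin_scal[of "\<lambda>x. mul K x y"]) (intro lins)
lemma mul_scal_r [simp]: "mul K x (c \<odot> y) = c \<odot> mul K x y"
  by (rule lin_scal[of "mul K x"]) (intro lins)
lemma mul_ev_l: "mul K (ev t F) y = ev t (\<lambda>a b. mul K (F a b) y)"
  by (rule ev_lin[of "\<lambda>x. mul K x y"]) (intro lins)
lemma mul_ev_r: "mul K y (ev t F) = ev t (\<lambda>a b. mul K y (F a b))"
  by (rule ev_lin[of "mul K y"]) (intro lins)
lemma tv_scal_l [simp]: "tv (c \<odot> x) y = c \<odot> tv x y"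
  by (rule lin_scal[of "\<lambda>x. tv x y"]) (intro lins)
lemma tv_scal_r [simp]: "tv x (c \<odot> y) = c \<odot> tv x y"
  by (rule lin_scal[of "tv x"]) (intro lins)
lemma tv_ev_l: "tv (ev t F) y = ev t (\<lambda>a b. tv (F a b) y)"
  by (rule ev_lin[of "\<lambda>x. tv x y"]) (intro lins)
lemma tv_ev_r: "tv y (ev t F) = ev t (\<lambda>a b. tv y (F a b))"
  by (rule ev_lin[of "tv y"]) (intro lins)

lemma mul_tens_tv: "mul (tens K L) (tv a b) (tv c d) = tv (mul K a c) (mul L b d)"
proof -
  have "mul (tens K L) (tv a b) (tv c d) (p, q) = mul K a c p * mul L b d q" for p q
    by (simp add: mul_def tens_def sum_product sum_UNIV_pair mult_ac)
  then show ?thesis by (auto simp: tv_def)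
qed

lemma one_tens: "one (tens K L) = tv (one K) (one L)"
  by (simp add: one_def tens_def)

section \<open>Algebra maps with commuting images\<close>

text \<open>The axioms of \<open>is_bialg\<close> are split into \<open>alg\<close>,
  \<open>coalg\<close> and \<open>compat\<close> because the constructions below change them
  independently: co-opposites and twists keep the product, the double keeps the coproduct of the
  tensor product of \<open>H\<close> and its dual.\<close>

definition alg :: "('a::finite, 'k::field) bialg \<Rightarrow> bool" where
  "alg K \<longleftrightarrow> (\<forall>x y z. mul K (mul K x y) z = mul K x (mul K y z)) \<and>
             (\<forall>x. mul K (one K) x = x \<and> mul K x (one K) = x)"

definition alghom :: "('a::finite, 'k::field) bialg \<Rightarrow> ('b::finite, 'k) bialg \<Rightarrow> (('a \<Rightarrow> 'k) \<Rightarrow> ('b \<Rightarrow> 'k)) \<Rightarrow> bool" where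
  "alghom A K f \<longleftrightarrow> lin f \<and> (\<forall>x y. f (mul A x y) = mul K (f x) (f y)) \<and> f (one A) = one K"

definition comm :: "('b::finite, 'k::field) bialg \<Rightarrow> ('x \<Rightarrow> 'b \<Rightarrow> 'k) \<Rightarrow> ('y \<Rightarrow> 'b \<Rightarrow> 'k) \<Rightarrow> bool" where
  "comm K f g \<longleftrightarrow> (\<forall>x y. mul K (f x) (g y) = mul K (g y) (f x))"

text \<open>For maps \<open>i\<close> and \<open>j\<close> into \<open>K\<close> with commuting images, \<open>lift2 K i j t\<close> is \<open>t\<close> placed in the legs \<open>i\<close> and \<open>j\<close>
of \<open>K\<close>. A coproduct spread over two legs is again a leg.\<close>

definition lift2 :: "('c::finite, 'k::field) bialg \<Rightarrow> (('a::finite \<Rightarrow> 'k) \<Rightarrow> 'c \<Rightarrow> 'k)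
    \<Rightarrow> (('b::finite \<Rightarrow> 'k) \<Rightarrow> 'c \<Rightarrow> 'k) \<Rightarrow> ('a \<times> 'b \<Rightarrow> 'k) \<Rightarrow> 'c \<Rightarrow> 'k" where
  "lift2 K i j x = ev x (\<lambda>a b. mul K (i a) (j b))"

lemma alg_assoc: "alg K \<Longrightarrow> mul K (mul K x y) z = mul K x (mul K y z)"
  and alg_one_l [simp]: "alg K \<Longrightarrow> mul K (one K) x = x"
  and alg_one_r [simp]: "alg K \<Longrightarrow> mul K x (one K) = x"
  by (simp_all add: alg_def)

lemma alghom_lin: "alghom A K f \<Longrightarrow> lin f"
  and alghom_mul: "alghom A K f \<Longrightarrow> f (mul A x y) = mul K (f x) (f y)"
  and alghom_one: "alghom A K f \<Longrightarrow> f (one A) = one K"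
  by (simp_all add: alghom_def)

lemma alghom_compose: "alghom A B f \<Longrightarrow> alghom B C g \<Longrightarrow> alghom A C (\<lambda>x. g (f x))"
  by (simp add: alghom_def lin_compose)

lemma alghom_id: "alghom A A (\<lambda>x. x)"
  by (simp add: alghom_def lins)

lemma commD: "comm K f g \<Longrightarrow> mul K (f x) (g y) = mul K (g y) (f x)"
  by (simp add: comm_def)

lemma comm_sym: "comm K f g \<Longrightarrow> comm K g f"
  by (simp add: comm_def)

lemma comm_swap: "alg K \<Longrightarrow> comm K f g \<Longrightarrow> mul K (f x) (mul K (g y) z) = mul K (g y) (mul K (f x) z)"
  using alg_assoc[of K "f x" "g y" z] alg_assoc[of K "g y" "f x" z] commD[of K f g x y] by simp

lemma comm_image: "alghom A K h \<Longrightarrow> comm A f g \<Longrightarrow> comm K (\<lambda>x. h (f x)) (\<lambda>x. h (g x))"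
  unfolding comm_def by (simp flip: alghom_mul)

lemma comm_compose: "comm K f g \<Longrightarrow> comm K (\<lambda>x. f (p x)) (\<lambda>x. g (q x))"
  by (simp add: comm_def)

lemma comm_compose_l: "comm K f g \<Longrightarrow> comm K (\<lambda>x. f (p x)) g"
  and comm_compose_r: "comm K f g \<Longrightarrow> comm K f (\<lambda>x. g (q x))"
  by (simp_all add: comm_def)

lemma alg_tens:
  assumes K: "alg K" and L: "alg L"
  shows "alg (tens K L)"
  unfolding alg_def
proof (intro allI conjI)
  let ?m = "mul (tens K L)"
  have 1: "?m (?m (tv a b) (tv c d)) (tv e f) = ?m (tv a b) (?m (tv c d) (tv e f))" for a b c d e f
    by (simp add: mul_tens_tv alg_assoc K L)
  have 2: "?m (?m (tv a b) (tv c d)) z = ?m (tv a b) (?m (tv c d) z)" for a b c d z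
    by (rule lin_eq_tvI[of "\<lambda>z. ?m (?m (tv a b) (tv c d)) z"], (intro lins)+) (rule 1)
  have 3: "?m (?m (tv a b) y) z = ?m (tv a b) (?m y z)" for a b y z
    by (rule lin_eq_tvI[of "\<lambda>y. ?m (?m (tv a b) y) z"], (intro lins)+) (rule 2)
  show "?m (?m x y) z = ?m x (?m y z)" for x y z
    by (rule lin_eq_tvI[of "\<lambda>x. ?m (?m x y) z"], (intro lins)+) (rule 3)
  show "?m (one (tens K L)) x = x" for x
    by (rule lin_eq_tvI, (intro lins)+) (simp add: one_tens mul_tens_tv K L)
  show "?m x (one (tens K L)) = x" for x
    by (rule lin_eq_tvI[of "\<lambda>x. ?m x (one (tens K L))"], (intro lins)+) (simp add: one_tens mul_tens_tv K L)
qed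

lemma alghom_inL: "alg L \<Longrightarrow> alghom K (tens K L) (\<lambda>x. tv x (one L))"
  unfolding alghom_def by (auto simp: mul_tens_tv one_tens intro!: lins)

lemma alghom_inR: "alg K \<Longrightarrow> alghom L (tens K L) (\<lambda>x. tv (one K) x)"
  unfolding alghom_def by (auto simp: mul_tens_tv one_tens intro!: lins)

lemma comm_inL_inR: "alg K \<Longrightarrow> alg L \<Longrightarrow> comm (tens K L) (\<lambda>x. tv x (one L)) (\<lambda>x. tv (one K) x)"
  unfolding comm_def by (simp add: mul_tens_tv)

lemma lin_lift2 [lins]: "lin f \<Longrightarrow> lin (\<lambda>x. lift2 K i j (f x))"
  unfolding lift2_def by (intro lins)

lemma lin_lift2' [lins]: "lin (lift2 K i j)"
  unfolding lift2_def by (intro lins)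

lemma lift2_tv: "lin i \<Longrightarrow> lin j \<Longrightarrow> lift2 K i j (tv x y) = mul K (i x) (j y)"
  unfolding lift2_def by (rule ev_tv[of "\<lambda>a b. mul K (i a) (j b)"]) (intro lins; assumption)+

text \<open>The universal property of the tensor product of algebras. An identity between tensors
  over \<open>H\<close> is thereby moved into any algebra with suitable legs, so it is proved once
  and read in whichever legs are at hand.\<close>

lemma alghom_lift2:
  assumes K: "alg K" and i: "alghom A K i" and j: "alghom B K j" and c: "comm K i j"
  shows "alghom (tens A B) K (lift2 K i j)"
proof -
  let ?f = "lift2 K i j" and ?m = "mul (tens A B)"
  note li = alghom_lin[OF i] and lj = alghom_lin[OF j]
  have 1: "?f (?m (tv a b) (tv c d)) = mul K (?f (tv a b)) (?f (tv c d))" for a b c d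
    using comm_swap[OF K comm_sym[OF c]]
    by (simp add: mul_tens_tv lift2_tv li lj alghom_mul[OF i] alghom_mul[OF j] alg_assoc K)
  have 2: "?f (?m (tv a b) y) = mul K (?f (tv a b)) (?f y)" for a b y
    by (rule lin_eq_tvI, (intro lins)+) (rule 1)
  have "?f (?m x y) = mul K (?f x) (?f y)" for x y
    by (rule lin_eq_tvI[of "\<lambda>x. ?f (?m x y)"], (intro lins)+) (rule 2)
  then show ?thesis
    unfolding alghom_def
    by (auto simp: one_tens lift2_tv li lj alghom_one[OF i] alghom_one[OF j] K intro!: lins)
qed

lemma alghom_lift2_image:
  assumes "alghom K M f" shows "f (lift2 K i j x) = lift2 M (\<lambda>x. f (i x)) (\<lambda>x. f (j x)) x"
  unfolding lift2_def ev_lin[OF alghom_lin[OF assms]] alghom_mul[OF assms] ..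

lemma comm_lift2_l:
  assumes K: "alg K" and "comm K i l" "comm K j l"
  shows "comm K (lift2 K i j) l"
proof -
  have "mul K (mul K (i a) (j b)) (l y) = mul K (l y) (mul K (i a) (j b))" for a b y
    using comm_swap[OF assms(1,2), of a y "j b"] commD[OF assms(3), of b y] by (simp add: alg_assoc K)
  then show ?thesis
    unfolding comm_def lift2_def mul_ev_l mul_ev_r by simp
qed

lemma comm_lift2_r:
  assumes K: "alg K" and "comm K l i" "comm K l j"
  shows "comm K l (lift2 K i j)"
  by (rule comm_sym[OF comm_lift2_l[OF K comm_sym[OF assms(2)] comm_sym[OF assms(3)]]])

text \<open>For the canonical legs placement does nothing; this leads back from identities in
  arbitrary legs to identities in the tensor product itself.\<close>

lemma lift2_in:
  assumes "alg K" "alg L"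
  shows "lift2 (tens K L) (\<lambda>x. tv x (one L)) (\<lambda>y. tv (one K) y) x = x"
  using assms by (simp add: lift2_def mul_tens_tv)

lemma lift2_inv:
  assumes "alg K" "alghom (tens A B) K (lift2 K i j)" "mul (tens A B) x y = one (tens A B)"
  shows "mul K (lift2 K i j x) (lift2 K i j y) = one K"
  using alghom_mul[OF assms(2), of x y] alghom_one[OF assms(2)] assms(3) by simp

lemma alg_inv_unique:
  assumes "alg K" "mul K y x = one K" "mul K x z = one K"
  shows "y = z"
  using alg_assoc[OF assms(1), of y x z] assms by simp

lemma inv_el_eq:
  assumes "alg K" "mul K x y = one K" "mul K y x = one K"
  shows "inv_el K x = y"
proof -
  have "mul K x (inv_el K x) = one K \<and> mul K (inv_el K x) x = one K"
    unfolding inv_el_def by (rule someI[of _ y]) (use assms in simp)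
  then show ?thesis using alg_inv_unique[of K "inv_el K x" x y] assms by simp
qed

section \<open>Coalgebra axioms, compatibility and Sweedler calculus\<close>

definition coalg :: "('a::finite, 'k::field) bialg \<Rightarrow> bool" where
  "coalg K \<longleftrightarrow> (\<forall>a p q r. (\<Sum>d\<in>UNIV. dc K a d r * dc K d p q) = (\<Sum>d\<in>UNIV. dc K a p d * dc K d q r)) \<and>
     (\<forall>a c. (\<Sum>b\<in>UNIV. dc K a b c * ec K b) = bv a c) \<and>
     (\<forall>a b. (\<Sum>c\<in>UNIV. dc K a b c * ec K c) = bv a b)"

definition compat :: "('a::finite, 'k::field) bialg \<Rightarrow> bool" where
  "compat K \<longleftrightarrow> alghom K (tens K K) (cop K) \<and> (\<forall>x y. cou K (mul K x y) = cou K x * cou K y) \<and> cou K (one K) = 1"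

lemma cop_bv: "cop K (bv a) = (\<lambda>(b, c). dc K a b c)"
  by (simp add: cop_def)

lemma cou_bv: "cou K (bv a) = ec K a"
  by (simp add: cou_def)

lemma lin_cop [lins]: "lin f \<Longrightarrow> lin (\<lambda>x. cop K (f x))"
  by (auto simp: lin_iff cop_def fun_eq_iff distrib_right sum.distrib sum_distrib_left mult.assoc)

lemma lin_cop' [lins]: "lin (cop K)" using lin_cop[OF lin_id] .

lemma cou_add: "cou K (x + y) = cou K x + cou K y"
  and cou_scal [simp]: "cou K (c \<odot> x) = c * cou K x"
  by (simp_all add: cou_def distrib_right sum.distrib sum_distrib_left mult.assoc)

lemma lin_cou [lins]: "lin f \<Longrightarrow> lin (\<lambda>x. cou K (f x) \<odot> v)"
  by (simp add: lin_iff cou_add add_scal)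

abbreviation sw :: "('a::finite, 'k::field) bialg \<Rightarrow> ('a \<Rightarrow> 'k) \<Rightarrow> (('a \<Rightarrow> 'k) \<Rightarrow> ('a \<Rightarrow> 'k) \<Rightarrow> 'c \<Rightarrow> 'k) \<Rightarrow> 'c \<Rightarrow> 'k" where
  "sw K x F \<equiv> ev (cop K x) F"

lemma cop_apply: "cop K x (b, c) = (\<Sum>a\<in>UNIV. x a * dc K a b c)"
  by (simp add: cop_def)

lemma coalgD:
  assumes "coalg K"
  shows "(\<Sum>d\<in>UNIV. dc K a d r * dc K d p q) = (\<Sum>d\<in>UNIV. dc K a p d * dc K d q r)"
    and "(\<Sum>b\<in>UNIV. dc K a b c * ec K b) = bv a c"
    and "(\<Sum>c\<in>UNIV. dc K a b c * ec K c) = bv a b"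
  using assms unfolding coalg_def by simp_all

lemma sum_swap3: "(\<Sum>x\<in>A. \<Sum>y\<in>B. \<Sum>z\<in>C. f x y z) = (\<Sum>z\<in>C. \<Sum>x\<in>A. \<Sum>y\<in>B. f x y z)"
  for f :: "_ \<Rightarrow> _ \<Rightarrow> _ \<Rightarrow> 'a::comm_monoid_add"
proof -
  have "(\<Sum>x\<in>A. \<Sum>y\<in>B. \<Sum>z\<in>C. f x y z) = (\<Sum>x\<in>A. \<Sum>z\<in>C. \<Sum>y\<in>B. f x y z)"
    by (rule sum.cong[OF refl]) (rule sum.swap)
  also have "\<dots> = (\<Sum>z\<in>C. \<Sum>x\<in>A. \<Sum>y\<in>B. f x y z)" by (rule sum.swap)
  finally show ?thesis .
qed

lemma coalg_coassoc:
  assumes "coalg K"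
  shows "sw K x (\<lambda>a c. sw K a (\<lambda>p q. F p q c)) = sw K x (\<lambda>p d. sw K d (\<lambda>q r. F p q r))"
proof (rule lin_eqI[of "\<lambda>x. sw K x (\<lambda>a c. sw K a (\<lambda>p q. F p q c))"])
  fix a
  let ?F = "\<lambda>p q r. F (bv p) (bv q) (bv r)"
  have "sw K (bv a) (\<lambda>a c. sw K a (\<lambda>p q. F p q c)) = (\<Sum>d\<in>UNIV. \<Sum>r\<in>UNIV. \<Sum>p\<in>UNIV. \<Sum>q\<in>UNIV. (dc K a d r * dc K d p q) \<odot> ?F p q r)"
    by (simp add: ev_sum cop_bv scal_sum del: sum_fun_apply)
  also have "\<dots> = (\<Sum>r\<in>UNIV. \<Sum>p\<in>UNIV. \<Sum>d\<in>UNIV. \<Sum>q\<in>UNIV. (dc K a d r * dc K d p q) \<odot> ?F p q r)"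
    by (subst sum.swap, rule sum.cong[OF refl], rule sum.swap)
  also have "\<dots> = (\<Sum>r\<in>UNIV. \<Sum>p\<in>UNIV. \<Sum>q\<in>UNIV. \<Sum>d\<in>UNIV. (dc K a d r * dc K d p q) \<odot> ?F p q r)"
    by (rule sum.cong[OF refl], rule sum.cong[OF refl], rule sum.swap)
  also have "\<dots> = (\<Sum>p\<in>UNIV. \<Sum>q\<in>UNIV. \<Sum>r\<in>UNIV. (\<Sum>d\<in>UNIV. dc K a d r * dc K d p q) \<odot> ?F p q r)"
    by (subst sum_swap3[symmetric]) (simp only: sum_scal)
  also have "\<dots> = (\<Sum>p\<in>UNIV. \<Sum>q\<in>UNIV. \<Sum>r\<in>UNIV. (\<Sum>d\<in>UNIV. dc K a p d * dc K d q r) \<odot> ?F p q r)"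
    by (simp only: coalgD(1)[OF assms])
  also have "\<dots> = (\<Sum>p\<in>UNIV. \<Sum>d\<in>UNIV. \<Sum>q\<in>UNIV. \<Sum>r\<in>UNIV. (dc K a p d * dc K d q r) \<odot> ?F p q r)"
    unfolding sum_scal by (rule sum.cong[OF refl], rule sum_swap3)
  also have "\<dots> = sw K (bv a) (\<lambda>p d. sw K d (\<lambda>q r. F p q r))"
    by (simp add: ev_sum cop_bv scal_sum del: sum_fun_apply)
  finally show "sw K (bv a) (\<lambda>a c. sw K a (\<lambda>p q. F p q c)) = sw K (bv a) (\<lambda>p d. sw K d (\<lambda>q r. F p q r))" .
qed (intro lins)+

lemma coalg_counit_l: assumes "coalg K" "lin G" shows "sw K x (\<lambda>a b. cou K a \<odot> G b) = G x"
proof (rule lin_eqI[of "\<lambda>x. sw K x (\<lambda>a b. cou K a \<odot> G b)"])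
  fix a
  have "sw K (bv a) (\<lambda>a b. cou K a \<odot> G b) = (\<Sum>c\<in>UNIV. \<Sum>b\<in>UNIV. (dc K a b c * ec K b) \<odot> G (bv c))"
    by (subst sum.swap) (simp add: ev_sum cop_bv cou_bv del: sum_fun_apply)
  also have "\<dots> = (\<Sum>c\<in>UNIV. (\<Sum>b\<in>UNIV. dc K a b c * ec K b) \<odot> G (bv c))"
    by (simp only: sum_scal)
  also have "\<dots> = (\<Sum>c\<in>UNIV. bv a c \<odot> G (bv c))"
    by (simp only: coalgD(2)[OF assms(1)])
  finally show "sw K (bv a) (\<lambda>a b. cou K a \<odot> G b) = G (bv a)"
    by (simp only: lin_expand[OF assms(2), symmetric])
qed ((intro lins)+, rule assms(2))

lemma coalg_counit_r: assumes "coalg K" "lin G" shows "sw K x (\<lambda>a b. cou K b \<odot> G a) = G x"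
proof (rule lin_eqI[of "\<lambda>x. sw K x (\<lambda>a b. cou K b \<odot> G a)"])
  fix a
  have "sw K (bv a) (\<lambda>a b. cou K b \<odot> G a) = (\<Sum>b\<in>UNIV. \<Sum>c\<in>UNIV. (dc K a b c * ec K c) \<odot> G (bv b))"
    by (simp add: ev_sum cop_bv cou_bv del: sum_fun_apply)
  also have "\<dots> = (\<Sum>b\<in>UNIV. (\<Sum>c\<in>UNIV. dc K a b c * ec K c) \<odot> G (bv b))"
    by (simp only: sum_scal)
  also have "\<dots> = (\<Sum>c\<in>UNIV. bv a c \<odot> G (bv c))"
    by (simp only: coalgD(3)[OF assms(1)])
  finally show "sw K (bv a) (\<lambda>a b. cou K b \<odot> G a) = G (bv a)"
    by (simp only: lin_expand[OF assms(2), symmetric])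
qed ((intro lins)+, rule assms(2))

text \<open>Both sides of each coalgebra axiom are linear in the vector, so the axioms for all
  vectors come down to those for structure constants. In the latter form \<open>coalg\<close> passes
  at once to any structure with the same \<open>dc\<close> and \<open>ec\<close>.\<close>

lemma is_bialg_iff: "is_bialg K \<longleftrightarrow> alg K \<and> coalg K \<and> compat K"
proof -
  let ?l = "\<lambda>x. (\<lambda>((a, b), c). \<Sum>d\<in>UNIV. cop K x (d, c) * dc K d a b)"
  let ?r = "\<lambda>x. (\<lambda>((a, b), c). \<Sum>d\<in>UNIV. cop K x (a, d) * dc K d b c)"
  let ?u = "\<lambda>x c. \<Sum>b\<in>UNIV. cop K x (b, c) * ec K b" and ?v = "\<lambda>x b. \<Sum>c\<in>UNIV. cop K x (b, c) * ec K c"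
  have lr: "lin ?l" "lin ?r" "lin ?u" "lin ?v"
    by (auto simp: lin_iff lin_add[OF lin_cop'] lin_scal[OF lin_cop'] fun_eq_iff distrib_right sum.distrib sum_distrib_left mult.assoc)
  have "(\<forall>x. ?l x = ?r x) \<longleftrightarrow> (\<forall>a. ?l (bv a) = ?r (bv a))"
    using lin_eqI[OF lr(1,2)] by blast
  moreover have "(\<forall>x. ?u x = x) \<longleftrightarrow> (\<forall>a. ?u (bv a) = bv a)"
    using lin_eqI[OF lr(3) lin_id] by blast
  moreover have "(\<forall>x. ?v x = x) \<longleftrightarrow> (\<forall>a. ?v (bv a) = bv a)"
    using lin_eqI[OF lr(4) lin_id] by blast
  ultimately have "coalg K \<longleftrightarrow> (\<forall>x. ?l x = ?r x) \<and> (\<forall>x. ?u x = x \<and> ?v x = x)"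
    unfolding coalg_def by (simp add: cop_bv fun_eq_iff all_conj_distrib)
  then show ?thesis
    unfolding is_bialg_def alg_def compat_def alghom_def using lin_cop'[of K] by blast
qed

section \<open>Antipodes and bialgebra isomorphisms\<close>

definition antipode :: "('a::finite, 'k::field) bialg \<Rightarrow> (('a \<Rightarrow> 'k) \<Rightarrow> 'a \<Rightarrow> 'k) \<Rightarrow> bool" where
  "antipode K S \<longleftrightarrow> lin S \<and> (\<forall>x. sw K x (\<lambda>a b. mul K (S a) b) = cou K x \<odot> one K) \<and>
     (\<forall>x. sw K x (\<lambda>a b. mul K a (S b)) = cou K x \<odot> one K)"

text \<open>Unlike \<open>hopf_iso\<close> this presupposes no axioms for \<open>K\<close> and
  \<open>L\<close>, so it can serve to carry axioms from one to the other.\<close>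

definition bialg_iso :: "('a::finite, 'k::field) bialg \<Rightarrow> ('b::finite, 'k) bialg \<Rightarrow> (('a \<Rightarrow> 'k) \<Rightarrow> 'b \<Rightarrow> 'k) \<Rightarrow> bool" where
  "bialg_iso K L f \<longleftrightarrow> bij f \<and> alghom K L f \<and> (\<forall>x. cop L (f x) = tensmap f f (cop K x)) \<and> (\<forall>x. cou L (f x) = cou K x)"

lemma lin_app [lins]: "lin f \<Longrightarrow> lin (\<lambda>x. app s (f x))"
  by (auto simp: lin_iff app_def fun_eq_iff distrib_right sum.distrib sum_distrib_left mult.assoc)

lemma lin_eq_app: assumes "lin S" shows "S = app (\<lambda>a. S (bv a))"
proof
  fix x show "S x = app (\<lambda>a. S (bv a)) x"
    by (subst lin_expand[OF assms]) (auto simp: app_def)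
qed

lemma is_antipode_iff: "is_antipode K s \<longleftrightarrow> antipode K (app s)"
  unfolding is_antipode_def antipode_def
  by (simp add: lin_app lin_id fun_eq_iff ev_apply sum_UNIV_pair all_conj_distrib)

lemma is_hopf_iff: "is_hopf K \<longleftrightarrow> is_bialg K \<and> (\<exists>S. antipode K S)"
  unfolding is_hopf_def is_antipode_iff by (metis lin_eq_app antipode_def)

lemma antipode_lin: "antipode K S \<Longrightarrow> lin S"
  and antipode_l: "antipode K S \<Longrightarrow> sw K x (\<lambda>a b. mul K (S a) b) = cou K x \<odot> one K"
  and antipode_r: "antipode K S \<Longrightarrow> sw K x (\<lambda>a b. mul K a (S b)) = cou K x \<odot> one K"
  by (simp_all add: antipode_def)

lemma antipode_l_lin:
  assumes "antipode K S" "lin G"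
  shows "sw K x (\<lambda>a b. G (mul K (S a) b)) = cou K x \<odot> G (one K)"
  using ev_lin[OF assms(2), of "cop K x" "\<lambda>a b. mul K (S a) b"] lin_scal[OF assms(2)]
  by (simp add: antipode_l[OF assms(1)])

lemma antipode_r_lin:
  assumes "antipode K S" "lin G"
  shows "sw K x (\<lambda>a b. G (mul K a (S b))) = cou K x \<odot> G (one K)"
  using ev_lin[OF assms(2), of "cop K x" "\<lambda>a b. mul K a (S b)"] lin_scal[OF assms(2)]
  by (simp add: antipode_r[OF assms(1)])

text \<open>Antipodes are two-sided convolution inverses of the identity, so S = S * (id * S') = (S
  * id) * S' = S'.\<close>

lemma antipode_unique:
  assumes K: "alg K" "coalg K" and S: "antipode K S" and S': "antipode K S'"
  shows "S = S'"
proof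
  fix x
  note l [lins] = antipode_lin[OF S] antipode_lin[OF S'] lin_compose[OF antipode_lin[OF S]] lin_compose[OF antipode_lin[OF S']]
  have "S x = sw K x (\<lambda>a b. cou K b \<odot> S a)"
    by (rule coalg_counit_r[OF K(2), symmetric]) (intro lins)
  also have "\<dots> = sw K x (\<lambda>a b. sw K b (\<lambda>c d. mul K (S a) (mul K c (S' d))))"
    by (simp add: antipode_r_lin[OF S', where G = "mul K (S _)"] lins K)
  also have "\<dots> = sw K x (\<lambda>b d. sw K b (\<lambda>a c. mul K (mul K (S a) c) (S' d)))"
    by (simp add: coalg_coassoc[OF K(2)] alg_assoc[OF K(1)])
  also have "\<dots> = sw K x (\<lambda>b d. cou K b \<odot> S' d)"
    by (simp add: antipode_l_lin[OF S, where G = "\<lambda>y. mul K y (S' _)"] lins K)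
  also have "\<dots> = S' x"
    by (rule coalg_counit_l[OF K(2)]) (intro lins)
  finally show "S x = S' x" .
qed

text \<open>By uniqueness the choice operator inside \<open>antip\<close> returns whichever antipode
  has been exhibited.\<close>

lemma antip_eq:
  assumes K: "alg K" "coalg K" and S: "antipode K S"
  shows "antip K = S"
proof -
  have "is_antipode K (\<lambda>a. S (bv a))"
    using S lin_eq_app[OF antipode_lin[OF S]] by (simp add: is_antipode_iff)
  then have "is_antipode K (SOME s. is_antipode K s)" by (rule someI[where P = "is_antipode K"])
  then have "antipode K (antip K)" by (simp add: is_antipode_iff antip_def)
  then show ?thesis by (rule antipode_unique[OF K _ S])
qed

lemma tensmap_ev: "tensmap f g T = ev T (\<lambda>a b. tv (f a) (g b))"
  by (auto simp: tensmap_def ev_apply fun_eq_iff sum_UNIV_pair mult.assoc)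

lemma lin_tensmap [lins]: "lin h \<Longrightarrow> lin (\<lambda>x. tensmap f g (h x))"
  unfolding tensmap_ev by (intro lins)

lemma ev_tensmap:
  assumes "\<And>a. lin (F a)" "\<And>b. lin (\<lambda>a. F a b)"
  shows "ev (tensmap f g T) F = ev T (\<lambda>a b. F (f a) (g b))"
  unfolding tensmap_ev ev_ev by (simp add: ev_tv[OF assms])

lemma tensmap_tv: "lin f \<Longrightarrow> lin g \<Longrightarrow> tensmap f g (tv x y) = tv (f x) (g y)"
  unfolding tensmap_ev by (rule ev_tv[of "\<lambda>a b. tv (f a) (g b)"]) (intro lins; assumption)+

lemma bisoD:
  assumes "bialg_iso K L f"
  shows "bij f" "alghom K L f" "lin f" "f (mul K x y) = mul L (f x) (f y)" "f (one K) = one L"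
    "cop L (f x) = tensmap f f (cop K x)" "cou L (f x) = cou K x"
  using assms by (simp_all add: bialg_iso_def alghom_def)

lemma tensmap_tensmap:
  assumes "lin f" "lin g"
  shows "tensmap f g (tensmap f' g' T) = tensmap (\<lambda>x. f (f' x)) (\<lambda>x. g (g' x)) T"
  unfolding tensmap_ev[of f g] tensmap_ev[of "\<lambda>x. f (f' x)"]
  by (rule ev_tensmap) (intro lins assms)+

lemma tensmap_id: "tensmap (\<lambda>x. x) (\<lambda>x. x) T = T"
  by (simp add: tensmap_ev)

lemma lin_inv:
  assumes "lin f" "bij f" shows "lin (inv f)"
proof (rule linI)
  note fi = bij_is_surj[OF assms(2)] and ii = bij_is_inj[OF assms(2)]
  show "inv f (x + y) = inv f x + inv f y" for x y
    by (rule inv_f_eq[OF ii]) (simp only: lin_add[OF assms(1)] surj_f_inv_f[OF fi])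
  show "inv f (c \<odot> x) = c \<odot> inv f x" for c x
    by (rule inv_f_eq[OF ii]) (simp only: lin_scal[OF assms(1)] surj_f_inv_f[OF fi])
qed

lemma bialg_iso_inv:
  assumes f: "bialg_iso K L f" shows "bialg_iso L K (inv f)"
proof -
  note F = bisoD[OF f]
  have r: "f (inv f x) = x" and l: "inv f (f y) = y" for x y
    using F(1) by (simp_all add: bij_is_surj surj_f_inv_f bij_is_inj)
  note li = lin_inv[OF F(3,1)]
  have "inv f (mul L x y) = mul K (inv f x) (inv f y)" for x y
    using F(4)[of "inv f x" "inv f y"] l by (metis r)
  moreover have "inv f (one L) = one K" using l F(5) by metis
  moreover have "cop K (inv f x) = tensmap (inv f) (inv f) (cop L x)" for x
  proof -
    have "tensmap (inv f) (inv f) (cop L x) = tensmap (inv f) (inv f) (tensmap f f (cop K (inv f x)))"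
      using F(6)[of "inv f x"] by (simp add: r)
    then show ?thesis by (simp add: tensmap_tensmap li l tensmap_id)
  qed
  moreover have "cou K (inv f x) = cou L x" for x
    using F(7)[of "inv f x"] by (simp add: r)
  ultimately show ?thesis
    using F(1) li by (simp add: bialg_iso_def alghom_def bij_imp_bij_inv)
qed

lemma bialg_iso_compose:
  assumes f: "bialg_iso K L f" and g: "bialg_iso L M g" shows "bialg_iso K M (\<lambda>x. g (f x))"
  unfolding bialg_iso_def
proof (intro conjI allI)
  show "bij (\<lambda>x. g (f x))"
    using bij_comp[OF bisoD(1)[OF f] bisoD(1)[OF g]] by (simp add: o_def)
  show "alghom K M (\<lambda>x. g (f x))"
    by (rule alghom_compose[OF bisoD(2)[OF f] bisoD(2)[OF g]])
  show "cop M (g (f x)) = tensmap (\<lambda>x. g (f x)) (\<lambda>x. g (f x)) (cop K x)" for x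
    by (simp only: bisoD(6)[OF f] bisoD(6)[OF g] tensmap_tensmap[OF bisoD(3)[OF g] bisoD(3)[OF g]])
  show "cou M (g (f x)) = cou K x" for x
    by (simp only: bisoD(7)[OF f] bisoD(7)[OF g])
qed

lemma bialg_iso_alg: assumes f: "bialg_iso K L f" and K: "alg K" shows "alg L"
  unfolding alg_def
proof (intro allI conjI)
  note F = bisoD[OF f]
  obtain g where g: "\<And>x. f (g x) = x" using bij_is_surj[OF F(1)] by (meson surj_f_inv_f)
  show "mul L (mul L x y) z = mul L x (mul L y z)" for x y z
    using arg_cong[OF alg_assoc[OF K, of "g x" "g y" "g z"], of f] by (simp only: F(4) g)
  show "mul L (one L) x = x" for x
    using arg_cong[OF alg_one_l[OF K, of "g x"], of f] by (simp only: F(4,5) g)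
  show "mul L x (one L) = x" for x
    using arg_cong[OF alg_one_r[OF K, of "g x"], of f] by (simp only: F(4,5) g)
qed

lemma bv_sym: "bv a b = bv b a"
  by (simp add: bv_def)

lemma sum_bv_r [simp]: "(\<Sum>a\<in>UNIV. f a * bv p a) = f p" for p :: "'a::finite"
  using sum_bv[of p f] by (simp add: mult.commute)

lemma sum_bv_r' [simp]: "(\<Sum>a\<in>UNIV. f a * bv a p) = f p" for p :: "'a::finite"
  using sum_bv_r[of f p] by (simp add: bv_sym)

text \<open>The coordinates of the tensors \<open>tv p (tv q c)\<close> recover all structure
  constants, so testing coassociativity on this one trilinear function suffices.\<close>

lemma coalgI:
  assumes "\<And>x. sw K x (\<lambda>a c. sw K a (\<lambda>p q. tv p (tv q c))) = sw K x (\<lambda>p d. sw K d (\<lambda>q r. tv p (tv q r)))"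
    and "\<And>x. sw K x (\<lambda>a b. cou K a \<odot> b) = x" and "\<And>x. sw K x (\<lambda>a b. cou K b \<odot> a) = x"
  shows "coalg K"
  unfolding coalg_def
proof (intro conjI allI)
  fix a p q r
  have "sw K (bv a) (\<lambda>a c. sw K a (\<lambda>p q. tv p (tv q c))) (p, q, r) = (\<Sum>d\<in>UNIV. dc K a d r * dc K d p q)"
    by (simp add: ev_apply cop_bv mult.assoc[symmetric] flip: sum_distrib_right)
  moreover have "sw K (bv a) (\<lambda>p d. sw K d (\<lambda>q r. tv p (tv q r))) (p, q, r) = (\<Sum>d\<in>UNIV. dc K a p d * dc K d q r)"
    by (simp add: ev_apply cop_bv mult.assoc[symmetric] flip: sum_distrib_right)
  ultimately show "(\<Sum>d\<in>UNIV. dc K a d r * dc K d p q) = (\<Sum>d\<in>UNIV. dc K a p d * dc K d q r)"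
    using assms(1)[of "bv a"] by simp
next
  fix a c
  show "(\<Sum>b\<in>UNIV. dc K a b c * ec K b) = bv a c"
    using fun_cong[OF assms(2)[of "bv a"], of c]
    by (simp add: ev_apply cop_bv cou_bv mult.assoc[symmetric])
  show "(\<Sum>b\<in>UNIV. dc K a c b * ec K b) = bv a c"
    using fun_cong[OF assms(3)[of "bv a"], of c]
    by (simp add: ev_apply cop_bv cou_bv mult.assoc[symmetric] flip: sum_distrib_right)
qed

lemma bialg_iso_sw:
  assumes f: "bialg_iso K L f" and F: "\<And>a. lin (F a)" "\<And>b. lin (\<lambda>a. F a b)"
  shows "sw L (f x) F = sw K x (\<lambda>a b. F (f a) (f b))"
  unfolding bisoD(6)[OF f] by (rule ev_tensmap[OF F])

lemma bialg_iso_coalg: assumes f: "bialg_iso K L f" and K: "coalg K" shows "coalg L"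
proof (rule coalgI)
  note F = bisoD[OF f]
  note [lins] = F(3) lin_compose[OF F(3)]
  obtain g where g: "\<And>x. f (g x) = x" using bij_is_surj[OF F(1)] by (meson surj_f_inv_f)
  fix x'
  define x where "x = g x'"
  have x: "x' = f x" by (simp add: x_def g)
  have "sw L (f x) (\<lambda>a c. sw L a (\<lambda>p q. tv p (tv q c))) = sw K x (\<lambda>a c. sw L (f a) (\<lambda>p q. tv p (tv q (f c))))"
    by (rule bialg_iso_sw[OF f]) (intro lins)+
  also have "\<dots> = sw K x (\<lambda>a c. sw K a (\<lambda>p q. tv (f p) (tv (f q) (f c))))"
    by (rule ev_cong, rule bialg_iso_sw[OF f]) (intro lins)+
  also have "\<dots> = sw K x (\<lambda>p d. sw K d (\<lambda>q r. tv (f p) (tv (f q) (f r))))"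
    by (rule coalg_coassoc[OF K])
  also have "\<dots> = sw K x (\<lambda>p d. sw L (f d) (\<lambda>q r. tv (f p) (tv q r)))"
    by (rule ev_cong, rule bialg_iso_sw[OF f, symmetric]) (intro lins)+
  also have "\<dots> = sw L (f x) (\<lambda>p d. sw L d (\<lambda>q r. tv p (tv q r)))"
    by (rule bialg_iso_sw[OF f, symmetric, where F = "\<lambda>p d. sw L d (\<lambda>q r. tv p (tv q r))"]) (intro lins)+
  finally show "sw L x' (\<lambda>a c. sw L a (\<lambda>p q. tv p (tv q c))) = sw L x' (\<lambda>p d. sw L d (\<lambda>q r. tv p (tv q r)))"
    by (simp only: x)
  have "sw L (f x) (\<lambda>a b. cou L a \<odot> b) = sw K x (\<lambda>a b. cou K a \<odot> f b)"
    by (subst bialg_iso_sw[OF f]) ((intro lins)+, simp only: F(7))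
  then show "sw L x' (\<lambda>a b. cou L a \<odot> b) = x'"
    by (simp only: x coalg_counit_l[OF K F(3)])
  have "sw L (f x) (\<lambda>a b. cou L b \<odot> a) = sw K x (\<lambda>a b. cou K b \<odot> f a)"
    by (subst bialg_iso_sw[OF f]) ((intro lins)+, simp only: F(7))
  then show "sw L x' (\<lambda>a b. cou L b \<odot> a) = x'"
    by (simp only: x coalg_counit_r[OF K F(3)])
qed

text \<open>Read as a placement in two commuting legs, \<open>tensmap\<close> inherits
  multiplicativity from \<open>alghom_lift2\<close>.\<close>

lemma tensmap_lift2:
  assumes "alg L" "alg L'"
  shows "tensmap f g x = lift2 (tens L L') (\<lambda>x. tv (f x) (one L')) (\<lambda>x. tv (one L) (g x)) x"
  using assms by (simp add: tensmap_ev lift2_def mul_tens_tv)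

lemma alghom_tensmap:
  assumes L: "alg L" "alg L'" and f: "alghom A L f" and g: "alghom B L' g"
  shows "alghom (tens A B) (tens L L') (tensmap f g)"
proof -
  have "tensmap f g = lift2 (tens L L') (\<lambda>x. tv (f x) (one L')) (\<lambda>x. tv (one L) (g x))"
    using tensmap_lift2[OF L] by blast
  then show ?thesis
    using alghom_lift2[OF alg_tens[OF L] alghom_compose[OF f alghom_inL[OF L(2)]]
        alghom_compose[OF g alghom_inR[OF L(1)]] comm_compose[OF comm_inL_inR[OF L]]] by simp
qed

lemma bialg_iso_compat: assumes f: "bialg_iso K L f" and K: "alg K" "compat K" shows "compat L"
  unfolding compat_def
proof (intro conjI allI)
  note F = bisoD[OF f]
  note L = bialg_iso_alg[OF f K(1)]
  obtain g where g: "\<And>x. f (g x) = x" using bij_is_surj[OF F(1)] by (meson surj_f_inv_f)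
  note T = alghom_tensmap[OF L L F(2) F(2)]
  have cK: "alghom K (tens K K) (cop K)" and eK: "cou K (mul K x y) = cou K x * cou K y" "cou K (one K) = 1" for x y
    using K(2) by (simp_all add: compat_def)
  show "cou L (mul L x y) = cou L x * cou L y" for x y
    using eK(1)[of "g x" "g y"] F(4,7) g by metis
  show "cou L (one L) = 1"
    using eK(2) F(5,7) by metis
  have "cop L (mul L (f x) (f y)) = mul (tens L L) (cop L (f x)) (cop L (f y))" for x y
    by (simp only: F(4)[symmetric] F(6) alghom_mul[OF cK] alghom_mul[OF T])
  then have "cop L (mul L x y) = mul (tens L L) (cop L x) (cop L y)" for x y
    by (metis g)
  moreover have "cop L (one L) = one (tens L L)"
    by (simp only: F(5)[symmetric] F(6) alghom_one[OF cK] alghom_one[OF T])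
  ultimately show "alghom L (tens L L) (cop L)" by (simp add: alghom_def lins)
qed

lemma bialg_iso_antipode: assumes f: "bialg_iso K L f" and S: "antipode K S" shows "antipode L (\<lambda>x. f (S (inv f x)))"
  unfolding antipode_def
proof (intro conjI allI)
  note F = bisoD[OF f]
  note [lins] = F(3) lin_compose[OF F(3)] lin_compose[OF antipode_lin[OF S]] lin_inv[OF F(3,1)] lin_compose[OF lin_inv[OF F(3,1)]]
  show "lin (\<lambda>x. f (S (inv f x)))" by (intro lins)
  fix x'
  define x where "x = inv f x'"
  have x: "x' = f x" and i: "\<And>x. inv f (f x) = x"
    using F(1) by (simp_all add: x_def bij_is_inj bij_is_surj surj_f_inv_f)
  have "sw L (f x) (\<lambda>a b. mul L (f (S (inv f a))) b) = sw K x (\<lambda>a b. f (mul K (S a) b))"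
    by (subst bialg_iso_sw[OF f]) ((intro lins)+, simp only: F(4) i)
  then show "sw L x' (\<lambda>a b. mul L (f (S (inv f a))) b) = cou L x' \<odot> one L"
    by (simp only: x antipode_l_lin[OF S F(3)] F(5,7))
  have "sw L (f x) (\<lambda>a b. mul L a (f (S (inv f b)))) = sw K x (\<lambda>a b. f (mul K a (S b)))"
    by (subst bialg_iso_sw[OF f]) ((intro lins)+, simp only: F(4) i)
  then show "sw L x' (\<lambda>a b. mul L a (f (S (inv f b)))) = cou L x' \<odot> one L"
    by (simp only: x antipode_r_lin[OF S F(3)] F(5,7))
qed

lemma bialg_iso_is_hopf: assumes f: "bialg_iso K L f" and K: "is_hopf K" shows "is_hopf L"
  using K bialg_iso_alg[OF f] bialg_iso_coalg[OF f] bialg_iso_compat[OF f] bialg_iso_antipode[OF f]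
  unfolding is_hopf_iff is_bialg_iff by blast

text \<open>Compatibility with antipodes is automatic: conjugating the antipode of \<open>K\<close>
  by \<open>f\<close> gives an antipode of \<open>L\<close>, and antipodes are unique. That
  \<open>L\<close> is Hopf at all is part of the conclusion.\<close>

lemma bialg_iso_hopf_iso: assumes f: "bialg_iso K L f" and K: "is_hopf K" shows "hopf_iso K L f"
proof -
  note F = bisoD[OF f]
  obtain S where S: "antipode K S" and K': "alg K" "coalg K"
    using K unfolding is_hopf_iff is_bialg_iff by blast
  have "antip L = (\<lambda>x. f (S (inv f x)))"
    by (rule antip_eq[OF bialg_iso_alg[OF f K'(1)] bialg_iso_coalg[OF f K'(2)] bialg_iso_antipode[OF f S]])
  then have "f (antip K x) = antip L (f x)" for x
    using F(1) by (simp add: antip_eq[OF K' S] bij_is_inj)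
  then show ?thesis
    using F K bialg_iso_is_hopf[OF f K] unfolding hopf_iso_def by blast
qed

lemma sw_mul:
  assumes K: "compat K" and F: "\<And>a. lin (F a)" "\<And>b. lin (\<lambda>a. F a b)"
  shows "sw K (mul K x y) F = sw K x (\<lambda>a b. sw K y (\<lambda>c d. F (mul K a c) (mul K b d)))"
proof -
  have "cop K (mul K x y) = mul (tens K K) (cop K x) (cop K y)"
    using K by (simp add: compat_def alghom_def)
  also have "\<dots> = mul (tens K K) (sw K x tv) (sw K y tv)" by simp
  also have "\<dots> = sw K x (\<lambda>a b. sw K y (\<lambda>c d. tv (mul K a c) (mul K b d)))"
    by (simp only: mul_ev_l) (simp only: mul_ev_r mul_tens_tv)
  finally show ?thesis by (simp only: ev_ev ev_tv[OF F])
qed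

lemma sw_one:
  assumes K: "compat K" and F: "\<And>a. lin (F a)" "\<And>b. lin (\<lambda>a. F a b)"
  shows "sw K (one K) F = F (one K) (one K)"
  using K by (simp add: compat_def alghom_def one_tens ev_tv[OF F])

lemma antipode_one: assumes "alg K" "compat K" and S: "antipode K S" shows "S (one K) = one K"
proof -
  have "sw K (one K) (\<lambda>a b. mul K (S a) b) = S (one K)"
    by (subst sw_one[OF assms(2)]) ((intro lins lin_compose[OF antipode_lin[OF S]])+, simp add: assms(1))
  then show ?thesis using assms(2) by (simp add: antipode_l[OF S] compat_def)
qed

text \<open>Both sides are convolution inverse to the product on K \<otimes> K. The chain expands
  S(x y) to S(x_1 y_1) x_2 y_2 S(y_3) S(x_3) by the right antipode axiom for y and x, then collapses
  the first three factors by the left axiom for the product x_1 y_1.\<close>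

lemma antipode_mul:
  assumes K: "alg K" "coalg K" "compat K" and S: "antipode K S"
  shows "S (mul K x y) = mul K (S y) (S x)"
proof -
  note [lins] = antipode_lin[OF S] lin_compose[OF antipode_lin[OF S]]
  note A = alg_assoc[OF K(1)]
  have e: "cou K (mul K a b) = cou K a * cou K b" for a b using K(3) by (simp add: compat_def)
  have "S (mul K x y) = sw K x (\<lambda>a b. cou K b \<odot> S (mul K a y))"
    by (rule coalg_counit_r[OF K(2), symmetric]) (intro lins)
  also have "\<dots> = sw K x (\<lambda>a b. cou K b \<odot> sw K y (\<lambda>c d. cou K d \<odot> S (mul K a c)))"
    by (subst coalg_counit_r[OF K(2), where G = "\<lambda>c. S (mul K _ c)"]) (intro lins refl)+
  also have "\<dots> = sw K x (\<lambda>a b. sw K y (\<lambda>c d. sw K b (\<lambda>b1 b2. cou K d \<odot> mul K (S (mul K a c)) (mul K b1 (S b2)))))"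
    by (subst antipode_r_lin[OF S, where G = "\<lambda>z. cou K _ \<odot> mul K (S (mul K _ _)) z"])
      ((intro lins)+, simp add: ev_scal K mult.commute)
  also have "\<dots> = sw K x (\<lambda>a b. sw K y (\<lambda>c d. sw K b (\<lambda>b1 b2. sw K d (\<lambda>d1 d2.
      mul K (S (mul K a c)) (mul K b1 (mul K (mul K d1 (S d2)) (S b2))))))) "
    by (subst antipode_r_lin[OF S, where G = "\<lambda>z. mul K (S (mul K _ _)) (mul K _ (mul K z (S _)))"])
      ((intro lins)+, simp add: K)
  also have "\<dots> = sw K x (\<lambda>a b. sw K b (\<lambda>b1 b2. sw K y (\<lambda>c d. sw K d (\<lambda>d1 d2.
      mul K (mul K (S (mul K a c)) (mul K b1 d1)) (mul K (S d2) (S b2))))))"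
    by (subst (2) ev_swap) (simp add: A)
  also have "\<dots> = sw K x (\<lambda>a b. sw K a (\<lambda>a1 b1. sw K y (\<lambda>c d. sw K c (\<lambda>c1 d1.
      mul K (mul K (S (mul K a1 c1)) (mul K b1 d1)) (mul K (S d) (S b))))))"
    by (simp only: coalg_coassoc[OF K(2)])
  also have "\<dots> = sw K x (\<lambda>a b. sw K y (\<lambda>c d. sw K (mul K a c) (\<lambda>p q.
      mul K (mul K (S p) q) (mul K (S d) (S b)))))"
    by (subst sw_mul[OF K(3)]) ((intro lins)+, subst (2) ev_swap, rule refl)
  also have "\<dots> = sw K x (\<lambda>a b. sw K y (\<lambda>c d. (cou K a * cou K c) \<odot> (mul K (S d) (S b))))"
    by (subst antipode_l_lin[OF S, where G = "\<lambda>z. mul K z _"]) ((intro lins)+, simp add: K e)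
  also have "\<dots> = sw K x (\<lambda>a b. cou K a \<odot> sw K y (\<lambda>c d. cou K c \<odot> (mul K (S d) (S b))))"
    by (simp add: ev_scal)
  also have "\<dots> = sw K x (\<lambda>a b. cou K a \<odot> mul K (S y) (S b))"
    by (subst coalg_counit_l[OF K(2), where G = "\<lambda>d. mul K (S d) _"]) (intro lins refl)+
  also have "\<dots> = mul K (S y) (S x)"
    by (rule coalg_counit_l[OF K(2)]) (intro lins)
  finally show ?thesis .
qed

section \<open>Co-opposite, tensor product and dual\<close>

lemma alghom_cop: "compat K \<Longrightarrow> alghom K (tens K K) (cop K)"
  by (simp add: compat_def)

lemma mul_cop_of [simp]: "mul (cop_of K) = mul K"
  by (intro ext) (simp add: mul_def cop_of_def)

lemma one_cop_of [simp]: "one (cop_of K) = one K"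
  by (simp add: one_def cop_of_def)

lemma cou_cop_of [simp]: "cou (cop_of K) = cou K"
  by (intro ext) (simp add: cou_def cop_of_def)

lemma mul_tens_cop_of: "mul (tens (cop_of K) (cop_of K)) = mul (tens K K)"
  by (intro ext) (simp add: mul_def tens_def cop_of_def)

lemma alg_cop_of [simp]: "alg (cop_of K) = alg K"
  unfolding alg_def mul_cop_of one_cop_of ..

lemma alghom_cop_of_dom [simp]: "alghom (cop_of A) K = alghom A K"
  unfolding alghom_def mul_cop_of one_cop_of ..

lemma flip_apply [simp]: "flip t (a, b) = t (b, a)"
  by (simp add: flip_def)

lemma flip_tv [simp]: "flip (tv x y) = tv y x"
  by (auto simp: flip_def fun_eq_iff mult.commute)

lemma lin_flip [lins]: "lin f \<Longrightarrow> lin (\<lambda>x. flip (f x))"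
  by (auto simp: lin_iff flip_def fun_eq_iff)

lemma lin_flip' [lins]: "lin flip"
  by (auto simp: lin_iff flip_def fun_eq_iff)

lemma ev_flip: "ev (flip t) F = ev t (\<lambda>a b. F b a)"
  by (simp add: ev_sum) (rule sum.swap)

lemma cop_cop_of: "cop (cop_of K) x = flip (cop K x)"
  by (auto simp: cop_def cop_of_def flip_def)

lemma coalg_cop_of: assumes "coalg K" shows "coalg (cop_of K)"
proof -
  have d: "dc (cop_of K) a b c = dc K a c b" and e: "ec (cop_of K) = ec K" for a b c
    by (simp_all add: cop_of_def)
  show ?thesis
    unfolding coalg_def d e
  proof (intro conjI allI)
    show "(\<Sum>d\<in>UNIV. dc K a r d * dc K d q p) = (\<Sum>d\<in>UNIV. dc K a d p * dc K d r q)" for a p q r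
      using coalgD(1)[OF assms, of a p r q] by simp
  qed (simp_all add: coalgD(2,3)[OF assms])
qed

lemma flip_lift2: "alg K \<Longrightarrow> alg L \<Longrightarrow> flip x = lift2 (tens L K) (\<lambda>x. tv (one L) x) (\<lambda>y. tv y (one K)) x"
  using ev_lin[OF lin_flip', of x tv] by (simp add: lift2_def mul_tens_tv)

lemma alghom_flip: assumes "alg K" "alg L" shows "alghom (tens K L) (tens L K) flip"
proof -
  have "flip = lift2 (tens L K) (\<lambda>x. tv (one L) x) (\<lambda>y. tv y (one K))"
    using flip_lift2[OF assms] by blast
  then show ?thesis
    using alghom_lift2[OF alg_tens[OF assms(2,1)] alghom_inR[OF assms(2)] alghom_inL[OF assms(1)]
       comm_sym[OF comm_inL_inR[OF assms(2,1)]]] by simp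
qed

lemma compat_cop_of: assumes K: "alg K" "compat K" shows "compat (cop_of K)"
proof -
  have "alghom K (tens K K) (\<lambda>x. flip (cop K x))"
    by (rule alghom_compose[OF alghom_cop[OF K(2)] alghom_flip[OF K(1,1)]])
  then show ?thesis
    using K(2) unfolding compat_def
    by (simp add: alghom_def cop_cop_of mul_tens_cop_of lins one_tens)
qed

text \<open>Applying \<open>S\<close>, which reverses products and is injective, turns the axioms
  for the inverse of \<open>S\<close> and the opposite coproduct into the axioms for
  \<open>S\<close>.\<close>

lemma antipode_cop_of:
  assumes K: "alg K" "coalg K" "compat K" and S: "antipode K S" "bij S"
  shows "antipode (cop_of K) (inv S)"
  unfolding antipode_def
proof (intro conjI allI)
  note lS = antipode_lin[OF S(1)] note li = lin_inv[OF lS S(2)]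
  have r: "S (inv S x) = x" for x using S(2) by (simp add: bij_is_surj surj_f_inv_f)
  have inj: "S x = S y \<Longrightarrow> x = y" for x y using S(2) by (meson bij_is_inj injD)
  show "lin (inv S)" by (rule li)
  note m = antipode_mul[OF K S(1)] and o = antipode_one[OF K(1,3) S(1)]
  fix x
  have "S (sw K x (\<lambda>a b. mul K (inv S b) a)) = sw K x (\<lambda>a b. mul K (S a) b)"
    by (simp only: ev_lin[OF lS] m r)
  also have "\<dots> = S (cou K x \<odot> one K)"
    by (simp only: antipode_l[OF S(1)] lin_scal[OF lS] o)
  finally show "sw (cop_of K) x (\<lambda>a b. mul (cop_of K) (inv S a) b) = cou (cop_of K) x \<odot> one (cop_of K)"
    by (simp add: cop_cop_of ev_flip inj)
  have "S (sw K x (\<lambda>a b. mul K b (inv S a))) = sw K x (\<lambda>a b. mul K a (S b))"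
    by (simp only: ev_lin[OF lS] m r)
  also have "\<dots> = S (cou K x \<odot> one K)"
    by (simp only: antipode_r[OF S(1)] lin_scal[OF lS] o)
  finally show "sw (cop_of K) x (\<lambda>a b. mul (cop_of K) a (inv S b)) = cou (cop_of K) x \<odot> one (cop_of K)"
    by (simp add: cop_cop_of ev_flip inj)
qed

section \<open>Tensor products of coalgebras and Hopf algebras\<close>

lemma coalg_tens: assumes K: "coalg K" and L: "coalg L" shows "coalg (tens K L)"
proof -
  have d: "dc (tens K L) (a, a') (b, b') (c, c') = dc K a b c * dc L a' b' c'" for a a' b b' c c'
    by (simp add: tens_def)
  have e: "ec (tens K L) (a, b) = ec K a * ec L b" for a b by (simp add: tens_def)
  have s: "(\<Sum>x\<in>UNIV. \<Sum>y\<in>UNIV. (f x * g y) * (f' x * g' y)) = (\<Sum>x\<in>UNIV. f x * f' x) * (\<Sum>y\<in>UNIV. g y * g' y)"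
    for f f' :: "'a \<Rightarrow> 'b" and g g' :: "'c \<Rightarrow> 'b"
    by (simp add: sum_product mult_ac)
  show ?thesis
    unfolding coalg_def by (simp only: split_paired_All sum_UNIV_pair d e s coalgD[OF K] coalgD[OF L] bv_pair tv_apply) simp
qed

lemma cop_tens_tv: "cop (tens K L) (tv x y) = sw K x (\<lambda>a b. sw L y (\<lambda>c d. tv (tv a c) (tv b d)))"
proof -
  have "cop (tens K L) (tv x y) ((p, q), (r, s)) = cop K x (p, r) * cop L y (q, s)" for p q r s
    by (simp add: cop_apply sum_UNIV_pair tens_def sum_product mult_ac)
  moreover have "sw K x (\<lambda>a b. sw L y (\<lambda>c d. tv (tv a c) (tv b d))) ((p, q), (r, s)) = cop K x (p, r) * cop L y (q, s)" for p q r s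
  proof -
    have "sw L y (\<lambda>c d. tv (tv a c) (tv b d)) ((p, q), (r, s)) = a p * b r * cop L y (q, s)" for a b
    proof -
      have "sw L y (\<lambda>c d. tv (tv a c) (tv b d)) ((p, q), (r, s)) = a p * b r * sw L y tv (q, s)"
        by (simp only: ev_apply sum_distrib_left tv_apply) (simp add: mult_ac)
      then show ?thesis by simp
    qed
    then have "sw K x (\<lambda>a b. sw L y (\<lambda>c d. tv (tv a c) (tv b d))) ((p, q), (r, s)) = sw K x tv (p, r) * cop L y (q, s)"
      by (simp only: ev_apply sum_distrib_right tv_apply mult.assoc)
    then show ?thesis by simp
  qed
  ultimately show ?thesis by (auto simp: fun_eq_iff)
qed

lemma sw_tens:
  assumes F: "\<And>a. lin (F a)" "\<And>b. lin (\<lambda>a. F a b)"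
  shows "sw (tens K L) (tv x y) F = sw K x (\<lambda>a b. sw L y (\<lambda>c d. F (tv a c) (tv b d)))"
  by (simp only: cop_tens_tv ev_ev ev_tv[OF F])

lemma cou_tens_tv: "cou (tens K L) (tv x y) = cou K x * cou L y"
  by (simp add: cou_def sum_UNIV_pair tens_def sum_product mult_ac)

lemma alghom_del:
  assumes "compat H" "alg K" "alghom H K i" "alghom H K j" "comm K i j"
  shows "alghom H K (\<lambda>x. lift2 K i j (cop H x))"
  by (rule alghom_compose[OF alghom_cop[OF assms(1)] alghom_lift2[OF assms(2-)]])

text \<open>The coproduct of the tensor product combines the coproduct of \<open>K\<close>, placed
  in the legs \<open>k1\<close>, \<open>k2\<close>, with that of \<open>L\<close>, placed in
  \<open>l1\<close>, \<open>l2\<close>. Both are algebra maps and their images commute, so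
  multiplicativity is an instance of the universal property.\<close>

lemma compat_tens:
  fixes K :: "('a::finite, 'k::field) bialg" and L :: "('b::finite, 'k) bialg"
  assumes K: "alg K" "compat K" and L: "alg L" "compat L"
  shows "compat (tens K L)"
  unfolding compat_def
proof (intro conjI allI)
  let ?T = "tens K L"
  let ?M = "tens ?T ?T"
  define k1 k2 l1 l2 where "k1 = (\<lambda>x::'a \<Rightarrow> 'k. tv (tv x (one L)) (one ?T))" and "k2 = (\<lambda>x::'a \<Rightarrow> 'k. tv (one ?T) (tv x (one L)))"
    and "l1 = (\<lambda>x::'b \<Rightarrow> 'k. tv (tv (one K) x) (one ?T))" and "l2 = (\<lambda>x::'b \<Rightarrow> 'k. tv (one ?T) (tv (one K) x))"
  note defs = k1_def k2_def l1_def l2_def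
  have T: "alg ?T" and M: "alg ?M" using K L by (simp_all add: alg_tens)
  have h: "alghom K ?M k1" "alghom K ?M k2" "alghom L ?M l1" "alghom L ?M l2"
    unfolding defs using alghom_compose[OF alghom_inL[OF L(1)] alghom_inL[OF T]] alghom_compose[OF alghom_inL[OF L(1)] alghom_inR[OF T]]
      alghom_compose[OF alghom_inR[OF K(1)] alghom_inL[OF T]] alghom_compose[OF alghom_inR[OF K(1)] alghom_inR[OF T]] .
  have c: "comm ?M k1 k2" "comm ?M l1 l2" "comm ?M k1 l1" "comm ?M k1 l2" "comm ?M k2 l1" "comm ?M k2 l2"
    by (simp_all add: comm_def defs mul_tens_tv one_tens K L)
  have "cop ?T x = lift2 ?M (\<lambda>x. lift2 ?M k1 k2 (cop K x)) (\<lambda>x. lift2 ?M l1 l2 (cop L x)) x" for x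
  proof (rule lin_eq_tvI[of "cop ?T"], (intro lins)+)
    fix x y
    have "lift2 ?M (\<lambda>x. lift2 ?M k1 k2 (cop K x)) (\<lambda>x. lift2 ?M l1 l2 (cop L x)) (tv x y)
       = mul ?M (lift2 ?M k1 k2 (cop K x)) (lift2 ?M l1 l2 (cop L y))"
      by (rule lift2_tv) (intro lins)+
    also have "\<dots> = sw K x (\<lambda>a b. sw L y (\<lambda>c d. tv (tv a c) (tv b d)))"
      unfolding lift2_def mul_ev_l mul_ev_r by (subst ev_swap) (simp add: defs mul_tens_tv one_tens K L)
    finally show "cop ?T (tv x y) = lift2 ?M (\<lambda>x. lift2 ?M k1 k2 (cop K x)) (\<lambda>x. lift2 ?M l1 l2 (cop L x)) (tv x y)"
      by (simp only: cop_tens_tv)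
  qed
  then have eq: "cop ?T = lift2 ?M (\<lambda>x. lift2 ?M k1 k2 (cop K x)) (\<lambda>x. lift2 ?M l1 l2 (cop L x))" by blast
  have cc: "comm ?M (lift2 ?M k1 k2) (lift2 ?M l1 l2)"
    by (rule comm_lift2_l[OF M]; rule comm_lift2_r[OF M]) (rule c)+
  show "alghom ?T ?M (cop ?T)"
    unfolding eq by (rule alghom_lift2[OF M alghom_del[OF K(2) M h(1,2) c(1)] alghom_del[OF L(2) M h(3,4) c(2)] comm_compose[OF cc]])
  have 1: "cou ?T (mul ?T (tv a b) (tv c d)) = cou ?T (tv a b) * cou ?T (tv c d)" for a b c d
    using K(2) L(2) by (simp add: compat_def mul_tens_tv cou_tens_tv)
  \<comment> \<open>\<open>lin\<close> is defined for vector-valued maps only, so the counit is made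
    vector-valued by scaling a constant vector.\<close>
  let ?v = "\<lambda>_::unit. 1::'k"
  have 2: "cou ?T (mul ?T (tv a b) y) \<odot> ?v = cou ?T y \<odot> cou ?T (tv a b) \<odot> ?v" for a b y
    by (rule lin_eq_tvI, (intro lins)+) (simp add: 1 mult.commute)
  have 3: "cou ?T (mul ?T x y) \<odot> ?v = cou ?T x \<odot> cou ?T y \<odot> ?v" for x y
    by (rule lin_eq_tvI[of "\<lambda>x. cou ?T (mul ?T x y) \<odot> ?v"], (intro lins)+) (simp only: 2, simp only: scal_scal mult.commute)
  show "cou ?T (mul ?T x y) = cou ?T x * cou ?T y" for x y
    using fun_cong[OF 3[of x y], of "()"] by simp
  show "cou ?T (one ?T) = 1"
    using K(2) L(2) by (simp add: compat_def one_tens cou_tens_tv)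
qed

lemma antipode_tens:
  assumes S: "antipode K S" and S': "antipode L S'"
  shows "antipode (tens K L) (tensmap S S')"
  unfolding antipode_def
proof (intro conjI allI)
  let ?T = "tens K L"
  note [lins] = antipode_lin[OF S] antipode_lin[OF S'] lin_compose[OF antipode_lin[OF S]] lin_compose[OF antipode_lin[OF S']]
  have tt: "tensmap S S' (tv x y) = tv (S x) (S' y)" for x y by (rule tensmap_tv) (intro lins)+
  show "lin (tensmap S S')" using lin_tensmap[OF lin_id] .
  have 1: "sw ?T (tv x y) (\<lambda>a b. mul ?T (tensmap S S' a) b) = cou ?T (tv x y) \<odot> one ?T" for x y
  proof -
    have "sw ?T (tv x y) (\<lambda>a b. mul ?T (tensmap S S' a) b)
       = sw K x (\<lambda>a b. sw L y (\<lambda>c d. tv (mul K (S a) b) (mul L (S' c) d)))"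
      by (subst sw_tens) ((intro lins)+, simp only: tt mul_tens_tv)
    also have "\<dots> = sw K x (\<lambda>a b. tv (mul K (S a) b) (cou L y \<odot> one L))"
      by (simp only: tv_ev_r[symmetric] antipode_l[OF S'])
    also have "\<dots> = tv (cou K x \<odot> one K) (cou L y \<odot> one L)"
      by (simp only: tv_ev_l[symmetric] antipode_l[OF S])
    finally show ?thesis by (simp add: cou_tens_tv one_tens mult.commute)
  qed
  show "sw ?T x (\<lambda>a b. mul ?T (tensmap S S' a) b) = cou ?T x \<odot> one ?T" for x
    by (rule lin_eq_tvI[of "\<lambda>x. sw ?T x (\<lambda>a b. mul ?T (tensmap S S' a) b)"], (intro lins)+) (rule 1)
  have 1: "sw ?T (tv x y) (\<lambda>a b. mul ?T a (tensmap S S' b)) = cou ?T (tv x y) \<odot> one ?T" for x y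
  proof -
    have "sw ?T (tv x y) (\<lambda>a b. mul ?T a (tensmap S S' b))
       = sw K x (\<lambda>a b. sw L y (\<lambda>c d. tv (mul K a (S b)) (mul L c (S' d))))"
      by (subst sw_tens) ((intro lins)+, simp only: tt mul_tens_tv)
    also have "\<dots> = sw K x (\<lambda>a b. tv (mul K a (S b)) (cou L y \<odot> one L))"
      by (simp only: tv_ev_r[symmetric] antipode_r[OF S'])
    also have "\<dots> = tv (cou K x \<odot> one K) (cou L y \<odot> one L)"
      by (simp only: tv_ev_l[symmetric] antipode_r[OF S])
    finally show ?thesis by (simp add: cou_tens_tv one_tens mult.commute)
  qed
  show "sw ?T x (\<lambda>a b. mul ?T a (tensmap S S' b)) = cou ?T x \<odot> one ?T" for x
    by (rule lin_eq_tvI[of "\<lambda>x. sw ?T x (\<lambda>a b. mul ?T a (tensmap S S' b))"], (intro lins)+) (rule 1)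
qed

section \<open>The pairing and the dual Hopf algebra\<close>

lemma lin_pair_r [lins]: "lin f \<Longrightarrow> lin (\<lambda>x. pair a (f x) \<odot> v)"
  by (simp add: lin_iff pair_def distrib_left sum.distrib sum_distrib_left mult.left_commute add_scal)

lemma lin_pair_l [lins]: "lin f \<Longrightarrow> lin (\<lambda>x. pair (f x) a \<odot> v)"
  by (simp add: lin_iff pair_def distrib_right sum.distrib sum_distrib_left mult.assoc add_scal)

lemma pair_bv_l [simp]: "pair (bv p) x = x p"
  by (simp add: pair_def)

lemma pair_bv_r [simp]: "pair x (bv p) = x p"
  by (simp add: pair_def)

text \<open>Scalars are treated as vectors over the index type \<open>unit\<close>, so that the rules for linear maps
also cover functionals.\<close>

lemma pair_eqI: "(\<And>x. pair a x \<odot> (\<lambda>_::unit. 1) = pair b x \<odot> (\<lambda>_. 1)) \<Longrightarrow> a = b"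
proof
  fix j assume "\<And>x. pair a x \<odot> (\<lambda>_::unit. 1) = pair b x \<odot> (\<lambda>_. 1)"
  from fun_cong[OF this[of "bv j"], of "()"] show "a j = b j"
    by simp
qed

text \<open>The trailing vector \<open>v\<close> makes the rule applicable to nested pairings: each
  application leaves another vector of the same kind, which can stand under
  \<open>ev\<close>.\<close>

lemma pair_mul_dual: "pair (mul (dualH H) a b) x \<odot> v = sw H x (\<lambda>p q. pair a p \<odot> pair b q \<odot> v)"
proof -
  have "pair (mul (dualH H) a b) x = (\<Sum>i\<in>UNIV. \<Sum>p\<in>UNIV. \<Sum>q\<in>UNIV. x i * dc H i p q * a p * b q)"
    by (simp add: pair_def mul_def dualH_def sum_distrib_right sum_distrib_left mult_ac)
  also have "\<dots> = (\<Sum>p\<in>UNIV. \<Sum>i\<in>UNIV. \<Sum>q\<in>UNIV. x i * dc H i p q * a p * b q)"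
    by (rule sum.swap)
  also have "\<dots> = (\<Sum>p\<in>UNIV. \<Sum>q\<in>UNIV. \<Sum>i\<in>UNIV. x i * dc H i p q * a p * b q)"
    by (rule sum.cong[OF refl]) (rule sum.swap)
  finally have eq: "pair (mul (dualH H) a b) x = (\<Sum>p\<in>UNIV. \<Sum>q\<in>UNIV. \<Sum>i\<in>UNIV. x i * dc H i p q * a p * b q)" .
  show ?thesis
    unfolding eq by (simp add: ev_sum cop_apply sum_scal sum_distrib_right mult.assoc del: sum_fun_apply)
qed

lemma cop_dual_apply: "cop (dualH H) a (p, q) = pair a (mul H (bv p) (bv q))"
  by (simp add: cop_apply dualH_def mul_bv pair_def)

lemma pair_ev: "pair a (ev t F) \<odot> v = ev t (\<lambda>p q. pair a (F p q) \<odot> v)"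
  by (rule ev_lin[of "\<lambda>x. pair a x \<odot> v"]) (intro lins)

lemma pair_scal_l [simp]: "pair (c \<odot> a) x = c * pair a x"
  by (simp add: pair_def sum_distrib_left mult.assoc)

lemma pair_scal_r [simp]: "pair a (c \<odot> x) = c * pair a x"
  by (simp add: pair_def sum_distrib_left mult.left_commute)

lemma pair_mul: "pair a (mul H x y) \<odot> v = sw (dualH H) a (\<lambda>b c. pair b x \<odot> pair c y \<odot> v)"
proof -
  have eq: "mul H x y = ev (tv x y) (\<lambda>p q. mul H p q)"
    by (rule ev_tv[symmetric]) (intro lins)+
  show ?thesis
    unfolding eq pair_ev by (simp add: ev_sum cop_dual_apply mult_ac del: sum_fun_apply)
qed

text \<open>The matrix on the left is the transpose of \<open>S\<close>; applied to a functional a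
  it gives the composite of a with \<open>S\<close>.\<close>

lemma antipode_dual_pair: "pair (app (\<lambda>a b. S (bv b) a) a) x \<odot> v = pair a (S x) \<odot> v" if "lin S"
proof -
  have "pair (app (\<lambda>a b. S (bv b) a) a) x = (\<Sum>i\<in>UNIV. \<Sum>j\<in>UNIV. a j * (S (bv i) j * x i))"
    by (simp add: pair_def app_def sum_distrib_right sum_distrib_left mult_ac)
  also have "\<dots> = pair a (S x)"
    by (subst sum.swap, subst (2) lin_expand[OF that]) (simp add: pair_def sum_distrib_left mult_ac)
  finally show ?thesis by simp
qed

lemma pair_one_dual [simp]: "pair (one (dualH H)) x = cou H x"
  by (simp add: pair_def one_def dualH_def cou_def mult.commute)

lemma cou_dual [simp]: "cou (dualH H) a = pair a (one H)"
  by (simp add: pair_def one_def dualH_def cou_def)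

lemma alg_dualH: assumes H: "coalg H" shows "alg (dualH H)"
  unfolding alg_def
proof (intro allI conjI; rule pair_eqI)
  let ?v = "\<lambda>_::unit. 1"
  fix a b c x
  have "pair (mul (dualH H) (mul (dualH H) a b) c) x \<odot> ?v
      = sw H x (\<lambda>p q. sw H p (\<lambda>r s. pair a r \<odot> pair b s \<odot> pair c q \<odot> ?v))"
    by (simp only: pair_mul_dual)
  also have "\<dots> = sw H x (\<lambda>p q. sw H q (\<lambda>r s. pair a p \<odot> pair b r \<odot> pair c s \<odot> ?v))"
    by (rule coalg_coassoc[OF H])
  also have "\<dots> = pair (mul (dualH H) a (mul (dualH H) b c)) x \<odot> ?v"
    by (simp only: pair_mul_dual ev_scal[symmetric])
  finally show "pair (mul (dualH H) (mul (dualH H) a b) c) x \<odot> ?v = pair (mul (dualH H) a (mul (dualH H) b c)) x \<odot> ?v" .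
  show "pair (mul (dualH H) (one (dualH H)) a) x \<odot> ?v = pair a x \<odot> ?v"
    unfolding pair_mul_dual pair_one_dual by (rule coalg_counit_l[OF H]) (intro lins)
  show "pair (mul (dualH H) a (one (dualH H))) x \<odot> ?v = pair a x \<odot> ?v"
    unfolding pair_mul_dual pair_one_dual
    using coalg_counit_r[OF H, of "\<lambda>p. pair a p \<odot> ?v"] by (simp add: lins mult.commute)
qed

lemma coalg_dualH: assumes H: "alg H" shows "coalg (dualH H)"
proof -
  have d: "dc (dualH H) a b c = mc H b c a" and e: "ec (dualH H) = one H" for a b c
    by (simp_all add: dualH_def one_def)
  have l: "mul H x (bv r) a = (\<Sum>d\<in>UNIV. x d * mc H d r a)" and r: "mul H (bv r) x a = (\<Sum>d\<in>UNIV. x d * mc H r d a)" for x r a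
    by (simp_all add: mul_def mult.assoc flip: sum_distrib_left)
  have "mul H (mc H p q) (bv r) a = mul H (bv p) (mc H q r) a" for p q r a
    using alg_assoc[OF H, of "bv p" "bv q" "bv r"] by (simp add: mul_bv)
  moreover have "mul H (bv b) (one H) a = bv b a" "mul H (one H) (bv b) a = bv b a" for a b
    using H by simp_all
  ultimately show ?thesis
    unfolding coalg_def d e l r by (simp add: mult.commute bv_sym)
qed

lemma antipode_dualH:
  assumes S: "antipode H S"
  shows "antipode (dualH H) (app (\<lambda>a b. S (bv b) a))"
  unfolding antipode_def
proof (intro allI conjI)
  let ?S = "app (\<lambda>a b. S (bv b) a)" and ?D = "dualH H" and ?v = "\<lambda>_::unit. 1::'b"
  note lS = antipode_lin[OF S]
  note p = antipode_dual_pair[OF lS]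
  show "lin ?S" by (rule lin_app[OF lin_id])
  fix a
  show "sw ?D a (\<lambda>b c. mul ?D (?S b) c) = cou ?D a \<odot> one ?D"
  proof (rule pair_eqI)
    fix x
    have "pair (sw ?D a (\<lambda>b c. mul ?D (?S b) c)) x \<odot> ?v
        = sw ?D a (\<lambda>b c. sw H x (\<lambda>r s. pair b (S r) \<odot> pair c s \<odot> ?v))"
      by (subst ev_lin[of "\<lambda>y. pair y x \<odot> ?v"]) (intro lins, simp only: pair_mul_dual p)
    also have "\<dots> = pair a (sw H x (\<lambda>r s. mul H (S r) s)) \<odot> ?v"
      by (subst ev_swap) (simp only: pair_mul[symmetric] pair_ev)
    finally show "pair (sw ?D a (\<lambda>b c. mul ?D (?S b) c)) x \<odot> ?v = pair (cou ?D a \<odot> one ?D) x \<odot> ?v"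
      unfolding antipode_l[OF S] by (simp add: mult.commute)
  qed
  show "sw ?D a (\<lambda>b c. mul ?D b (?S c)) = cou ?D a \<odot> one ?D"
  proof (rule pair_eqI)
    fix x
    have "pair (sw ?D a (\<lambda>b c. mul ?D b (?S c))) x \<odot> ?v
        = sw ?D a (\<lambda>b c. sw H x (\<lambda>r s. pair b r \<odot> pair c (S s) \<odot> ?v))"
      by (subst ev_lin[of "\<lambda>y. pair y x \<odot> ?v"]) (intro lins, simp only: pair_mul_dual p)
    also have "\<dots> = pair a (sw H x (\<lambda>r s. mul H r (S s))) \<odot> ?v"
      by (subst ev_swap) (simp only: pair_mul[symmetric] pair_ev)
    finally show "pair (sw ?D a (\<lambda>b c. mul ?D b (?S c))) x \<odot> ?v = pair (cou ?D a \<odot> one ?D) x \<odot> ?v"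
      unfolding antipode_r[OF S] by (simp add: mult.commute)
  qed
qed

section \<open>Quasitriangular structures\<close>

definition legs2 :: "('a::finite, 'k::field) bialg \<Rightarrow> ('b::finite, 'k) bialg
    \<Rightarrow> (('a \<Rightarrow> 'k) \<Rightarrow> 'b \<Rightarrow> 'k) \<Rightarrow> (('a \<Rightarrow> 'k) \<Rightarrow> 'b \<Rightarrow> 'k) \<Rightarrow> bool" where
  "legs2 H M i j \<longleftrightarrow> alg M \<and> alghom H M i \<and> alghom H M j \<and> comm M i j"

definition legs3 :: "('a::finite, 'k::field) bialg \<Rightarrow> ('b::finite, 'k) bialg
    \<Rightarrow> (('a \<Rightarrow> 'k) \<Rightarrow> 'b \<Rightarrow> 'k) \<Rightarrow> (('a \<Rightarrow> 'k) \<Rightarrow> 'b \<Rightarrow> 'k) \<Rightarrow> (('a \<Rightarrow> 'k) \<Rightarrow> 'b \<Rightarrow> 'k) \<Rightarrow> bool" where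
  "legs3 H M i j k \<longleftrightarrow> legs2 H M i j \<and> legs2 H M i k \<and> legs2 H M j k"

text \<open>The hexagon identities (\<Delta> \<otimes> id) R = R_13 R_23 and, in
  \<open>hex2\<close>, (id \<otimes> \<Delta>) R = R_13 R_12, read in arbitrary legs i, j, k. The
  freedom in the legs later admits the counit and whole coproducts as single legs.\<close>

definition hex1 :: "('a::finite, 'k::field) bialg \<Rightarrow> ('a \<times> 'a \<Rightarrow> 'k) \<Rightarrow> ('b::finite, 'k) bialg
    \<Rightarrow> (('a \<Rightarrow> 'k) \<Rightarrow> 'b \<Rightarrow> 'k) \<Rightarrow> (('a \<Rightarrow> 'k) \<Rightarrow> 'b \<Rightarrow> 'k) \<Rightarrow> (('a \<Rightarrow> 'k) \<Rightarrow> 'b \<Rightarrow> 'k) \<Rightarrow> bool" where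
  "hex1 H R M i j k \<longleftrightarrow>
     lift2 M (\<lambda>x. lift2 M i j (cop H x)) k R = mul M (lift2 M i k R) (lift2 M j k R)"

definition hex2 :: "('a::finite, 'k::field) bialg \<Rightarrow> ('a \<times> 'a \<Rightarrow> 'k) \<Rightarrow> ('b::finite, 'k) bialg
    \<Rightarrow> (('a \<Rightarrow> 'k) \<Rightarrow> 'b \<Rightarrow> 'k) \<Rightarrow> (('a \<Rightarrow> 'k) \<Rightarrow> 'b \<Rightarrow> 'k) \<Rightarrow> (('a \<Rightarrow> 'k) \<Rightarrow> 'b \<Rightarrow> 'k) \<Rightarrow> bool" where
  "hex2 H R M i j k \<longleftrightarrow>
     lift2 M i (\<lambda>x. lift2 M j k (cop H x)) R = mul M (lift2 M i k R) (lift2 M i j R)"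

text \<open>Naming the inverse lets identities for \<open>Ri\<close> be developed alongside those
  for \<open>R\<close>.\<close>

definition qt_with :: "('a::finite, 'k::field) bialg \<Rightarrow> ('a \<times> 'a \<Rightarrow> 'k) \<Rightarrow> ('a \<times> 'a \<Rightarrow> 'k) \<Rightarrow> bool" where
  "qt_with K R Ri \<longleftrightarrow> mul (tens K K) R Ri = one (tens K K) \<and> mul (tens K K) Ri R = one (tens K K) \<and>
     (\<forall>x. mul (tens K K) (flip (cop K x)) R = mul (tens K K) R (cop K x)) \<and>
     ev R (\<lambda>d c. tv (cop K d) c) =
       mul (tens (tens K K) K) (ev R (\<lambda>a c. tv (tv a (one K)) c)) (ev R (\<lambda>b c. tv (tv (one K) b) c)) \<and>
     ev R (\<lambda>a d. tv a (cop K d)) =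
       mul (tens K (tens K K)) (ev R (\<lambda>a c. tv a (tv (one K) c))) (ev R (\<lambda>a b. tv a (tv b (one K))))"

lemma qt_iff: "qt K R \<longleftrightarrow> (\<exists>Ri. qt_with K R Ri)"
proof -
  have 1: "(\<lambda>((a, b), c). \<Sum>d\<in>UNIV. R (d, c) * dc K d a b) = ev R (\<lambda>d c. tv (cop K d) c)"
    by (auto simp: fun_eq_iff ev_apply cop_bv mult.assoc[symmetric])
  have 2: "(\<lambda>((a, b), c). R (a, c) * uc K b) = ev R (\<lambda>a c. tv (tv a (one K)) c)"
    by (auto simp: fun_eq_iff ev_apply one_def mult.assoc[symmetric] simp flip: sum_distrib_right)
  have 3: "(\<lambda>((a, b), c). uc K a * R (b, c)) = ev R (\<lambda>b c. tv (tv (one K) b) c)"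
    by (auto simp: fun_eq_iff ev_apply one_def mult.assoc[symmetric] mult.commute[of "uc K _"])
      (simp flip: sum_distrib_right)
  have 4: "(\<lambda>(a, (b, c)). \<Sum>d\<in>UNIV. R (a, d) * dc K d b c) = ev R (\<lambda>a d. tv a (cop K d))"
    by (auto simp: fun_eq_iff ev_apply cop_bv mult.assoc[symmetric] simp flip: sum_distrib_right)
      (subst sum.swap, simp flip: sum_distrib_right)
  have 5: "(\<lambda>(a, (b, c)). R (a, c) * uc K b) = ev R (\<lambda>a c. tv a (tv (one K) c))"
    by (auto simp: fun_eq_iff ev_apply one_def mult.assoc[symmetric] simp flip: sum_distrib_right)
  have 6: "(\<lambda>(a, (b, c)). R (a, b) * uc K c) = ev R (\<lambda>a b. tv a (tv b (one K)))"
    by (auto simp: fun_eq_iff ev_apply one_def mult.assoc[symmetric] simp flip: sum_distrib_right)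
  show ?thesis unfolding qt_def qt_with_def 1 2 3 4 5 6 by blast
qed

lemma legs2D:
  assumes "legs2 H M i j"
  shows "alg M" "alghom H M i" "alghom H M j" "comm M i j" "lin i" "lin j"
  using assms by (simp_all add: legs2_def alghom_def)

lemma legs2_sym: "legs2 H M i j \<Longrightarrow> legs2 H M j i"
  by (simp add: legs2_def comm_sym)

lemma legs3D:
  assumes "legs3 H M i j k"
  shows "alg M" "alghom H M i" "alghom H M j" "alghom H M k" "comm M i j" "comm M i k" "comm M j k"
    "lin i" "lin j" "lin k" "legs2 H M i j" "legs2 H M i k" "legs2 H M j k"
  using assms by (simp_all add: legs3_def legs2_def alghom_def)

lemma legs2_alghom_lift2: "legs2 H M i j \<Longrightarrow> alghom (tens H H) M (lift2 M i j)"
  by (simp add: legs2_def alghom_lift2)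

lemma lift2_flip: "comm M i j \<Longrightarrow> lift2 M i j (flip t) = lift2 M j i t"
  by (simp add: lift2_def ev_flip comm_def)

text \<open>Three commuting legs give an algebra map from the triple tensor power of
  \<open>H\<close> to \<open>M\<close>; it carries the defining identity to the one in the
  legs.\<close>

lemma qt_with_hex1: assumes q: "qt_with H R Ri" and H: "alg H" and l: "legs3 H M i j k" shows "hex1 H R M i j k"
proof -
  note L = legs3D[OF l]
  let ?f = "lift2 M (lift2 M i j) k"
  have c: "comm M (lift2 M i j) k" by (rule comm_lift2_l[OF L(1,6,7)])
  have h: "alghom (tens (tens H H) H) M ?f"
    by (rule alghom_lift2[OF L(1) legs2_alghom_lift2[OF L(11)] L(4) c])
  note lf = alghom_lin[OF h]
  have tv: "?f (tv x y) = mul M (lift2 M i j x) (k y)" for x y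
    by (rule lift2_tv) (intro lins L)+
  have tv2: "lift2 M i j (tv x y) = mul M (i x) (j y)" for x y
    by (rule lift2_tv) (intro lins L)+
  have "?f (ev R (\<lambda>d c. tv (cop H d) c)) = mul M (?f (ev R (\<lambda>a c. tv (tv a (one H)) c))) (?f (ev R (\<lambda>b c. tv (tv (one H) b) c)))"
    using q by (simp add: qt_with_def alghom_mul[OF h])
  then show ?thesis
    by (simp add: hex1_def ev_lin[OF lf] tv tv2 alghom_one[OF L(2)] alghom_one[OF L(3)] L(1) lift2_def[of _ _ _ R])
qed

lemma qt_with_hex2: assumes q: "qt_with H R Ri" and H: "alg H" and l: "legs3 H M i j k" shows "hex2 H R M i j k"
proof -
  note L = legs3D[OF l]
  let ?f = "lift2 M i (lift2 M j k)"
  have c: "comm M i (lift2 M j k)" by (rule comm_lift2_r[OF L(1,5,6)])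
  have h: "alghom (tens H (tens H H)) M ?f"
    by (rule alghom_lift2[OF L(1) L(2) legs2_alghom_lift2[OF L(13)] c])
  note lf = alghom_lin[OF h]
  have tv: "?f (tv x y) = mul M (i x) (lift2 M j k y)" for x y
    by (rule lift2_tv) (intro lins L)+
  have tv2: "lift2 M j k (tv x y) = mul M (j x) (k y)" for x y
    by (rule lift2_tv) (intro lins L)+
  have "?f (ev R (\<lambda>a d. tv a (cop H d))) = mul M (?f (ev R (\<lambda>a c. tv a (tv (one H) c)))) (?f (ev R (\<lambda>a b. tv a (tv b (one H)))))"
    using q by (simp add: qt_with_def alghom_mul[OF h])
  then show ?thesis
    by (simp add: hex2_def ev_lin[OF lf] tv tv2 alghom_one[OF L(3)] alghom_one[OF L(4)] L(1) lift2_def[of _ _ _ R])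
qed

text \<open>The way back from legs: the two hexagon premises are instantiated at the canonical
  embeddings into the triple tensor power, bracketed to the left for the first and to the right for
  the second.\<close>

lemma qt_with_I:
  fixes K :: "('a::finite, 'k::field) bialg"
  assumes K: "alg K" and i: "mul (tens K K) R Ri = one (tens K K)" "mul (tens K K) Ri R = one (tens K K)"
    and tw: "\<And>x. mul (tens K K) (flip (cop K x)) R = mul (tens K K) R (cop K x)"
    and h1: "\<And>i j k. legs3 K (tens (tens K K) K) i j k \<Longrightarrow> hex1 K R (tens (tens K K) K) i j k"
    and h2: "\<And>i j k. legs3 K (tens K (tens K K)) i j k \<Longrightarrow> hex2 K R (tens K (tens K K)) i j k"
  shows "qt_with K R Ri"
  unfolding qt_with_def
proof (intro conjI allI i tw)
  note KK = alg_tens[OF K K]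
  have KK1: "mul (tens K K) x (tv (one K) (one K)) = x" "mul (tens K K) (tv (one K) (one K)) x = x" for x
    using alg_one_l[OF KK] alg_one_r[OF KK] by (simp_all add: one_tens)
  let ?M = "tens (tens K K) K"
  let ?i = "\<lambda>x::'a \<Rightarrow> 'k. tv (tv x (one K)) (one K)" and ?j = "\<lambda>x::'a \<Rightarrow> 'k. tv (tv (one K) x) (one K)"
    and ?k = "\<lambda>x::'a \<Rightarrow> 'k. tv (one (tens K K)) x"
  have "legs3 K ?M ?i ?j ?k"
    unfolding legs3_def legs2_def
    using alghom_compose[OF alghom_inL[OF K, of K] alghom_inL[OF K]] alghom_compose[OF alghom_inR[OF K, of K] alghom_inL[OF K]]
      alghom_inR[OF KK, of K]
    by (simp add: alg_tens K comm_def mul_tens_tv one_tens)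
  from h1[OF this]
  have h: "lift2 ?M (\<lambda>x. lift2 ?M ?i ?j (cop K x)) ?k R = mul ?M (lift2 ?M ?i ?k R) (lift2 ?M ?j ?k R)"
    by (simp only: hex1_def)
  have "lift2 ?M ?i ?j (cop K x) = tv (cop K x) (one K)" for x
    using tv_ev_l[of "cop K x" tv "one K"] by (simp add: lift2_def mul_tens_tv K)
  with h show "ev R (\<lambda>d c. tv (cop K d) c) =
     mul ?M (ev R (\<lambda>a c. tv (tv a (one K)) c)) (ev R (\<lambda>b c. tv (tv (one K) b) c))"
    by (simp add: lift2_def mul_tens_tv K one_tens KK1)
  let ?M = "tens K (tens K K)"
  let ?i = "\<lambda>x::'a \<Rightarrow> 'k. tv x (one (tens K K))" and ?j = "\<lambda>x::'a \<Rightarrow> 'k. tv (one K) (tv x (one K))"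
    and ?k = "\<lambda>x::'a \<Rightarrow> 'k. tv (one K) (tv (one K) x)"
  have "legs3 K ?M ?i ?j ?k"
    unfolding legs3_def legs2_def
    using alghom_compose[OF alghom_inL[OF K, of K] alghom_inR[OF K]] alghom_compose[OF alghom_inR[OF K, of K] alghom_inR[OF K]]
      alghom_inL[OF KK, of K]
    by (simp add: alg_tens K comm_def mul_tens_tv one_tens)
  from h2[OF this]
  have h: "lift2 ?M ?i (\<lambda>x. lift2 ?M ?j ?k (cop K x)) R = mul ?M (lift2 ?M ?i ?k R) (lift2 ?M ?i ?j R)"
    by (simp only: hex2_def)
  have "lift2 ?M ?j ?k (cop K x) = tv (one K) (cop K x)" for x
    using tv_ev_r[of "one K" "cop K x" tv] by (simp add: lift2_def mul_tens_tv K)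
  with h show "ev R (\<lambda>a d. tv a (cop K d)) =
     mul ?M (ev R (\<lambda>a c. tv a (tv (one K) c))) (ev R (\<lambda>a b. tv a (tv b (one K))))"
    by (simp add: lift2_def mul_tens_tv K one_tens KK1)
qed

lemma lift2_lift2_comm:
  assumes "alg M" "comm M i k" "comm M i l" "comm M j k" "comm M j l"
  shows "mul M (lift2 M i j x) (lift2 M k l y) = mul M (lift2 M k l y) (lift2 M i j x)"
  by (rule commD[of M "lift2 M i j" "lift2 M k l"], rule comm_lift2_l[OF assms(1)]; rule comm_lift2_r[OF assms(1)]) (rule assms)+

lemma qt_with_tw:
  assumes q: "qt_with H R Ri" and l: "legs2 H M i j"
  shows "mul M (lift2 M i j R) (lift2 M i j (cop H x)) = mul M (lift2 M j i (cop H x)) (lift2 M i j R)"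
  using q unfolding qt_with_def
  by (simp add: lift2_flip[OF legs2D(4)[OF l], symmetric] alghom_mul[OF legs2_alghom_lift2[OF l], symmetric])

lemma qt_with_inv:
  assumes q: "qt_with H R Ri" and l: "legs2 H M i j"
  shows "mul M (lift2 M i j R) (lift2 M i j Ri) = one M" "mul M (lift2 M i j Ri) (lift2 M i j R) = one M"
  using q lift2_inv[OF legs2D(1)[OF l] legs2_alghom_lift2[OF l]] unfolding qt_with_def by simp_all

lemma legs2_del_l: "compat H \<Longrightarrow> legs3 H M i j k \<Longrightarrow> legs2 H M (\<lambda>x. lift2 M i j (cop H x)) k"
  unfolding legs3_def legs2_def
  by (auto intro: alghom_del comm_compose_l[OF comm_lift2_l])

lemma legs2_del_r: "compat H \<Longrightarrow> legs3 H M i j k \<Longrightarrow> legs2 H M i (\<lambda>x. lift2 M j k (cop H x))"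
  unfolding legs3_def legs2_def
  by (auto intro: alghom_del comm_compose_r[OF comm_lift2_r])

text \<open>The coproduct leg is itself a leg, so the left side inverts the left side of the hexagon
  identity, and inverting the right side reverses its factors.\<close>

lemma qt_with_hex1i:
  assumes H: "alg H" "compat H" and q: "qt_with H R Ri" and l: "legs3 H M i j k"
  shows "lift2 M (\<lambda>x. lift2 M i j (cop H x)) k Ri = mul M (lift2 M j k Ri) (lift2 M i k Ri)"
proof (rule alg_inv_unique)
  note L = legs3D[OF l]
  show M: "alg M" by (rule L)
  note h = qt_with_hex1[OF q H(1) l, unfolded hex1_def] and c = legs2_del_l[OF H(2) l]
  show "mul M (lift2 M (\<lambda>x. lift2 M i j (cop H x)) k Ri) (lift2 M (\<lambda>x. lift2 M i j (cop H x)) k R) = one M"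
    by (rule qt_with_inv(2)[OF q c])
  show "mul M (lift2 M (\<lambda>x. lift2 M i j (cop H x)) k R) (mul M (lift2 M j k Ri) (lift2 M i k Ri)) = one M"
    unfolding h using alg_assoc[OF M, of "lift2 M j k R" "lift2 M j k Ri"] qt_with_inv[OF q L(12)] qt_with_inv[OF q L(13)]
    by (simp add: alg_assoc[OF M] M)
qed

lemma qt_with_hex2i:
  assumes H: "alg H" "compat H" and q: "qt_with H R Ri" and l: "legs3 H M i j k"
  shows "lift2 M i (\<lambda>x. lift2 M j k (cop H x)) Ri = mul M (lift2 M i j Ri) (lift2 M i k Ri)"
proof (rule alg_inv_unique)
  note L = legs3D[OF l]
  show M: "alg M" by (rule L)
  note h = qt_with_hex2[OF q H(1) l, unfolded hex2_def] and c = legs2_del_r[OF H(2) l]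
  show "mul M (lift2 M i (\<lambda>x. lift2 M j k (cop H x)) Ri) (lift2 M i (\<lambda>x. lift2 M j k (cop H x)) R) = one M"
    by (rule qt_with_inv(2)[OF q c])
  show "mul M (lift2 M i (\<lambda>x. lift2 M j k (cop H x)) R) (mul M (lift2 M i j Ri) (lift2 M i k Ri)) = one M"
    unfolding h using alg_assoc[OF M, of "lift2 M i j R" "lift2 M i j Ri"] qt_with_inv[OF q L(11)] qt_with_inv[OF q L(12)]
    by (simp add: alg_assoc[OF M] M)
qed

text \<open>R_12 moves past (\<Delta> \<otimes> id) R at the cost of replacing \<Delta> by its
  opposite. Expanding both sides by the first hexagon identity, once for the legs i, j and once for
  j, i, gives the Yang-Baxter equation.\<close>

lemma ybe:
  assumes H: "alg H" "compat H" and q: "qt_with H R Ri" and l: "legs3 H M i j k"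
  shows "mul M (lift2 M i j R) (mul M (lift2 M i k R) (lift2 M j k R))
    = mul M (lift2 M j k R) (mul M (lift2 M i k R) (lift2 M i j R))"
proof -
  note L = legs3D[OF l]
  have l': "legs3 H M j i k" using l by (simp add: legs3_def legs2_sym)
  note h = qt_with_hex1[OF q H(1) l, unfolded hex1_def] qt_with_hex1[OF q H(1) l', unfolded hex1_def]
  have c: "comm M (lift2 M i j) k" by (rule comm_lift2_l[OF L(1,6,7)])
  have "mul M (lift2 M i j R) (lift2 M (\<lambda>x. lift2 M i j (cop H x)) k R)
     = ev R (\<lambda>a b. mul M (mul M (lift2 M i j R) (lift2 M i j (cop H a))) (k b))"
    unfolding lift2_def[of M "\<lambda>x. lift2 M i j (cop H x)" k] mul_ev_r by (simp add: alg_assoc[OF L(1)])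
  also have "\<dots> = ev R (\<lambda>a b. mul M (mul M (lift2 M j i (cop H a)) (k b)) (lift2 M i j R))"
    by (simp add: qt_with_tw[OF q L(11)] alg_assoc[OF L(1)] commD[OF c])
  also have "\<dots> = mul M (lift2 M (\<lambda>x. lift2 M j i (cop H x)) k R) (lift2 M i j R)"
    unfolding lift2_def[of M "\<lambda>x. lift2 M j i (cop H x)" k] mul_ev_l ..
  finally show ?thesis unfolding h by (simp add: alg_assoc[OF L(1)])
qed

lemma qt_with_tw_inv:
  assumes q: "qt_with H R Ri" and l: "legs2 H M i j"
  shows "mul M (lift2 M i j (cop H x)) (lift2 M i j Ri) = mul M (lift2 M i j Ri) (lift2 M j i (cop H x))"
proof -
  note A = alg_assoc[OF legs2D(1)[OF l]] and inv = qt_with_inv[OF q l]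
  let ?R = "lift2 M i j R" and ?I = "lift2 M i j Ri" and ?c = "lift2 M i j (cop H x)" and ?d = "lift2 M j i (cop H x)"
  have "mul M ?c ?I = mul M (mul M ?I ?R) (mul M ?c ?I)"
    by (simp add: inv legs2D(1)[OF l])
  also have "\<dots> = mul M ?I (mul M (mul M ?R ?c) ?I)" by (simp only: A)
  also have "\<dots> = mul M ?I (mul M ?d (mul M ?R ?I))" by (simp only: qt_with_tw[OF q l] A)
  finally show ?thesis by (simp add: inv legs2D(1)[OF l])
qed

lemma legs2_in: "alg K \<Longrightarrow> legs2 K (tens K K) (\<lambda>x. tv x (one K)) (\<lambda>x. tv (one K) x)"
  by (simp add: legs2_def alg_tens alghom_inL alghom_inR comm_inL_inR)

lemma alghom_cop_of_dom2: "legs2 (cop_of H) M i j = legs2 H M i j" "legs3 (cop_of H) M i j k = legs3 H M i j k"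
  by (simp_all add: legs2_def legs3_def)

text \<open>Inversion reverses the factors in each hexagon identity, and the opposite coproduct
  interchanges the two legs it fills; the two reversals cancel.\<close>

lemma qt_with_cop_of_inv:
  assumes H: "alg H" "compat H" and q: "qt_with H R Ri"
  shows "qt_with (cop_of H) Ri R"
proof (rule qt_with_I)
  note l = legs2_in[OF H(1)]
  note t = qt_with_tw_inv[OF q l, unfolded lift2_in[OF H(1) H(1)] flip_lift2[OF H(1) H(1), symmetric]]
  have f: "flip (flip y) = y" for y :: "'a \<times> 'a \<Rightarrow> 'b" by (simp add: flip_def)
  show "alg (cop_of H)" using H(1) by simp
  show "mul (tens (cop_of H) (cop_of H)) Ri R = one (tens (cop_of H) (cop_of H))"
    "mul (tens (cop_of H) (cop_of H)) R Ri = one (tens (cop_of H) (cop_of H))"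
    using q by (simp_all add: qt_with_def mul_tens_cop_of one_tens)
  show "mul (tens (cop_of H) (cop_of H)) (flip (cop (cop_of H) x)) Ri = mul (tens (cop_of H) (cop_of H)) Ri (cop (cop_of H) x)" for x
    by (simp add: mul_tens_cop_of cop_cop_of f t)
  {
    fix M :: "('c::finite, 'b) bialg" and i j k
    assume "legs3 (cop_of H) M i j k"
    then have l: "legs3 H M i j k" "legs3 H M j i k" "legs3 H M i k j"
      unfolding alghom_cop_of_dom2 by (simp_all add: legs3_def legs2_sym)
    note L = legs3D[OF l(1)]
    have "hex1 (cop_of H) Ri M i j k"
      using qt_with_hex1i[OF H q l(2)] by (simp add: hex1_def cop_cop_of lift2_flip[OF L(5)])
    moreover have "hex2 (cop_of H) Ri M i j k"
      using qt_with_hex2i[OF H q l(3)] by (simp add: hex2_def cop_cop_of lift2_flip[OF L(7)])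
    ultimately have "hex1 (cop_of H) Ri M i j k \<and> hex2 (cop_of H) Ri M i j k" ..
  } note h = this
  show "hex1 (cop_of H) Ri (tens (tens (cop_of H) (cop_of H)) (cop_of H)) i j k"
    if "legs3 (cop_of H) (tens (tens (cop_of H) (cop_of H)) (cop_of H)) i j k" for i j k
    using h[OF that] ..
  show "hex2 (cop_of H) Ri (tens (cop_of H) (tens (cop_of H) (cop_of H))) i j k"
    if "legs3 (cop_of H) (tens (cop_of H) (tens (cop_of H) (cop_of H))) i j k" for i j k
    using h[OF that] ..
qed

text \<open>Flipping \<open>R\<close> exchanges the two hexagon identities, read in the legs k, j,
  i; the reversed order of factors is absorbed by the opposite coproduct.\<close>

lemma qt_with_cop_of_flip:
  fixes H :: "('a::finite, 'b::field) bialg"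
  assumes H: "alg H" "compat H" and q: "qt_with H R Ri"
  shows "qt_with (cop_of H) (flip R) (flip Ri)"
proof (rule qt_with_I)
  note fh = alghom_flip[OF H(1,1)]
  have f: "flip (flip y) = y" for y :: "'a \<times> 'a \<Rightarrow> 'b" by (simp add: flip_def)
  show "alg (cop_of H)" using H(1) by simp
  have "mul (tens H H) (flip R) (flip Ri) = flip (mul (tens H H) R Ri)"
    "mul (tens H H) (flip Ri) (flip R) = flip (mul (tens H H) Ri R)"
    by (simp_all only: alghom_mul[OF fh])
  then show "mul (tens (cop_of H) (cop_of H)) (flip R) (flip Ri) = one (tens (cop_of H) (cop_of H))"
    "mul (tens (cop_of H) (cop_of H)) (flip Ri) (flip R) = one (tens (cop_of H) (cop_of H))"
    using q by (simp_all add: qt_with_def mul_tens_cop_of one_tens)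
  show "mul (tens (cop_of H) (cop_of H)) (flip (cop (cop_of H) x)) (flip R) = mul (tens (cop_of H) (cop_of H)) (flip R) (cop (cop_of H) x)" for x
  proof -
    have "mul (tens H H) (flip (cop H x)) R = mul (tens H H) R (cop H x)"
      using q by (simp add: qt_with_def)
    from arg_cong[OF this, of flip] show ?thesis
      by (simp add: mul_tens_cop_of cop_cop_of f alghom_mul[OF fh])
  qed
  {
    fix M :: "('c::finite, 'b) bialg" and i j k
    assume "legs3 (cop_of H) M i j k"
    then have l: "legs3 H M i j k" "legs3 H M k j i" "legs3 H M j k i" "legs3 H M k i j"
      unfolding alghom_cop_of_dom2 by (simp_all add: legs3_def legs2_sym)
    note L = legs3D[OF l(1)]
    have c: "comm M (lift2 M j i) k" "comm M i (lift2 M k j)"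
      by (rule comm_lift2_l[OF L(1) L(7) L(6)], rule comm_lift2_r[OF L(1) L(6) L(5)])
    have "hex1 (cop_of H) (flip R) M i j k"
      using qt_with_hex2[OF q H(1) l(2)] lift2_flip[OF comm_compose_l[OF c(1), of "cop H"], of R]
      by (simp add: hex1_def hex2_def cop_cop_of lift2_flip L)
    moreover have "hex2 (cop_of H) (flip R) M i j k"
      using qt_with_hex1[OF q H(1) l(2)] lift2_flip[OF comm_compose_r[OF c(2), of "cop H"], of R]
      by (simp add: hex1_def hex2_def cop_cop_of lift2_flip L)
    ultimately have "hex1 (cop_of H) (flip R) M i j k \<and> hex2 (cop_of H) (flip R) M i j k" ..
  } note h = this
  show "hex1 (cop_of H) (flip R) (tens (tens (cop_of H) (cop_of H)) (cop_of H)) i j k"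
    if "legs3 (cop_of H) (tens (tens (cop_of H) (cop_of H)) (cop_of H)) i j k" for i j k
    using h[OF that] ..
  show "hex2 (cop_of H) (flip R) (tens (cop_of H) (tens (cop_of H) (cop_of H))) i j k"
    if "legs3 (cop_of H) (tens (cop_of H) (tens (cop_of H) (cop_of H))) i j k" for i j k
    using h[OF that] ..
qed

section \<open>Tensor products of quasitriangular structures\<close>

definition tensR :: "('a::finite \<times> 'a \<Rightarrow> 'k::field) \<Rightarrow> ('b::finite \<times> 'b \<Rightarrow> 'k) \<Rightarrow> ('a \<times> 'b) \<times> ('a \<times> 'b) \<Rightarrow> 'k" where
  "tensR R R' = ev R (\<lambda>a b. ev R' (\<lambda>c d. tv (tv a c) (tv b d)))"

lemma cop_tens: "alg K \<Longrightarrow> alg L \<Longrightarrow> cop (tens K L) (tv x y) = tensR (cop K x) (cop L y)"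
  by (simp add: tensR_def cop_tens_tv)

text \<open>\<open>tensR R R'\<close> is R_13 R'_24 on A \<otimes> B \<otimes> A \<otimes> B. Placed
  in legs it factors into a part over \<open>A\<close> and a part over \<open>B\<close>, so each
  property reduces to one for \<open>A\<close> and one for \<open>B\<close>.\<close>

lemma lift2_tensR:
  assumes A: "alg A" and B: "alg B" and l: "legs2 (tens A B) M i j"
  shows "lift2 M i j (tensR R R') = mul M (lift2 M (\<lambda>x. i (tv x (one B))) (\<lambda>x. j (tv x (one B))) R)
     (lift2 M (\<lambda>x. i (tv (one A) x)) (\<lambda>x. j (tv (one A) x)) R')"
proof -
  note L = legs2D[OF l]
  have t: "tv a b = mul (tens A B) (tv a (one B)) (tv (one A) b)" for a b
    by (simp add: mul_tens_tv A B)
  have 1: "mul M (i (tv a c)) (j (tv b d)) = mul M (mul M (i (tv a (one B))) (j (tv b (one B)))) (mul M (i (tv (one A) c)) (j (tv (one A) d)))" for a b c d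
    unfolding t[of a c] t[of b d] alghom_mul[OF L(2)] alghom_mul[OF L(3)]
    by (simp add: alg_assoc[OF L(1)] comm_swap[OF L(1) comm_sym[OF L(4)], of "tv b (one B)" "tv (one A) c"])
  have "lift2 M i j (tensR R R') = ev R (\<lambda>a b. ev R' (\<lambda>c d. mul M (i (tv a c)) (j (tv b d))))"
    unfolding tensR_def ev_lin[OF lin_lift2'] by (simp add: lift2_tv L)
  also have "\<dots> = ev R (\<lambda>a b. ev R' (\<lambda>c d.
      mul M (mul M (i (tv a (one B))) (j (tv b (one B)))) (mul M (i (tv (one A) c)) (j (tv (one A) d)))))"
    by (intro ev_cong) (rule 1)
  finally show ?thesis
    unfolding lift2_def mul_ev_l by (simp only: mul_ev_r)
qed

lemma legs2_in_compose:
  assumes A: "alg A" and B: "alg B" and l: "legs2 (tens A B) M i j"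
  shows "legs2 A M (\<lambda>x. i (tv x (one B))) (\<lambda>x. j (tv x (one B)))"
    and "legs2 B M (\<lambda>x. i (tv (one A) x)) (\<lambda>x. j (tv (one A) x))"
    and "comm M (\<lambda>x. i (tv x (one B))) (\<lambda>x. i (tv (one A) x))"
    and "comm M (\<lambda>x. j (tv x (one B))) (\<lambda>x. j (tv (one A) x))"
    and "comm M (\<lambda>x. i (tv x (one B))) (\<lambda>x. j (tv (one A) x))"
    and "comm M (\<lambda>x. j (tv x (one B))) (\<lambda>x. i (tv (one A) x))"
proof -
  note L = legs2D[OF l]
  show "legs2 A M (\<lambda>x. i (tv x (one B))) (\<lambda>x. j (tv x (one B)))"
    unfolding legs2_def
    by (intro conjI L(1) alghom_compose[OF alghom_inL[OF B]] L(2,3) comm_compose[OF L(4)])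
  show "legs2 B M (\<lambda>x. i (tv (one A) x)) (\<lambda>x. j (tv (one A) x))"
    unfolding legs2_def
    by (intro conjI L(1) alghom_compose[OF alghom_inR[OF A]] L(2,3) comm_compose[OF L(4)])
  show "comm M (\<lambda>x. i (tv x (one B))) (\<lambda>x. i (tv (one A) x))"
    "comm M (\<lambda>x. j (tv x (one B))) (\<lambda>x. j (tv (one A) x))"
    by (rule comm_image[OF L(2) comm_inL_inR[OF A B]] comm_image[OF L(3) comm_inL_inR[OF A B]])+
  show "comm M (\<lambda>x. i (tv x (one B))) (\<lambda>x. j (tv (one A) x))"
    "comm M (\<lambda>x. j (tv x (one B))) (\<lambda>x. i (tv (one A) x))"
    by (rule comm_compose[OF L(4)] comm_compose[OF comm_sym[OF L(4)]])+
qed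

text \<open>Each axiom is the product of the corresponding axioms for \<open>A\<close> and
  \<open>B\<close>. What remains is to interleave the factors, which is possible since legs coming
  from \<open>A\<close> commute with legs coming from \<open>B\<close>.\<close>

lemma qt_with_tens:
  fixes A :: "('a::finite, 'k::field) bialg" and B :: "('b::finite, 'k) bialg"
  assumes A: "alg A" "compat A" "qt_with A R Ri" and B: "alg B" "compat B" "qt_with B R' Ri'"
  shows "qt_with (tens A B) (tensR R R') (tensR Ri Ri')"
proof (rule qt_with_I)
  let ?T = "tens A B"
  show T: "alg ?T" by (rule alg_tens[OF A(1) B(1)])
  have inv: "mul M (lift2 M i j (tensR R R')) (lift2 M i j (tensR Ri Ri')) = one M"
    "mul M (lift2 M i j (tensR Ri Ri')) (lift2 M i j (tensR R R')) = one M"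
    if l: "legs2 ?T M i j" for M :: "('c::finite, 'k) bialg" and i j
  proof -
    note C = legs2_in_compose[OF A(1) B(1) l]
    note M = legs2D(1)[OF l]
    note i = qt_with_inv[OF A(3) C(1)] qt_with_inv[OF B(3) C(2)]
    have c: "mul M (lift2 M (\<lambda>x. i (tv x (one B))) (\<lambda>x. j (tv x (one B))) x)
        (lift2 M (\<lambda>x. i (tv (one A) x)) (\<lambda>x. j (tv (one A) x)) y)
      = mul M (lift2 M (\<lambda>x. i (tv (one A) x)) (\<lambda>x. j (tv (one A) x)) y)
        (lift2 M (\<lambda>x. i (tv x (one B))) (\<lambda>x. j (tv x (one B))) x)" for x y
      by (rule lift2_lift2_comm[OF M C(3,5,6,4)])
    have "mul M (mul M a b) (mul M a' b') = one M"
      if "mul M a a' = one M" "mul M b b' = one M" "mul M a' b = mul M b a'" for a b a' b'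
    proof -
      have "mul M (mul M a b) (mul M a' b') = mul M a (mul M (mul M b a') b')" by (simp only: alg_assoc[OF M])
      also have "\<dots> = mul M (mul M a a') (mul M b b')" by (simp only: that(3)[symmetric] alg_assoc[OF M])
      finally show ?thesis by (simp add: that M)
    qed
    then show "mul M (lift2 M i j (tensR R R')) (lift2 M i j (tensR Ri Ri')) = one M"
      "mul M (lift2 M i j (tensR Ri Ri')) (lift2 M i j (tensR R R')) = one M"
      unfolding lift2_tensR[OF A(1) B(1) l] using i c by blast+
  qed
  note l0 = legs2_in[OF T]
  show "mul (tens ?T ?T) (tensR R R') (tensR Ri Ri') = one (tens ?T ?T)"
    "mul (tens ?T ?T) (tensR Ri Ri') (tensR R R') = one (tens ?T ?T)"
    using inv[OF l0] by (simp_all only: lift2_in[OF T T])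
  have tw: "mul M (lift2 M i j (tensR R R')) (lift2 M i j (cop ?T z)) = mul M (lift2 M j i (cop ?T z)) (lift2 M i j (tensR R R'))"
    if l: "legs2 ?T M i j" for M :: "('c::finite, 'k) bialg" and i j z
  proof (rule lin_eq_tvI[of "\<lambda>z. mul M (lift2 M i j (tensR R R')) (lift2 M i j (cop ?T z))"], (intro lins)+)
    fix x y
    note C = legs2_in_compose[OF A(1) B(1) l]
    note M = legs2D(1)[OF l]
    have sw: "mul M (mul M a b) (mul M c d) = mul M (mul M c' d') (mul M a b)"
      if "mul M a c = mul M c' a" "mul M b d = mul M d' b" "mul M c b = mul M b c" "mul M d' a = mul M a d'" for a b c d c' d'
    proof -
      have "mul M (mul M a b) (mul M c d) = mul M (mul M a c) (mul M b d)"
        by (simp only: alg_assoc[OF M] that(3)[symmetric]) (simp only: alg_assoc[OF M, symmetric] that(3))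
      also have "\<dots> = mul M (mul M c' (mul M a d')) b" by (simp only: that(1,2) alg_assoc[OF M])
      also have "\<dots> = mul M (mul M c' d') (mul M a b)" by (simp only: that(4)[symmetric] alg_assoc[OF M])
      finally show ?thesis .
    qed
    show "mul M (lift2 M i j (tensR R R')) (lift2 M i j (cop ?T (tv x y))) = mul M (lift2 M j i (cop ?T (tv x y))) (lift2 M i j (tensR R R'))"
      unfolding cop_tens[OF A(1) B(1)] lift2_tensR[OF A(1) B(1) l] lift2_tensR[OF A(1) B(1) legs2_sym[OF l]]
      by (rule sw[OF qt_with_tw[OF A(3) C(1)] qt_with_tw[OF B(3) C(2)] lift2_lift2_comm[OF M C(3,5,6,4)]
            lift2_lift2_comm[OF M C(5,3,4,6), symmetric]])
  qed
  show "mul (tens ?T ?T) (flip (cop ?T x)) (tensR R R') = mul (tens ?T ?T) (tensR R R') (cop ?T x)" for x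
    using tw[OF l0, of x] by (simp only: lift2_in[OF T T] flip_lift2[OF T T, symmetric])
  {
    fix M :: "('c::finite, 'k) bialg" and i j k
    assume l: "legs3 ?T M i j k"
    note L = legs3D[OF l]
    have cT: "compat ?T" by (rule compat_tens[OF A(1,2) B(1,2)])
    note C1 = legs2_in_compose[OF A(1) B(1) L(11)] and C2 = legs2_in_compose[OF A(1) B(1) L(12)]
      and C3 = legs2_in_compose[OF A(1) B(1) L(13)]
    note M = L(1)
    have lA: "legs3 A M (\<lambda>x. i (tv x (one B))) (\<lambda>x. j (tv x (one B))) (\<lambda>x. k (tv x (one B)))"
      and lB: "legs3 B M (\<lambda>x. i (tv (one A) x)) (\<lambda>x. j (tv (one A) x)) (\<lambda>x. k (tv (one A) x))"
      using C1 C2 C3 by (simp_all add: legs3_def)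
    have d: "lift2 M i j (cop ?T (tv x (one B))) = lift2 M (\<lambda>x. i (tv x (one B))) (\<lambda>x. j (tv x (one B))) (cop A x)"
        "lift2 M i j (cop ?T (tv (one A) y)) = lift2 M (\<lambda>x. i (tv (one A) x)) (\<lambda>x. j (tv (one A) x)) (cop B y)"
      if l: "legs2 ?T M i j" for i j x y
    proof -
      note C = legs2_in_compose[OF A(1) B(1) l]
      show "lift2 M i j (cop ?T (tv x (one B))) = lift2 M (\<lambda>x. i (tv x (one B))) (\<lambda>x. j (tv x (one B))) (cop A x)"
        unfolding cop_tens[OF A(1) B(1)] lift2_tensR[OF A(1) B(1) l] alghom_one[OF alghom_cop[OF B(2)]]
        by (simp add: alghom_one[OF legs2_alghom_lift2[OF C(2)]] M)
      show "lift2 M i j (cop ?T (tv (one A) y)) = lift2 M (\<lambda>x. i (tv (one A) x)) (\<lambda>x. j (tv (one A) x)) (cop B y)"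
        unfolding cop_tens[OF A(1) B(1)] lift2_tensR[OF A(1) B(1) l] alghom_one[OF alghom_cop[OF A(2)]]
        by (simp add: alghom_one[OF legs2_alghom_lift2[OF C(1)]] M)
    qed
    have sw: "mul M (mul M a c) (mul M b d) = mul M (mul M a b) (mul M c d)"
      if "mul M c b = mul M b c" for a b c d
    proof -
      have "mul M (mul M a c) (mul M b d) = mul M a (mul M (mul M c b) d)" by (simp only: alg_assoc[OF M])
      then show ?thesis by (simp only: that alg_assoc[OF M])
    qed
    have "hex1 ?T (tensR R R') M i j k"
      unfolding hex1_def lift2_tensR[OF A(1) B(1) legs2_del_l[OF cT l]] lift2_tensR[OF A(1) B(1) L(12)]
        lift2_tensR[OF A(1) B(1) L(13)] d[OF L(11)]
        qt_with_hex1[OF A(3) A(1) lA, unfolded hex1_def] qt_with_hex1[OF B(3) B(1) lB, unfolded hex1_def]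
      by (rule sw, rule lift2_lift2_comm[OF M C1(6) C3(5) C2(6) C3(4)])
    moreover have "hex2 ?T (tensR R R') M i j k"
      unfolding hex2_def lift2_tensR[OF A(1) B(1) legs2_del_r[OF cT l]] lift2_tensR[OF A(1) B(1) L(12)]
        lift2_tensR[OF A(1) B(1) L(11)] d[OF L(13)]
        qt_with_hex2[OF A(3) A(1) lA, unfolded hex2_def] qt_with_hex2[OF B(3) B(1) lB, unfolded hex2_def]
      by (rule sw, rule lift2_lift2_comm[OF M C1(3) C2(5) C1(6) C3(5)])
    ultimately have "hex1 ?T (tensR R R') M i j k \<and> hex2 ?T (tensR R R') M i j k" ..
  } note h = this
  show "hex1 ?T (tensR R R') (tens (tens ?T ?T) ?T) i j k"
    if "legs3 ?T (tens (tens ?T ?T) ?T) i j k" for i j k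
    using h[OF that] ..
  show "hex2 ?T (tensR R R') (tens ?T (tens ?T ?T)) i j k"
    if "legs3 ?T (tens ?T (tens ?T ?T)) i j k" for i j k
    using h[OF that] ..
qed

section \<open>Quasitriangular Hopf algebras\<close>

lemma vector_space_scal: "vector_space (scal :: 'k::field \<Rightarrow> ('a \<Rightarrow> 'k) \<Rightarrow> 'a \<Rightarrow> 'k)"
  by unfold_locales (simp_all add: scal_add add_scal)

text \<open>Used to complete one-sided facts to bijectivity: the transpose of \<open>Qmap\<close> is
  shown injective, the antipode and \<open>theta2\<close> are shown surjective.\<close>

lemma lin_endo_surj_iff_inj:
  fixes f :: "('a::finite \<Rightarrow> 'k::field) \<Rightarrow> ('a \<Rightarrow> 'k)"
  assumes f: "lin f"
  shows "surj f \<longleftrightarrow> inj f"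
proof -
  interpret V: vector_space "scal :: 'k \<Rightarrow> ('a \<Rightarrow> 'k) \<Rightarrow> 'a \<Rightarrow> 'k" by (rule vector_space_scal)
  have inj: "inj (bv :: 'a \<Rightarrow> 'a \<Rightarrow> 'k)"
    by (rule injI) (auto simp: bv_def fun_eq_iff split: if_splits)
  have sp: "V.span (range (bv :: 'a \<Rightarrow> 'a \<Rightarrow> 'k)) = UNIV"
  proof -
    have "x \<in> V.span (range (bv :: 'a \<Rightarrow> 'a \<Rightarrow> 'k))" for x :: "'a \<Rightarrow> 'k"
      by (subst vec_expand[of x]) (intro V.span_sum V.span_scale V.span_base rangeI)
    then show ?thesis by blast
  qed
  have ind: "V.independent (range (bv :: 'a \<Rightarrow> 'a \<Rightarrow> 'k))"
  proof (rule V.independent_if_scalars_zero)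
    show "finite (range (bv :: 'a \<Rightarrow> 'a \<Rightarrow> 'k))" by simp
    fix g :: "('a \<Rightarrow> 'k) \<Rightarrow> 'k" and x
    assume s: "(\<Sum>x\<in>range (bv :: 'a \<Rightarrow> 'a \<Rightarrow> 'k). g x \<odot> x) = 0" and x: "x \<in> range (bv :: 'a \<Rightarrow> 'a \<Rightarrow> 'k)"
    from x obtain a where a: "x = bv a" by blast
    have "(\<Sum>b\<in>UNIV. g (bv b) \<odot> bv b) = 0"
      using s by (simp add: sum.reindex[OF inj] o_def del: sum_fun_apply)
    then have "(\<Sum>b\<in>UNIV. g (bv b) \<odot> bv b) a = 0" by (simp only: zero_fun_apply)
    then show "g x = 0" by (simp add: a)
  qed
  interpret F: finite_dimensional_vector_space "scal :: 'k \<Rightarrow> ('a \<Rightarrow> 'k) \<Rightarrow> 'a \<Rightarrow> 'k" "range (bv :: 'a \<Rightarrow> 'a \<Rightarrow> 'k)"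
    by unfold_locales (simp_all add: ind sp)
  have "Vector_Spaces.linear scal scal f"
    by unfold_locales (use f in \<open>simp_all add: lin_iff\<close>)
  then show ?thesis
    using F.linear_surj_imp_inj F.linear_inj_imp_surj by blast
qed

locale quasitri_hopf =
  fixes H :: "('i::finite, 'k::field) bialg" and R Ri :: "'i \<times> 'i \<Rightarrow> 'k" and S :: "('i \<Rightarrow> 'k) \<Rightarrow> 'i \<Rightarrow> 'k"
  assumes H: "alg H" "coalg H" "compat H" and S: "antipode H S" and q: "qt_with H R Ri"
begin

lemma lin_S [lins]: "lin S" "lin f \<Longrightarrow> lin (\<lambda>x. S (f x))"
  using antipode_lin[OF S] lin_compose by blast+

lemma antip_H: "antip H = S"
  by (rule antip_eq[OF H(1,2) S])

lemma S_mul: "S (mul H x y) = mul H (S y) (S x)"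
  by (rule antipode_mul[OF H S])

abbreviation "r M i j \<equiv> lift2 M i j R"
abbreviation "ri M i j \<equiv> lift2 M i j Ri"

lemmas alg_H [simp] = H(1)
lemmas assoc = alg_assoc[OF H(1)]

lemma cou_mul_one [simp]: "cou H (mul H x y) = cou H x * cou H y" "cou H (one H) = 1"
  using H(3) by (simp_all add: compat_def)

text \<open>The hexagon identities in Sweedler form: the identities hold in the triple tensor power
  \<open>?M\<close>, and the linear map \<open>?G\<close> evaluates the trilinear \<open>F\<close>
  on them.\<close>

lemma hex_ev:
  fixes F :: "('i \<Rightarrow> 'k) \<Rightarrow> ('i \<Rightarrow> 'k) \<Rightarrow> ('i \<Rightarrow> 'k) \<Rightarrow> 'c \<Rightarrow> 'k"
  assumes F: "\<And>b c. lin (\<lambda>a. F a b c)" "\<And>a c. lin (\<lambda>b. F a b c)" "\<And>a b. lin (F a b)"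
  shows "ev R (\<lambda>d c. sw H d (\<lambda>a b. F a b c)) = ev R (\<lambda>a c. ev R (\<lambda>b c'. F a b (mul H c c')))"
    and "ev Ri (\<lambda>a d. sw H d (\<lambda>b c. F a b c)) = ev Ri (\<lambda>a b. ev Ri (\<lambda>a' c. F (mul H a a') b c))"
proof -
  let ?M = "tens (tens H H) H"
  have HH: "alg (tens H H)" and M: "alg ?M" by (simp_all add: alg_tens)
  let ?i = "\<lambda>x::'i \<Rightarrow> 'k. tv (tv x (one H)) (one H)" and ?j = "\<lambda>x::'i \<Rightarrow> 'k. tv (tv (one H) x) (one H)"
    and ?k = "\<lambda>x::'i \<Rightarrow> 'k. tv (one (tens H H)) x"
  have l: "legs3 H ?M ?i ?j ?k"
    unfolding legs3_def legs2_def
    using alghom_compose[OF alghom_inL[OF H(1), of H] alghom_inL[OF H(1)]] alghom_compose[OF alghom_inR[OF H(1), of H] alghom_inL[OF H(1)]]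
      alghom_inR[OF HH, of H]
    by (simp add: M comm_def mul_tens_tv one_tens)
  let ?G = "\<lambda>X. ev X (\<lambda>u c. ev u (\<lambda>a b. F a b c))"
  have lG: "lin ?G" by (intro lins)
  have G: "?G (tv (tv a b) c) = F a b c" for a b c
  proof -
    have "?G (tv (tv a b) c) = ev (tv a b) (\<lambda>a b. F a b c)"
      by (rule ev_tv) (intro lins F)+
    also have "\<dots> = F a b c" by (rule ev_tv) (rule F)+
    finally show ?thesis .
  qed
  have d: "lift2 ?M ?i ?j (cop H x) = sw H x (\<lambda>a b. tv (tv a b) (one H))" for x
    by (simp add: lift2_def mul_tens_tv)
  have d': "lift2 ?M ?j ?k (cop H x) = sw H x (\<lambda>b c. tv (tv (one H) b) c)" for x
    by (simp add: lift2_def mul_tens_tv one_tens)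
  have "?G (r ?M (\<lambda>x. lift2 ?M ?i ?j (cop H x)) ?k) = ev R (\<lambda>d c. sw H d (\<lambda>a b. F a b c))"
    unfolding d lift2_def[of ?M _ ?k] ev_lin[OF lG] mul_ev_l by (simp add: mul_tens_tv one_tens G)
  moreover have "?G (mul ?M (r ?M ?i ?k) (r ?M ?j ?k)) = ev R (\<lambda>a c. ev R (\<lambda>b c'. F a b (mul H c c')))"
    unfolding lift2_def mul_ev_l by (simp only: mul_ev_r ev_lin[OF lG]) (simp add: mul_tens_tv one_tens G)
  ultimately show "ev R (\<lambda>d c. sw H d (\<lambda>a b. F a b c)) = ev R (\<lambda>a c. ev R (\<lambda>b c'. F a b (mul H c c')))"
    using qt_with_hex1[OF q H(1) l] by (simp add: hex1_def)
  have "?G (ri ?M ?i (\<lambda>x. lift2 ?M ?j ?k (cop H x))) = ev Ri (\<lambda>a d. sw H d (\<lambda>b c. F a b c))"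
    unfolding d' lift2_def[of ?M ?i] ev_lin[OF lG] mul_ev_r by (simp add: mul_tens_tv one_tens G)
  moreover have "?G (mul ?M (ri ?M ?i ?j) (ri ?M ?i ?k)) = ev Ri (\<lambda>a b. ev Ri (\<lambda>a' c. F (mul H a a') b c))"
    unfolding lift2_def mul_ev_l by (simp only: mul_ev_r ev_lin[OF lG]) (simp add: mul_tens_tv one_tens G)
  ultimately show "ev Ri (\<lambda>a d. sw H d (\<lambda>b c. F a b c)) = ev Ri (\<lambda>a b. ev Ri (\<lambda>a' c. F (mul H a a') b c))"
    using qt_with_hex2i[OF H(1,3) q l] by simp
qed

lemma alghom_cou: "alg M \<Longrightarrow> alghom H M (\<lambda>x. cou H x \<odot> one M)"
  by (auto simp: alghom_def intro!: lins)

text \<open>The counit is a leg \<open>e\<close>, and the coproduct spread over \<open>e\<close> and \<open>i\<close> is the leg \<open>i\<close> itself, so the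
hexagon identity reads \<open>R\<^sub>i\<^sub>j = R\<^sub>e\<^sub>j R\<^sub>i\<^sub>j\<close>.\<close>

lemma cou_R: "ev R (\<lambda>a b. cou H a \<odot> b) = one H" and cou_Ri: "ev Ri (\<lambda>a b. cou H b \<odot> a) = one H"
proof -
  let ?M = "tens H H"
  let ?e = "\<lambda>x. cou H x \<odot> one ?M" and ?i = "\<lambda>x::'i \<Rightarrow> 'k. tv x (one H)" and ?j = "\<lambda>x::'i \<Rightarrow> 'k. tv (one H) x"
  have M: "alg ?M" by (simp add: alg_tens)
  have l: "legs3 H ?M ?e ?i ?j" "legs3 H ?M ?i ?j ?e"
    unfolding legs3_def using legs2_in[OF H(1)] alghom_cou[OF M] M by (auto simp: legs2_def comm_def)
  note L = legs3D[OF l(1)]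
  have d: "lift2 ?M ?e ?i (cop H x) = ?i x" for x
    using coalg_counit_l[OF H(2) L(9), of x] by (simp add: lift2_def M)
  have d': "lift2 ?M ?j ?e (cop H x) = ?j x" for x
    using coalg_counit_r[OF H(2) L(10), of x] by (simp add: lift2_def M)
  have 1: "r ?M ?e ?j = one ?M"
  proof -
    have "mul ?M (r ?M ?i ?j) (ri ?M ?i ?j) = mul ?M (mul ?M (r ?M ?e ?j) (r ?M ?i ?j)) (ri ?M ?i ?j)"
      using qt_with_hex1[OF q H(1) l(1)] by (simp add: hex1_def d)
    then show ?thesis by (simp add: alg_assoc[OF M] qt_with_inv[OF q L(13)] M)
  qed
  let ?G = "\<lambda>X. ev X (\<lambda>a b. cou H a \<odot> b)"
  have G: "?G (tv a b) = cou H a \<odot> b" for a b by (rule ev_tv) (intro lins)+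
  have lG: "lin ?G" by (intro lins)
  have "?G (r ?M ?e ?j) = ev R (\<lambda>a b. cou H a \<odot> b)"
    unfolding lift2_def ev_lin[OF lG] by (simp add: M G)
  then show "ev R (\<lambda>a b. cou H a \<odot> b) = one H" unfolding 1 by (simp add: one_tens G)
  have 2: "ri ?M ?i ?e = one ?M"
  proof -
    have "mul ?M (r ?M ?i ?j) (ri ?M ?i ?j) = mul ?M (r ?M ?i ?j) (mul ?M (ri ?M ?i ?j) (ri ?M ?i ?e))"
      using qt_with_hex2i[OF H(1,3) q l(2)] by (simp add: d')
    then show ?thesis using alg_assoc[OF M, of "r ?M ?i ?j" "ri ?M ?i ?j"] by (simp add: qt_with_inv[OF q L(13)] M)
  qed
  let ?G = "\<lambda>X. ev X (\<lambda>a b. cou H b \<odot> a)"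
  have G: "?G (tv a b) = cou H b \<odot> a" for a b by (rule ev_tv) (intro lins)+
  have lG: "lin ?G" by (intro lins)
  have "?G (ri ?M ?i ?e) = ev Ri (\<lambda>a b. cou H b \<odot> a)"
    unfolding lift2_def ev_lin[OF lG] by (simp add: M G)
  then show "ev Ri (\<lambda>a b. cou H b \<odot> a) = one H" unfolding 2 by (simp add: one_tens G)
qed

text \<open>(S \<otimes> id)(R) R is, by the first hexagon identity, the result of applying S(a) b
  to the two halves of (\<Delta> \<otimes> id) R. The antipode axiom leaves the counit on the first
  leg of R, which gives 1.\<close>

lemma S_R: "tensmap S (\<lambda>x. x) R = Ri"
proof (rule alg_inv_unique)
  let ?M = "tens H H"
  show "alg ?M" by (simp add: alg_tens)
  have "mul ?M (tensmap S (\<lambda>x. x) R) R = mul ?M (ev R (\<lambda>a b. tv (S a) b)) (ev R tv)"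
    by (simp add: tensmap_ev)
  also have "\<dots> = ev R (\<lambda>a c. ev R (\<lambda>b c'. tv (mul H (S a) b) (mul H c c')))"
    unfolding mul_ev_l by (simp only: mul_ev_r mul_tens_tv)
  also have "\<dots> = ev R (\<lambda>d c. sw H d (\<lambda>a b. tv (mul H (S a) b) c))"
    by (rule hex_ev(1)[symmetric]) (intro lins)+
  also have "\<dots> = ev R (\<lambda>d c. tv (one H) (cou H d \<odot> c))"
    by (simp add: tv_ev_l[symmetric] antipode_l[OF S])
  also have "\<dots> = one ?M"
    by (simp only: tv_ev_r[symmetric] cou_R one_tens)
  finally show "mul ?M (tensmap S (\<lambda>x. x) R) R = one ?M" .
  show "mul ?M R Ri = one ?M" using q by (simp add: qt_with_def)
qed

lemma S_Ri: "tensmap (\<lambda>x. x) S Ri = R"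
proof (rule alg_inv_unique)
  let ?M = "tens H H"
  show "alg ?M" by (simp add: alg_tens)
  have "mul ?M (tensmap (\<lambda>x. x) S Ri) Ri = mul ?M (ev Ri (\<lambda>a b. tv a (S b))) (ev Ri tv)"
    by (simp add: tensmap_ev)
  also have "\<dots> = ev Ri (\<lambda>a b. ev Ri (\<lambda>a' c. tv (mul H a a') (mul H (S b) c)))"
    unfolding mul_ev_l by (simp only: mul_ev_r mul_tens_tv)
  also have "\<dots> = ev Ri (\<lambda>a d. sw H d (\<lambda>b c. tv a (mul H (S b) c)))"
    by (rule hex_ev(2)[symmetric]) (intro lins)+
  also have "\<dots> = ev Ri (\<lambda>a d. tv (cou H d \<odot> a) (one H))"
    by (simp add: tv_ev_r[symmetric] antipode_l[OF S])
  also have "\<dots> = one ?M"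
    by (simp only: tv_ev_l[symmetric] cou_Ri one_tens)
  finally show "mul ?M (tensmap (\<lambda>x. x) S Ri) Ri = one ?M" .
  show "mul ?M Ri R = one ?M" using q by (simp add: qt_with_def)
qed

lemma S_S_R: "tensmap S S R = R"
  using tensmap_tensmap[OF lin_id lin_S(1), of S "\<lambda>x. x" R] by (simp add: S_R S_Ri)

lemma tensmap_flip: "tensmap f g (flip t) = flip (tensmap g f t)"
  by (simp add: tensmap_ev ev_flip ev_lin[OF lin_flip'])

section \<open>Factorisability and bijectivity of the antipode\<close>

abbreviation "Q \<equiv> Qel H R"

lemma flip_flip: "flip (flip t) = t"
  by (simp add: flip_def)

lemma flip_Q: "flip Q = mul (tens H H) R (flip R)"
  unfolding Qel_def alghom_mul[OF alghom_flip[OF H(1,1)]] flip_flip ..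

text \<open>S \<otimes> S reverses products, fixes R and hence fixes R_21, so the two factors merely
  change places.\<close>

lemma S_S_Q: "tensmap S S Q = flip Q"
proof -
  have "tensmap S S (mul (tens H H) X Y) = mul (tens H H) (tensmap S S Y) (tensmap S S X)" for X Y
  proof -
    have t: "tensmap S S (tv a b) = tv (S a) (S b)" for a b by (rule tensmap_tv) (rule lin_S(1))+
    have "tensmap S S (mul (tens H H) (ev X tv) (ev Y tv))
      = ev X (\<lambda>a b. ev Y (\<lambda>c d. tv (mul H (S c) (S a)) (mul H (S d) (S b))))"
      unfolding mul_ev_l by (simp only: mul_ev_r mul_tens_tv ev_lin[OF lin_tensmap[OF lin_id]] t S_mul)
    also have "\<dots> = mul (tens H H) (ev Y (\<lambda>a b. tv (S a) (S b))) (ev X (\<lambda>a b. tv (S a) (S b)))"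
      unfolding mul_ev_l by (simp only: mul_ev_r mul_tens_tv) (rule ev_swap)
    finally show ?thesis by (simp add: tensmap_ev)
  qed
  then show ?thesis by (simp add: Qel_def flip_Q[unfolded Qel_def] tensmap_flip S_S_R)
qed

text \<open>The transpose of \<open>Qmap H R\<close>: the functional is paired with the second leg
  of R_21 R. This version appears below in the slices over the third leg.\<close>

definition Qt :: "('i \<Rightarrow> 'k) \<Rightarrow> 'i \<Rightarrow> 'k" where
  "Qt a = ev Q (\<lambda>p j. pair a j \<odot> p)"

lemma Qmap_ev: "Qmap H R a = ev Q (\<lambda>p j. pair a p \<odot> j)"
  by (simp add: Qmap_def fun_eq_iff ev_apply mult.assoc[symmetric]) (simp add: mult.commute)

lemma lin_Qt [lins]: "lin Qt"
  unfolding Qt_def by (intro lins)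

lemma pair_zero: "(\<And>b. pair a b = 0) \<Longrightarrow> a = 0"
  by (rule ext) (metis pair_bv_r zero_fun_apply)

text \<open>Since <a, Qmap b> = <b, Qt a>, surjectivity of \<open>Qmap\<close> makes the transpose
  injective, and an injective endomorphism is onto in finite dimension.\<close>

lemma Qt_surj: assumes "factorisable H R" shows "surj Qt"
proof -
  have "a = 0" if "Qt a = 0" for a
  proof (rule pair_zero)
    fix x
    obtain b where b: "x = Qmap H R b"
      using assms unfolding factorisable_def by (meson bij_is_surj surjD)
    let ?v = "\<lambda>_::unit. 1::'k"
    have "pair a x \<odot> ?v = pair b (Qt a) \<odot> ?v"
      unfolding b Qmap_ev Qt_def pair_ev by (simp add: mult.commute)
    then have "(pair a x \<odot> ?v) () = (pair b (Qt a) \<odot> ?v) ()" by (rule fun_cong)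
    then show "pair a x = 0" using that by (simp add: pair_def)
  qed
  have "inj Qt"
  proof (rule injI)
    fix x y assume "Qt x = Qt y"
    then have "Qt (x + (- 1) \<odot> y) = 0"
      by (simp only: lin_add[OF lin_Qt] lin_scal[OF lin_Qt]) (simp add: fun_eq_iff)
    with \<open>\<And>a. Qt a = 0 \<Longrightarrow> a = 0\<close> have "x + (- 1) \<odot> y = 0" by blast
    then show "x = y" by (simp add: fun_eq_iff)
  qed
  then show ?thesis using lin_endo_surj_iff_inj[OF lin_Qt] by simp
qed

text \<open>Pairing the first leg of (S \<otimes> S) Q = flip Q with a shows that S(Qmap(a composed
  with S)) = Qt a. As \<open>Qt\<close> is onto, so is \<open>S\<close>.\<close>

lemma S_bij: assumes "factorisable H R" shows "bij S"
proof -
  have "surj S"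
  proof (rule surjI)
    fix y
    define a where "a = inv Qt y"
    have a: "Qt a = y" using Qt_surj[OF assms] by (simp add: a_def surj_f_inv_f)
    have "S (Qmap H R (app (\<lambda>a b. S (bv b) a) a)) = ev Q (\<lambda>p j. pair a (S p) \<odot> S j)"
      unfolding Qmap_ev antipode_dual_pair[OF lin_S(1)] ev_lin[OF lin_S(1)] lin_scal[OF lin_S(1)] ..
    also have "\<dots> = ev (tensmap S S Q) (\<lambda>p j. pair a p \<odot> j)"
      by (rule ev_tensmap[symmetric]) (intro lins)+
    also have "\<dots> = Qt a"
      unfolding S_S_Q ev_flip Qt_def ..
    finally show "S (Qmap H R (app (\<lambda>a b. S (bv b) a) (inv Qt y))) = y" using a a_def by simp
  qed
  then show ?thesis using lin_endo_surj_iff_inj[OF lin_S(1)] by (simp add: bij_def)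
qed

end

section \<open>The bicrossproduct\<close>

lemma cop2_sum:
  "(\<Sum>(x, y)\<in>UNIV. t (x, y) * F (bv x) (bv y) c) = ev t F c"
  by (simp add: sum_UNIV_pair ev_apply)

text \<open>One step from an iterated coproduct in coordinates to nested \<open>ev\<close>. The
  index w collects the remaining tensor factors and may be a tuple, so the cases of three, four and
  five factors all reduce to it. The value of \<open>ev\<close> is read off over the type
  \<open>unit\<close> because the summand is a scalar.\<close>

lemma cop_step_sum:
  fixes t :: "'i::finite \<times> 'r::finite \<Rightarrow> 'k::field"
  shows "(\<Sum>(x, y, w)\<in>UNIV. (\<Sum>d\<in>UNIV. t (d, w) * dc K d x y) * F (bv x) (bv y) w) =
    (\<Sum>(d, w)\<in>UNIV. t (d, w) * sw K (bv d) (\<lambda>x y j. F x y w) ())"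
proof -
  let ?g = "\<lambda>x y w d. t (d, w) * (dc K d x y * F (bv x) (bv y) w)"
  have "(\<Sum>x\<in>UNIV. \<Sum>y\<in>UNIV. \<Sum>w\<in>UNIV. \<Sum>d\<in>UNIV. ?g x y w d) =
      (\<Sum>w\<in>UNIV. \<Sum>x\<in>UNIV. \<Sum>y\<in>UNIV. \<Sum>d\<in>UNIV. ?g x y w d)"
    by (rule sum_swap3)
  also have "\<dots> = (\<Sum>w\<in>UNIV. \<Sum>d\<in>UNIV. \<Sum>x\<in>UNIV. \<Sum>y\<in>UNIV. ?g x y w d)"
    by (rule sum.cong[OF refl]) (rule sum_swap3)
  also have "\<dots> = (\<Sum>d\<in>UNIV. \<Sum>w\<in>UNIV. \<Sum>x\<in>UNIV. \<Sum>y\<in>UNIV. ?g x y w d)"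
    by (rule sum.swap)
  finally show ?thesis
    by (simp only: sum_UNIV_pair prod.case sum_distrib_right ev_apply cop_bv sum_distrib_left mult.assoc)
qed

lemma cop3_sum:
  "(\<Sum>(x, y, z)\<in>UNIV. cop3 K v (x, y, z) * F (bv x) (bv y) (bv z) c) =
    sw K v (\<lambda>e z. sw K e (\<lambda>x y. F x y z)) c"
proof -
  have "(\<Sum>(x, y, z)\<in>UNIV. cop3 K v (x, y, z) * F (bv x) (bv y) (bv z) c) =
    (\<Sum>(d, z)\<in>UNIV. cop K v (d, z) * sw K (bv d) (\<lambda>x y. F x y (bv z)) c)"
    using cop_step_sum[of "cop K v" K "\<lambda>x y z. F x y (bv z) c"] by (simp add: cop3_def ev_apply)
  then show ?thesis using cop2_sum[of "cop K v" "\<lambda>e z. sw K e (\<lambda>x y. F x y z)" c] by simp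
qed

lemma cop4_sum:
  "(\<Sum>(x, y, z, w)\<in>UNIV. cop4 K v (x, y, z, w) * F (bv x) (bv y) (bv z) (bv w) c) =
    sw K v (\<lambda>e w. sw K e (\<lambda>d z. sw K d (\<lambda>x y. F x y z w))) c"
proof -
  have "(\<Sum>(x, y, z, w)\<in>UNIV. cop4 K v (x, y, z, w) * F (bv x) (bv y) (bv z) (bv w) c) =
    (\<Sum>(d, z, w)\<in>UNIV. cop3 K v (d, z, w) * sw K (bv d) (\<lambda>x y. F x y (bv z) (bv w)) c)"
    using cop_step_sum[of "cop3 K v" K "\<lambda>x y (z, w). F x y (bv z) (bv w) c"]
    by (simp add: cop4_def ev_apply case_prod_unfold)
  then show ?thesis using cop3_sum[of K v "\<lambda>d z w. sw K d (\<lambda>x y. F x y z w)" c] by simp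
qed

lemma cop5_sum:
  "(\<Sum>(x, y, z, w, u)\<in>UNIV. cop5 K v (x, y, z, w, u) * F (bv x) (bv y) (bv z) (bv w) (bv u) c) =
    sw K v (\<lambda>e u. sw K e (\<lambda>d w. sw K d (\<lambda>f z. sw K f (\<lambda>x y. F x y z w u)))) c"
proof -
  have "(\<Sum>(x, y, z, w, u)\<in>UNIV. cop5 K v (x, y, z, w, u) * F (bv x) (bv y) (bv z) (bv w) (bv u) c) =
    (\<Sum>(d, z, w, u)\<in>UNIV. cop4 K v (d, z, w, u) * sw K (bv d) (\<lambda>x y. F x y (bv z) (bv w) (bv u)) c)"
    using cop_step_sum[of "cop4 K v" K "\<lambda>x y (z, w, u). F x y (bv z) (bv w) (bv u) c"]
    by (simp add: cop5_def ev_apply case_prod_unfold)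
  then show ?thesis using cop4_sum[of K v "\<lambda>f z w u. sw K f (\<lambda>x y. F x y z w u)" c] by simp
qed

lemma ev_swap2:
  "ev s (\<lambda>a b. ev (t a b) (\<lambda>c d. ev u (\<lambda>p q. F a b c d p q))) =
   ev u (\<lambda>p q. ev s (\<lambda>a b. ev (t a b) (\<lambda>c d. F a b c d p q)))"
  unfolding ev_swap[of "t _ _"] by (rule ev_swap)

context quasitri_hopf
begin

abbreviation "T \<equiv> tens (cop_of H) H"
abbreviation "B \<equiv> bicross H"

lemma coassoc: "sw H x (\<lambda>a c. sw H a (\<lambda>p q. F p q c)) = sw H x (\<lambda>p d. sw H d (\<lambda>q r. F p q r))"
  by (rule coalg_coassoc[OF H(2)])

lemma alg_T [simp]: "alg T" by (simp add: alg_tens)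
lemma compat_T: "compat T" by (intro compat_tens compat_cop_of) (simp_all add: H)
lemma coalg_T: "coalg T" by (intro coalg_tens coalg_cop_of H)

lemma mul_T_tv [simp]: "mul T (tv a b) (tv c d) = tv (mul H a c) (mul H b d)"
  by (simp add: mul_tens_tv)

lemma one_T: "one T = tv (one H) (one H)"
  by (simp add: one_tens)

text \<open>The antipode is the inverse of \<open>S\<close> on the co-opposite factor and
  \<open>S\<close> on the other, hence the need for factorisability.\<close>

lemma hopf_T: assumes "factorisable H R" shows "is_hopf T"
  unfolding is_hopf_iff is_bialg_iff
  using antipode_tens[OF antipode_cop_of[OF H S S_bij[OF assms]] S] coalg_T compat_T by auto

text \<open>\<open>bprod\<close> prescribes the product on basis vectors; the formula is extended
  linearly, one argument at a time.\<close>

lemma mul_B_tv: "mul B (tv f h) (tv p g) =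
  sw H h (\<lambda>e z. sw H e (\<lambda>x y. tv (mul H f (mul H (mul H x p) (S y))) (mul H z g)))"
  (is "?m f h p g = ?r f h p g")
proof -
  have 1: "?m (bv f) (bv h) (bv p) (bv g) = ?r (bv f) (bv h) (bv p) (bv g)" for f h p g
    using cop3_sum[of H "bv h" "\<lambda>x y z. tv (mul H (bv f) (mul H (mul H x (bv p)) (S y))) (mul H z (bv g))"]
    by (intro ext) (simp add: bv_pair[symmetric] mul_bv bicross_def bprod_def antip_H del: mul_bv[of H])
  have 2: "?m (bv f) (bv h) (bv p) g = ?r (bv f) (bv h) (bv p) g" for f h p g
    by (rule lin_eqI[of "\<lambda>g. ?m (bv f) (bv h) (bv p) g"], (intro lins)+) (rule 1)
  have 3: "?m (bv f) (bv h) p g = ?r (bv f) (bv h) p g" for f h p g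
    by (rule lin_eqI[of "\<lambda>p. ?m (bv f) (bv h) p g"], (intro lins)+) (rule 2)
  have 4: "?m (bv f) h p g = ?r (bv f) h p g" for f h p g
    by (rule lin_eqI[of "\<lambda>h. ?m (bv f) h p g"], (intro lins)+) (rule 3)
  show ?thesis
    by (rule lin_eqI[of "\<lambda>f. ?m f h p g"], (intro lins)+) (rule 4)
qed

lemma cop_B_tv: "cop B (tv f h) = sw H f (\<lambda>f1 f2. sw H h (\<lambda>e h4. sw H e (\<lambda>d h3. sw H d (\<lambda>h1 h2.
    tv (tv f2 h2) (tv (mul H (mul H f1 h1) (S h3)) h4)))))"
proof -
  let ?F = "\<lambda>h f1 f2. sw H h (\<lambda>e h4. sw H e (\<lambda>d h3. sw H d (\<lambda>h1 h2.
    tv (tv f2 h2) (tv (mul H (mul H f1 h1) (S h3)) h4))))"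
  have 1: "cop B (tv (bv f) (bv h)) = sw H (bv f) (?F (bv h))" for f h
  proof (rule ext)
    fix c
    have "cop B (tv (bv f) (bv h)) c = bcop H f h c"
      by (cases c) (simp add: bv_pair[symmetric] cop_bv bicross_def)
    also have "\<dots> = (\<Sum>(f1, f2)\<in>UNIV. cop H (bv f) (f1, f2) * (\<Sum>(h1, h2, h3, h4)\<in>UNIV.
       cop4 H (bv h) (h1, h2, h3, h4) * tv (tv (bv f2) (bv h2)) (tv (mul H (mul H (bv f1) (bv h1)) (S (bv h3))) (bv h4)) c))"
      by (simp add: bcop_def antip_H case_prod_unfold sum_distrib_left mult.assoc)
    also have "\<dots> = sw H (bv f) (?F (bv h)) c"
      unfolding cop4_sum[where F = "\<lambda>h1 h2 h3 h4. tv (tv _ h2) (tv (mul H (mul H _ h1) (S h3)) h4)"]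
      by (rule cop2_sum)
    finally show "cop B (tv (bv f) (bv h)) c = sw H (bv f) (?F (bv h)) c" .
  qed
  have 2: "cop B (tv (bv f) h) = sw H (bv f) (?F h)" for f h
    by (rule lin_eqI[of "\<lambda>h. cop B (tv (bv f) h)"], (intro lins)+) (rule 1)
  show ?thesis
    by (rule lin_eqI[of "\<lambda>f. cop B (tv f h)"], (intro lins)+) (rule 2)
qed

lemma one_B: "one B = tv (one H) (one H)"
  by (simp add: one_def bicross_def)

lemma cou_B_tv: "cou B (tv f h) = cou H f * cou H h"
  by (simp add: cou_def bicross_def sum_UNIV_pair sum_product mult_ac)

definition theta1_inv :: "('i \<times> 'i \<Rightarrow> 'k) \<Rightarrow> 'i \<times> 'i \<Rightarrow> 'k" where
  "theta1_inv X = ev X (\<lambda>f h. sw H h (\<lambda>a b. tv (mul H f a) b))"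

lemma theta1_ev: "theta1 H X = ev X (\<lambda>f h. sw H h (\<lambda>a b. tv (mul H f (S a)) b))"
proof (rule ext)
  fix c
  show "theta1 H X c = ev X (\<lambda>f h. sw H h (\<lambda>a b. tv (mul H f (S a)) b)) c"
    unfolding theta1_def antip_H
      cop2_sum[where F = "\<lambda>a b. tv (mul H _ (S a)) b"] by (rule cop2_sum)
qed

lemma theta1_inv_tv: "theta1_inv (tv f h) = sw H h (\<lambda>a b. tv (mul H f a) b)"
  unfolding theta1_inv_def by (rule ev_tv) (intro lins)+

lemma theta1_tv: "theta1 H (tv f h) = sw H h (\<lambda>a b. tv (mul H f (S a)) b)"
  unfolding theta1_ev by (rule ev_tv) (intro lins)+

lemma lin_theta1_inv [lins]: "lin theta1_inv" "lin f \<Longrightarrow> lin (\<lambda>x. theta1_inv (f x))"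
  unfolding theta1_inv_def by (intro lins; assumption?)+

lemma lin_theta1 [lins]: "lin (theta1 H)" "lin f \<Longrightarrow> lin (\<lambda>x. theta1 H (f x))"
  unfolding theta1_ev by (intro lins; assumption?)+

lemma theta1_theta1_inv: "theta1 H (theta1_inv X) = X"
proof (rule lin_eq_tvI, (intro lins)+)
  fix f h
  have "theta1 H (theta1_inv (tv f h)) = sw H h (\<lambda>a b. sw H b (\<lambda>c d. tv (mul H f (mul H a (S c))) d))"
    by (simp add: theta1_inv_tv theta1_tv ev_lin[OF lin_theta1(1)] assoc)
  also have "\<dots> = sw H h (\<lambda>e d. sw H e (\<lambda>a c. tv (mul H f (mul H a (S c))) d))"
    by (rule coassoc[symmetric])
  also have "\<dots> = sw H h (\<lambda>e d. cou H e \<odot> tv f d)"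
    by (subst antipode_r_lin[OF S, where G = "\<lambda>y. tv (mul H f y) _"]) ((intro lins)+, simp)
  also have "\<dots> = tv f h" by (rule coalg_counit_l[OF H(2)]) (intro lins)
  finally show "theta1 H (theta1_inv (tv f h)) = tv f h" .
qed

lemma theta1_inv_theta1: "theta1_inv (theta1 H X) = X"
proof (rule lin_eq_tvI, (intro lins)+)
  fix f h
  have "theta1_inv (theta1 H (tv f h)) = sw H h (\<lambda>a b. sw H b (\<lambda>c d. tv (mul H f (mul H (S a) c)) d))"
    by (simp add: theta1_inv_tv theta1_tv ev_lin[OF lin_theta1_inv(1)] assoc)
  also have "\<dots> = sw H h (\<lambda>e d. sw H e (\<lambda>a c. tv (mul H f (mul H (S a) c)) d))"
    by (rule coassoc[symmetric])
  also have "\<dots> = sw H h (\<lambda>e d. cou H e \<odot> tv f d)"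
    by (subst antipode_l_lin[OF S, where G = "\<lambda>y. tv (mul H f y) _"]) ((intro lins)+, simp)
  also have "\<dots> = tv f h" by (rule coalg_counit_l[OF H(2)]) (intro lins)
  finally show "theta1_inv (theta1 H (tv f h)) = tv f h" .
qed

text \<open>Removes S(h_2) h_3 from the middle of a fourfold coproduct of h. The bracketing is the
  one produced when the last factor of h_1 \<otimes> h_2 \<otimes> h_3 is split once more.\<close>

lemma sw_cancel:
  assumes F: "\<And>d b. lin (\<lambda>u. F d u b)" "\<And>d u. lin (F d u)"
  shows "sw H h (\<lambda>e z. sw H e (\<lambda>d y. sw H z (\<lambda>a b. F d (mul H (S y) a) b))) = sw H h (\<lambda>d b. F d (one H) b)"
proof -
  have "sw H h (\<lambda>e z. sw H e (\<lambda>d y. sw H z (\<lambda>a b. F d (mul H (S y) a) b)))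
     = sw H h (\<lambda>d w. sw H w (\<lambda>y z. sw H z (\<lambda>a b. F d (mul H (S y) a) b)))"
    by (rule coassoc)
  also have "\<dots> = sw H h (\<lambda>d w. sw H w (\<lambda>u b. sw H u (\<lambda>y a. F d (mul H (S y) a) b)))"
    by (rule ev_cong) (rule coassoc[symmetric])
  also have "\<dots> = sw H h (\<lambda>d w. sw H w (\<lambda>u b. cou H u \<odot> F d (one H) b))"
    by (intro ev_cong antipode_l_lin[OF S] F)
  also have "\<dots> = sw H h (\<lambda>d w. F d (one H) w)"
    by (rule ev_cong, rule coalg_counit_l[OF H(2)]) (rule F)
  finally show ?thesis .
qed

text \<open>The bicrossproduct conjugates p by h, giving f h_1 p S(h_2) in the first factor. Then
  \<open>theta1_inv\<close> multiplies this by h_3 g_1, so S(h_2) h_3 cancels and the factorwise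
  product f h_1 p g_1 \<otimes> h_2 g_2 remains.\<close>

lemma theta1_inv_mul: "theta1_inv (mul B x y) = mul T (theta1_inv x) (theta1_inv y)"
proof -
  have 1: "theta1_inv (mul B (tv f h) (tv p g)) = mul T (theta1_inv (tv f h)) (theta1_inv (tv p g))" for f h p g
  proof -
    let ?G = "\<lambda>d u b. sw H g (\<lambda>c c'. tv (mul H (mul H f (mul H d p)) (mul H u c)) (mul H b c'))"
    have "theta1_inv (mul B (tv f h) (tv p g)) = sw H h (\<lambda>e z. sw H e (\<lambda>x y. sw H (mul H z g) (\<lambda>a b. tv (mul H (mul H f (mul H (mul H x p) (S y))) a) b)))"
      by (simp only: mul_B_tv ev_lin[OF lin_theta1_inv(1)] theta1_inv_tv)
    also have "\<dots> = sw H h (\<lambda>e z. sw H e (\<lambda>x y. sw H z (\<lambda>a b. sw H g (\<lambda>c d. tv (mul H (mul H f (mul H (mul H x p) (S y))) (mul H a c)) (mul H b d)))))"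
      by (intro ev_cong sw_mul[OF H(3)]) (intro lins)+
    also have "\<dots> = sw H h (\<lambda>e z. sw H e (\<lambda>d y. sw H z (\<lambda>a b. ?G d (mul H (S y) a) b)))"
      by (simp only: assoc)
    also have "\<dots> = sw H h (\<lambda>d b. ?G d (one H) b)"
      by (rule sw_cancel) (intro lins)+
    also have "\<dots> = mul T (theta1_inv (tv f h)) (theta1_inv (tv p g))"
      unfolding theta1_inv_tv mul_ev_l by (simp add: mul_ev_r assoc)
    finally show ?thesis .
  qed
  have 2: "theta1_inv (mul B (tv f h) y) = mul T (theta1_inv (tv f h)) (theta1_inv y)" for f h y
    by (rule lin_eq_tvI, (intro lins)+) (rule 1)
  show ?thesis
    by (rule lin_eq_tvI[of "\<lambda>x. theta1_inv (mul B x y)"], (intro lins)+) (rule 2)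
qed

lemma theta1_inv_one: "theta1_inv (one B) = one T"
  unfolding one_B theta1_inv_tv by (subst sw_one[OF H(3)]) ((intro lins)+, simp add: one_T)

text \<open>In the second copy of the bicrossproduct, S(h_3) meets the first half of the coproduct
  of h_4 and \<open>sw_cancel\<close> removes it. The four factors of h that are left are regrouped
  into the coproduct of f h_1 \<otimes> h_2 in \<open>T\<close>.\<close>

lemma theta1_inv_cop: "cop T (theta1_inv x) = tensmap theta1_inv theta1_inv (cop B x)"
proof (rule lin_eq_tvI[of "\<lambda>x. cop T (theta1_inv x)"], (intro lins)+)
  fix f h
  let ?F = "\<lambda>f1 f2 d u b. sw H d (\<lambda>h1 h2. sw H h2 (\<lambda>a c. tv (tv (mul H f2 a) c) (tv (mul H (mul H f1 h1) u) b)))"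
  have t: "tensmap theta1_inv theta1_inv (tv x y) = tv (theta1_inv x) (theta1_inv y)" for x y by (rule tensmap_tv) (rule lin_theta1_inv)+
  have "tensmap theta1_inv theta1_inv (cop B (tv f h)) = sw H f (\<lambda>f1 f2. sw H h (\<lambda>e h4. sw H e (\<lambda>d h3. sw H d (\<lambda>h1 h2.
      sw H h2 (\<lambda>a c. sw H h4 (\<lambda>p b. tv (tv (mul H f2 a) c) (tv (mul H (mul H f1 h1) (mul H (S h3) p)) b)))))))"
    unfolding cop_B_tv ev_lin[OF lin_tensmap[OF lin_id]] t theta1_inv_tv tv_ev_l by (simp only: tv_ev_r assoc)
  also have "\<dots> = sw H f (\<lambda>f1 f2. sw H h (\<lambda>e h4. sw H e (\<lambda>d h3. sw H h4 (\<lambda>p b. ?F f1 f2 d (mul H (S h3) p) b))))"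
    by (intro ev_cong ev_swap2)
  also have "\<dots> = sw H f (\<lambda>f1 f2. sw H h (\<lambda>d b. ?F f1 f2 d (one H) b))"
    by (intro ev_cong sw_cancel) (intro lins)+
  also have "\<dots> = sw H f (\<lambda>f1 f2. sw H h (\<lambda>d b. sw H d (\<lambda>e b1. sw H e (\<lambda>h1 a. tv (tv (mul H f2 a) b1) (tv (mul H f1 h1) b)))))"
    by (simp add: coassoc)
  also have "\<dots> = sw H f (\<lambda>f1 f2. sw H h (\<lambda>e k. sw H k (\<lambda>b1 b. sw H e (\<lambda>h1 a. tv (tv (mul H f2 a) b1) (tv (mul H f1 h1) b)))))"
    by (rule ev_cong, rule coassoc)
  also have "\<dots> = sw H f (\<lambda>f1 f2. sw H h (\<lambda>a b. sw H a (\<lambda>a1 a2. sw H b (\<lambda>b1 b2. tv (tv (mul H f2 a2) b1) (tv (mul H f1 a1) b2)))))"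
    by (intro ev_cong) (rule ev_swap)
  also have "\<dots> = sw H h (\<lambda>a b. sw H f (\<lambda>f1 f2. sw H a (\<lambda>a1 a2. sw H b (\<lambda>b1 b2. tv (tv (mul H f2 a2) b1) (tv (mul H f1 a1) b2)))))"
    by (rule ev_swap)
  also have "\<dots> = sw H h (\<lambda>a b. cop T (tv (mul H f a) b))"
    unfolding cop_tens_tv cop_cop_of ev_flip
    by (intro ev_cong sw_mul[OF H(3), symmetric]) (intro lins)+
  also have "\<dots> = cop T (theta1_inv (tv f h))"
    by (simp only: theta1_inv_tv ev_lin[OF lin_cop'])
  finally show "cop T (theta1_inv (tv f h)) = tensmap theta1_inv theta1_inv (cop B (tv f h))" ..
qed

lemma theta1_inv_cou: "cou T (theta1_inv x) = cou B x"
proof -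
  let ?v = "\<lambda>_::unit. 1::'k"
  have "cou T (theta1_inv x) \<odot> ?v = cou B x \<odot> ?v"
  proof (rule lin_eq_tvI[of "\<lambda>x. cou T (theta1_inv x) \<odot> ?v"], (intro lins)+)
    fix f h
    have "cou T (theta1_inv (tv f h)) \<odot> ?v = sw H h (\<lambda>a b. cou H a \<odot> (cou H b \<odot> (cou H f \<odot> ?v)))"
      unfolding theta1_inv_tv by (subst ev_lin[of "\<lambda>x. cou T x \<odot> ?v"]) (intro lins, simp add: cou_tens_tv mult_ac)
    also have "\<dots> = cou H h \<odot> (cou H f \<odot> ?v)" by (rule coalg_counit_l[OF H(2)]) (intro lins)
    finally show "cou T (theta1_inv (tv f h)) \<odot> ?v = cou B (tv f h) \<odot> ?v" by (simp add: cou_B_tv mult.commute)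
  qed
  from fun_cong[OF this, of "()"] show ?thesis by simp
qed

lemma bialg_iso_theta1_inv: "bialg_iso B T theta1_inv"
  unfolding bialg_iso_def alghom_def
  using theta1_inv_mul theta1_inv_one theta1_inv_cop theta1_inv_cou lin_theta1_inv(1) o_bij[of "theta1 H" theta1_inv] theta1_theta1_inv theta1_inv_theta1
  by (simp add: fun_eq_iff)

lemma bialg_iso_theta1: "bialg_iso T B (theta1 H)"
proof -
  have "inv theta1_inv = theta1 H" by (rule inv_equality) (simp_all add: theta1_theta1_inv theta1_inv_theta1)
  then show ?thesis using bialg_iso_inv[OF bialg_iso_theta1_inv] by simp
qed

lemma hopf_B: "factorisable H R \<Longrightarrow> is_hopf B"
  by (rule bialg_iso_is_hopf[OF bialg_iso_theta1 hopf_T])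

end

section \<open>Quasitriangular structures on the bicrossproduct\<close>

lemma qt_with_bialg_iso:
  assumes f: "bialg_iso K L f" and K: "alg K" and q: "qt_with K R Ri"
  shows "qt_with L (tensmap f f R) (tensmap f f Ri)"
proof (rule qt_with_I)
  note F = bisoD[OF f]
  show L: "alg L" by (rule bialg_iso_alg[OF f K])
  note h = alghom_tensmap[OF L L F(2) F(2)]
  show "mul (tens L L) (tensmap f f R) (tensmap f f Ri) = one (tens L L)"
    "mul (tens L L) (tensmap f f Ri) (tensmap f f R) = one (tens L L)"
    using q by (simp_all add: qt_with_def alghom_mul[OF h, symmetric] alghom_one[OF h])
  obtain g where g: "\<And>x. f (g x) = x" using bij_is_surj[OF F(1)] by (meson surj_f_inv_f)
  have "mul (tens L L) (flip (cop L (f x))) (tensmap f f R) = mul (tens L L) (tensmap f f R) (cop L (f x))" for x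
  proof -
    have "flip (tensmap f f (cop K x)) = tensmap f f (flip (cop K x))"
      by (simp add: tensmap_ev ev_flip ev_lin[OF lin_flip'])
    then show ?thesis
      using q by (simp add: F(6) alghom_mul[OF h, symmetric] qt_with_def)
  qed
  from this[of "g _"] show "mul (tens L L) (flip (cop L x)) (tensmap f f R) = mul (tens L L) (tensmap f f R) (cop L x)" for x
    by (simp add: g)
  {
    fix M :: "('m::finite, 'b) bialg" and i j k
    assume l: "legs3 L M i j k"
    note l3 = legs3D[OF l]
    have l': "legs3 K M (\<lambda>x. i (f x)) (\<lambda>x. j (f x)) (\<lambda>x. k (f x))"
      using l alghom_compose[OF F(2), of M] by (simp add: legs3_def legs2_def comm_compose)
    have e: "lift2 M i j (tensmap f f t) = lift2 M (\<lambda>x. i (f x)) (\<lambda>x. j (f x)) t" if "lin i" "lin j" for i j t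
      unfolding lift2_def by (rule ev_tensmap) (intro lins that)+
    have "hex1 L (tensmap f f R) M i j k"
      using qt_with_hex1[OF q K l'] by (simp add: hex1_def e l3(8-10) F(6) lin_compose[OF lin_lift2' lin_cop'])
    moreover have "hex2 L (tensmap f f R) M i j k"
      using qt_with_hex2[OF q K l'] by (simp add: hex2_def e l3(8-10) F(6) lin_compose[OF lin_lift2' lin_cop'])
    ultimately have "hex1 L (tensmap f f R) M i j k \<and> hex2 L (tensmap f f R) M i j k" ..
  } note h = this
  show "hex1 L (tensmap f f R) (tens (tens L L) L) i j k"
    if "legs3 L (tens (tens L L) L) i j k" for i j k
    using h[OF that] ..
  show "hex2 L (tensmap f f R) (tens L (tens L L)) i j k"
    if "legs3 L (tens L (tens L L)) i j k" for i j k
    using h[OF that] ..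
qed

context quasitri_hopf
begin

lemma inv_R: "inv_el (tens H H) R = Ri"
  using q by (intro inv_el_eq) (simp_all add: qt_with_def alg_tens)

lemma mul_tens4: "mul (tens4 H) X Y = mul (tens T T) X Y"
  by (simp add: tens4_def)

lemma mul_R13_R24: 
  "mul (tens T T) (ev X (\<lambda>a b. tv (tv a (one H)) (tv b (one H)))) (ev Y (\<lambda>c d. tv (tv (one H) c) (tv (one H) d))) = tensR X Y"
  unfolding mul_ev_l tensR_def by (simp add: mul_ev_r mul_tens_tv)

lemma R13inv_ev: "R13inv H R = ev Ri (\<lambda>a b. tv (tv a (one H)) (tv b (one H)))"
proof -
  have "ev Ri (\<lambda>a b. tv (tv a (one H)) (tv b (one H))) ((p, q), (r, s)) = ev Ri tv (p, r) * one H q * one H s" for p q r s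
    by (simp only: ev_apply sum_distrib_right tv_apply) (simp add: mult_ac)
  then show ?thesis by (auto simp: fun_eq_iff R13inv_def inv_R one_def)
qed

lemma R24_ev: "R24 H R = ev R (\<lambda>a b. tv (tv (one H) a) (tv (one H) b))"
proof -
  have "ev R (\<lambda>a b. tv (tv (one H) a) (tv (one H) b)) ((p, q), (r, s)) = ev R tv (q, s) * one H p * one H r" for p q r s
    by (simp only: ev_apply sum_distrib_right tv_apply) (simp add: mult_ac)
  then show ?thesis by (auto simp: fun_eq_iff R24_def one_def mult_ac)
qed

lemma R31_ev: "R31 H R = ev (flip R) (\<lambda>a b. tv (tv a (one H)) (tv b (one H)))"
proof -
  have "ev (flip R) (\<lambda>a b. tv (tv a (one H)) (tv b (one H))) ((p, q), (r, s)) = ev (flip R) tv (p, r) * one H q * one H s" for p q r s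
    by (simp only: ev_apply sum_distrib_right tv_apply) (simp add: mult_ac)
  then show ?thesis by (auto simp: fun_eq_iff R31_def one_def)
qed

text \<open>Before \<open>theta1\<close> the two elements are \<open>tensR Ri R\<close> and
  \<open>tensR (flip R) R\<close>: the co-opposite factor carries either R^{-1} or R_21, and the
  factor \<open>H\<close> carries R.\<close>

lemma qt_B:
  shows "qt B (tensmap (theta1 H) (theta1 H) (mul (tens4 H) (R13inv H R) (R24 H R)))"
    and "qt B (tensmap (theta1 H) (theta1 H) (mul (tens4 H) (R31 H R) (R24 H R)))"
proof -
  note c = compat_cop_of[OF H(1,3)]
  show "qt B (tensmap (theta1 H) (theta1 H) (mul (tens4 H) (R13inv H R) (R24 H R)))"
    unfolding mul_tens4 R13inv_ev R24_ev mul_R13_R24 qt_iff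
    using qt_with_bialg_iso[OF bialg_iso_theta1 alg_T qt_with_tens[OF _ c qt_with_cop_of_inv[OF H(1,3) q] H(1,3) q]] by auto
  show "qt B (tensmap (theta1 H) (theta1 H) (mul (tens4 H) (R31 H R) (R24 H R)))"
    unfolding mul_tens4 R31_ev R24_ev mul_R13_R24 qt_iff
    using qt_with_bialg_iso[OF bialg_iso_theta1 alg_T qt_with_tens[OF _ c qt_with_cop_of_flip[OF H(1,3) q] H(1,3) q]] by auto
qed

end

section \<open>The isomorphism from the double\<close>

lemma mul_tens_cop_of_l: "mul (tens (cop_of K) L) = mul (tens K L)"
  by (intro ext) (simp add: mul_def tens_def cop_of_def)

lemma alghom_tens_cop_of_l: "alghom A (tens K L) f \<Longrightarrow> alghom A (tens (cop_of K) L) f"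
  by (simp add: alghom_def mul_tens_cop_of_l one_tens)

context quasitri_hopf
begin

abbreviation "D \<equiv> dualH H"

lemma mul4:
  assumes "alg M" "mul M b c = mul M c b"
  shows "mul M (mul M a b) (mul M c d) = mul M (mul M a c) (mul M b d)"
proof -
  have "mul M (mul M a b) (mul M c d) = mul M a (mul M (mul M b c) d)" by (simp only: alg_assoc[OF assms(1)])
  then show ?thesis by (simp only: assms alg_assoc[OF assms(1)])
qed

text \<open>The first identity is the Yang-Baxter equation with both sides inverted. The second is
  the equation for the legs j, i, k with R_jk and R_ik moved to the other sides.\<close>

lemma ybe_inv:
  assumes l: "legs3 H M i j k"
  shows "mul M (ri M j k) (mul M (ri M i k) (ri M i j)) = mul M (ri M i j) (mul M (ri M i k) (ri M j k))"
    and "mul M (ri M j k) (mul M (ri M i k) (r M j i)) = mul M (r M j i) (mul M (ri M i k) (ri M j k))"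
proof -
  note L = legs3D[OF l]
  note M = L(1) note AM = alg_assoc[OF M]
  note v = qt_with_inv[OF q L(11)] qt_with_inv[OF q L(12)] qt_with_inv[OF q L(13)]
  have v': "mul M (r M i j) (mul M (ri M i j) x) = x" "mul M (ri M i j) (mul M (r M i j) x) = x"
     "mul M (r M i k) (mul M (ri M i k) x) = x" "mul M (ri M i k) (mul M (r M i k) x) = x"
     "mul M (r M j k) (mul M (ri M j k) x) = x" "mul M (ri M j k) (mul M (r M j k) x) = x" for x
    by (simp_all only: AM[symmetric] v alg_one_l[OF M])
  show "mul M (ri M j k) (mul M (ri M i k) (ri M i j)) = mul M (ri M i j) (mul M (ri M i k) (ri M j k))"
  proof (rule alg_inv_unique[OF M])
    show "mul M (mul M (ri M j k) (mul M (ri M i k) (ri M i j))) (mul M (r M i j) (mul M (r M i k) (r M j k))) = one M"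
      by (simp add: AM v v')
    show "mul M (mul M (r M i j) (mul M (r M i k) (r M j k))) (mul M (ri M i j) (mul M (ri M i k) (ri M j k))) = one M"
      unfolding ybe[OF H(1,3) q l] by (simp add: AM v v')
  qed
  have l': "legs3 H M j i k" using l by (simp add: legs3_def legs2_sym)
  have y: "mul M (r M j i) (mul M (r M j k) (r M i k)) = mul M (r M i k) (mul M (r M j k) (r M j i))"
    by (rule ybe[OF H(1,3) q l'])
  \<comment> \<open>The factors R_jk R_ik and their inverses are inserted on the right, so that one
    side of \<open>y\<close> appears in the middle.\<close>
  have "mul M (ri M j k) (mul M (ri M i k) (r M j i)) =
    mul M (ri M j k) (mul M (ri M i k) (mul M (mul M (r M j i) (mul M (r M j k) (r M i k))) (mul M (ri M i k) (ri M j k))))"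
    by (simp add: AM v' v M)
  also have "\<dots> = mul M (r M j i) (mul M (ri M i k) (ri M j k))"
    unfolding y by (simp add: AM v')
  finally show "mul M (ri M j k) (mul M (ri M i k) (r M j i)) = mul M (r M j i) (mul M (ri M i k) (ri M j k))" .
qed

abbreviation "M3 \<equiv> tens T H"
abbreviation "l1 \<equiv> \<lambda>x::'i \<Rightarrow> 'k. tv (tv x (one H)) (one H)"
abbreviation "l2 \<equiv> \<lambda>x::'i \<Rightarrow> 'k. tv (tv (one H) x) (one H)"
abbreviation "l3 \<equiv> \<lambda>x::'i \<Rightarrow> 'k. tv (tv (one H) (one H)) x"

lemma alghom_t1: "alghom H T (\<lambda>x. tv x (one H))" and alghom_t2: "alghom H T (\<lambda>x. tv (one H) x)"
  using alghom_inL[OF H(1), of "cop_of H"] alghom_inR[of "cop_of H" H] by simp_all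

lemma alg_M3 [simp]: "alg M3" by (simp add: alg_tens)

lemma mul_M3_tv [simp]: "mul M3 (tv x a) (tv y b) = tv (mul T x y) (mul H a b)"
  by (simp add: mul_tens_tv)

lemma one_T_mul [simp]: "mul T (tv (one H) (one H)) x = x" "mul T x (tv (one H) (one H)) = x"
  using alg_one_l[OF alg_T, of x] alg_one_r[OF alg_T, of x] by (simp_all add: one_T)

lemma legs3_M3: "legs3 H M3 l1 l2 l3" and legs3_M3': "legs3 H M3 l3 l1 l2"
proof -
  have "alghom H M3 l1" "alghom H M3 l2" "alghom H M3 l3"
    using alghom_compose[OF alghom_t1 alghom_inL[OF H(1)]] alghom_compose[OF alghom_t2 alghom_inL[OF H(1)]]
      alghom_inR[OF alg_T, of H] by (simp_all add: one_T)
  then show "legs3 H M3 l1 l2 l3" "legs3 H M3 l3 l1 l2"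
    by (simp_all add: legs3_def legs2_def comm_def)
qed

definition "L = mul M3 (ri M3 l3 l1) (r M3 l2 l3)"

definition contract :: "('i \<Rightarrow> 'k) \<Rightarrow> ('a::finite \<times> 'i \<Rightarrow> 'k) \<Rightarrow> 'a \<Rightarrow> 'k" where
  "contract a X = ev X (\<lambda>t y. pair a y \<odot> t)"

lemma contract_tv: "contract a (tv t y) = pair a y \<odot> t"
  unfolding contract_def by (rule ev_tv) (intro lins)+

lemma lin_contract [lins]: "lin (contract a)" "lin f \<Longrightarrow> lin (\<lambda>x. contract a (f x))"
  unfolding contract_def by (intro lins; assumption?)+

lemma lin_contract_l [lins]: "lin f \<Longrightarrow> lin (\<lambda>x. contract (f x) X)"
  unfolding contract_def by (intro lins)

lemma contract_mul_r: "contract a (mul (tens K H) X (tv t (one H))) = mul K (contract a X) t"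
proof (rule lin_eq_tvI[of "\<lambda>X. contract a (mul (tens K H) X (tv t (one H)))"], (intro lins)+)
  show "contract a (mul (tens K H) (tv x y) (tv t (one H))) = mul K (contract a (tv x y)) t" for x y
    by (simp add: mul_tens_tv contract_tv)
qed

lemma contract_mul_l: "contract a (mul (tens K H) (tv t (one H)) X) = mul K t (contract a X)"
proof (rule lin_eq_tvI, (intro lins)+)
  show "contract a (mul (tens K H) (tv t (one H)) (tv x y)) = mul K t (contract a (tv x y))" for x y
    by (simp add: mul_tens_tv contract_tv)
qed

abbreviation "Lslice a \<equiv> contract a L"

text \<open>\<open>L\<close> is built from legs and products alone, so an algebra map out of
  \<open>M3\<close> merely relocates its legs.\<close>

lemma L_image:
  assumes "alghom M3 M f"
  shows "f L = mul M (ri M (\<lambda>x. f (l3 x)) (\<lambda>x. f (l1 x))) (r M (\<lambda>x. f (l2 x)) (\<lambda>x. f (l3 x)))"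
  unfolding L_def alghom_mul[OF assms] alghom_lift2_image[OF assms] ..

text \<open>The hexagon identities split R_3i^{-1} and R_j3 when the third leg is spread over k and
  l. Both put the l factor first, and the two inner factors have disjoint legs, so they can be
  exchanged to collect l and k separately.\<close>

lemma L_cop_leg3:
  assumes l: "legs3 H M i j k" "legs3 H M i j l" "legs2 H M k l"
  shows "mul M (ri M (\<lambda>x. lift2 M k l (cop H x)) i) (r M j (\<lambda>x. lift2 M k l (cop H x)))
    = mul M (mul M (ri M l i) (r M j l)) (mul M (ri M k i) (r M j k))"
proof -
  note L = legs3D[OF l(1)] and L' = legs3D[OF l(2)] and kl = legs2D[OF l(3)]
  have a: "legs3 H M k l i" and b: "legs3 H M j k l"
    using l by (simp_all add: legs3_def legs2_sym)
  have c: "mul M (ri M k i) (r M j l) = mul M (r M j l) (ri M k i)"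
    by (rule lift2_lift2_comm[OF L(1) comm_sym[OF L(7)] kl(4) L(5) L'(6)])
  show ?thesis
    unfolding qt_with_hex1i[OF H(1,3) q a] qt_with_hex2[OF q H(1) b, unfolded hex2_def]
    by (rule mul4[OF L(1) c])
qed

text \<open>Pairing the two halves of the split third leg with b and a turns the coproduct there
  into the product of the dual. The order L_124 L_123 reverses the factors, which is why the double
  contains the opposite of the dual.\<close>

lemma Lslice_mul: "Lslice (mul D b a) = mul T (Lslice a) (Lslice b)"
proof -
  let ?M = "tens M3 H"
  let ?T = "\<lambda>t. tv (tv t (one H)) (one H)"
  let ?k = "\<lambda>y. tv (tv (one T) y) (one H)" and ?l = "\<lambda>y. tv (one M3) y"
  have M: "alg ?M" by (simp add: alg_tens)
  have hT: "alghom T ?M ?T"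
    by (rule alghom_compose[OF alghom_inL[OF H(1)] alghom_inL[OF H(1)]])
  have hk: "alghom H ?M ?k" by (rule alghom_compose[OF alghom_inR[OF alg_T] alghom_inL[OF H(1)]])
  have hl: "alghom H ?M ?l" by (rule alghom_inR[OF alg_M3])
  have kl: "legs2 H ?M ?k ?l"
    unfolding legs2_def using M hk hl by (simp add: comm_def mul_tens_tv one_tens)
  have cT: "comm ?M ?T ?k" "comm ?M ?T ?l"
    by (simp_all add: comm_def mul_tens_tv one_tens)
  let ?i = "\<lambda>x::'i \<Rightarrow> 'k. ?T (tv x (one H))" and ?j = "\<lambda>x::'i \<Rightarrow> 'k. ?T (tv (one H) x)"
  have hi: "alghom H ?M ?i" "alghom H ?M ?j" by (rule alghom_compose[OF alghom_t1 hT] alghom_compose[OF alghom_t2 hT])+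
  have l: "legs3 H ?M ?i ?j ?k" "legs3 H ?M ?i ?j ?l"
    unfolding legs3_def legs2_def using M hi hk hl
      comm_compose_l[OF cT(1), of "\<lambda>x. tv x (one H)"] comm_compose_l[OF cT(2), of "\<lambda>x. tv x (one H)"]
      comm_compose_l[OF cT(1), of "\<lambda>x. tv (one H) x"] comm_compose_l[OF cT(2), of "\<lambda>x. tv (one H) x"]
    by (simp_all add: comm_def mul_tens_tv)
  \<comment> \<open>The third leg spread over the legs 3 and 4 of \<open>?M\<close>; using it in
    place of \<open>?l\<close> expresses the coproduct applied to the third leg of
    \<open>L\<close>.\<close>
  define d where "d = (\<lambda>x. lift2 ?M ?k ?l (cop H x))"
  have hd: "alghom H ?M d"
    unfolding d_def using alghom_del[OF H(3) M hk hl] kl by (simp add: legs2_def)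
  have cd: "comm ?M ?T d" unfolding d_def
    by (rule comm_compose_r[OF comm_lift2_r[OF M cT]])
  have f1: "alghom M3 ?M (lift2 ?M ?T d)" by (rule alghom_lift2[OF M hT hd cd])
  have f2: "alghom M3 ?M (lift2 ?M ?T ?l)" by (rule alghom_lift2[OF M hT hl cT(2)])
  have f3: "alghom M3 ?M (\<lambda>x. tv x (one H))" by (rule alghom_inL[OF H(1)])
  note tv1 = lift2_tv[OF alghom_lin[OF hT] alghom_lin[OF hd]] and tv2 = lift2_tv[OF alghom_lin[OF hT] alghom_lin[OF hl]]
  have one: "?T (tv (one H) (one H)) = one ?M" by (simp add: one_tens)
  have e1: "lift2 ?M ?T d L = mul ?M (ri ?M d ?i) (r ?M ?j d)"
    unfolding L_image[OF f1] tv1 alghom_one[OF hd] one by (simp add: M)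
  have e2: "lift2 ?M ?T ?l L = mul ?M (ri ?M ?l ?i) (r ?M ?j ?l)"
    unfolding L_image[OF f2] tv2 alghom_one[OF hl] one by (simp add: M)
  have e3: "tv L (one H) = mul ?M (ri ?M ?k ?i) (r ?M ?j ?k)"
    unfolding L_image[OF f3] by (simp add: one_T)
  have e: "lift2 ?M ?T d L = mul ?M (lift2 ?M ?T ?l L) (tv L (one H))"
    unfolding e1 e2 e3 unfolding d_def by (rule L_cop_leg3[OF l kl])
  let ?G = "\<lambda>X. contract b (contract a X)"
  have lG: "lin ?G" by (intro lins)
  have "?G (lift2 ?M ?T d L) = ev L (\<lambda>t y. sw H y (\<lambda>y1 y2. pair b y1 \<odot> pair a y2 \<odot> t))"
    unfolding lift2_def[of ?M ?T d] unfolding d_def lift2_def[of ?M ?k ?l] mul_ev_r ev_lin[OF lG]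
    by (simp add: mul_tens_tv one_tens contract_tv lin_scal[OF lin_contract(1)] mult.commute)
  also have "\<dots> = Lslice (mul D b a)"
    unfolding pair_mul_dual[symmetric] contract_def ..
  finally have 1: "?G (lift2 ?M ?T d L) = Lslice (mul D b a)" .
  have g: "?G (mul ?M (mul ?M (?T t) (?l y)) (tv X (one H))) = pair a y \<odot> mul T t (contract b X)" for t y X
  proof -
    have "mul ?M (mul ?M (?T t) (?l y)) (tv X (one H)) = tv (mul M3 (tv t (one H)) X) y"
      by (simp add: mul_tens_tv[of M3] alg_assoc[OF alg_M3])
    then show ?thesis by (simp add: contract_tv lin_scal[OF lin_contract(1)] contract_mul_l)
  qed
  have "?G (mul ?M (lift2 ?M ?T ?l L) (tv L (one H))) = ev L (\<lambda>t y. pair a y \<odot> mul T t (Lslice b))"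
    unfolding lift2_def mul_ev_l ev_lin[OF lG] g ..
  also have "\<dots> = mul T (Lslice a) (Lslice b)"
    unfolding contract_def[of a L] mul_ev_l by simp
  finally show ?thesis using e 1 by simp
qed

text \<open>The counit on either leg is an algebra map, so it sends R and R^{-1} to mutually inverse
  elements. \<open>cou_R\<close> and \<open>cou_Ri\<close> say that one element of each pair is
  1.\<close>

lemma cou_R': "ev R (\<lambda>a b. cou H b \<odot> a) = one H" and cou_Ri': "ev Ri (\<lambda>a b. cou H a \<odot> b) = one H"
proof -
  let ?G = "\<lambda>X. ev X (\<lambda>a b. cou H a \<odot> b)" and ?G' = "\<lambda>X. ev X (\<lambda>a b. cou H b \<odot> a)"
  let ?e = "\<lambda>x. cou H x \<odot> one H"
  have c: "comm H ?e (\<lambda>x. x)" by (simp add: comm_def)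
  have "alghom (tens H H) H (lift2 H ?e (\<lambda>x. x))" "alghom (tens H H) H (lift2 H (\<lambda>x. x) ?e)"
    using alghom_lift2[OF H(1) alghom_cou[OF H(1)] alghom_id c] alghom_lift2[OF H(1) alghom_id alghom_cou[OF H(1)] comm_sym[OF c]] .
  moreover have "lift2 H ?e (\<lambda>x. x) = ?G" "lift2 H (\<lambda>x. x) ?e = ?G'"
    by (simp_all add: fun_eq_iff lift2_def)
  ultimately have h: "alghom (tens H H) H ?G" "alghom (tens H H) H ?G'" by simp_all
  have "mul (tens H H) R Ri = one (tens H H)" using q by (simp add: qt_with_def)
  from arg_cong[OF this, of ?G] arg_cong[OF this, of ?G']
  have "mul H (?G R) (?G Ri) = one H" "mul H (?G' R) (?G' Ri) = one H"
    by (simp_all only: alghom_mul[OF h(1)] alghom_mul[OF h(2)] alghom_one[OF h(1)] alghom_one[OF h(2)])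
  then show "?G' R = one H" "?G Ri = one H" by (simp_all only: cou_R cou_Ri alg_one_l[OF H(1)] alg_one_r[OF H(1)])
qed

lemma Lslice_one: "Lslice (one D) = one T"
proof -
  have eq: "L = ev Ri (\<lambda>a b. ev R (\<lambda>c d. tv (tv b c) (mul H a d)))"
    unfolding L_def lift2_def mul_ev_l by (simp add: mul_ev_r)
  have "Lslice (one D) = ev Ri (\<lambda>a b. ev R (\<lambda>c d. tv (cou H a \<odot> b) (cou H d \<odot> c)))"
    unfolding eq ev_lin[OF lin_contract(1)] contract_tv by (simp add: mult.commute)
  also have "\<dots> = tv (one H) (one H)"
    by (simp only: tv_ev_r[symmetric] tv_ev_l[symmetric] cou_R' cou_Ri')
  finally show ?thesis by (simp add: one_T)
qed

definition Li where "Li = mul M3 (ri M3 l2 l3) (r M3 l3 l1)"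

lemma L_Li: "mul M3 L Li = one M3" "mul M3 Li L = one M3"
proof -
  note l = legs3D[OF legs3_M3]
  note v = qt_with_inv[OF q l(13)] qt_with_inv[OF q legs2_sym[OF l(12)]]
  note AM = alg_assoc[OF alg_M3]
  have v': "mul M3 (r M3 l2 l3) (mul M3 (ri M3 l2 l3) x) = x" "mul M3 (r M3 l3 l1) (mul M3 (ri M3 l3 l1) x) = x" for x
    by (simp_all only: AM[symmetric] v alg_one_l[OF alg_M3])
  show "mul M3 L Li = one M3" "mul M3 Li L = one M3"
    by (simp_all add: L_def Li_def AM v v')
qed

abbreviation "dl x \<equiv> tv (cop H x) (one H)"

lemma alghom_copT: "alghom H T (cop H)"
  using H(3) by (simp add: compat_def alghom_tens_cop_of_l)

lemma lift2_l12: "lift2 M3 l1 l2 t = tv t (one H)"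
  using tv_ev_l[of t tv "one H"] by (simp add: lift2_def)

text \<open>R_23 exchanges the factors g_2 and g_3, then R_31^{-1} exchanges the entries of the legs
  1 and 3. Together the three factors of g are permuted cyclically.\<close>

lemma L_tw: "mul M3 L (sw H g (\<lambda>e z. mul M3 (dl e) (l3 z))) = mul M3 (sw H g (\<lambda>z e. mul M3 (l3 z) (dl e))) L"
proof -
  note l = legs3D[OF legs3_M3]
  note AM = alg_assoc[OF alg_M3]
  let ?d = "\<lambda>i j x. lift2 M3 i j (cop H x)"
  have d: "?d i j x = sw H x (\<lambda>a b. mul M3 (i a) (j b))" for i j x by (simp add: lift2_def)
  have dl: "dl x = ?d l1 l2 x" for x by (simp only: lift2_l12)
  have "mul M3 (r M3 l2 l3) (sw H g (\<lambda>e z. mul M3 (dl e) (l3 z)))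
     = mul M3 (r M3 l2 l3) (sw H g (\<lambda>a e. mul M3 (l1 a) (?d l2 l3 e)))"
    unfolding dl d mul_ev_l AM coassoc mul_ev_r ..
  also have "\<dots> = sw H g (\<lambda>a e. mul M3 (l1 a) (mul M3 (r M3 l2 l3) (?d l2 l3 e)))"
    unfolding mul_ev_r comm_swap[OF alg_M3 comm_lift2_l[OF alg_M3 comm_sym[OF l(5)] comm_sym[OF l(6)]]] ..
  also have "\<dots> = sw H g (\<lambda>a e. mul M3 (l1 a) (mul M3 (?d l3 l2 e) (r M3 l2 l3)))"
    by (simp only: qt_with_tw[OF q l(13)])
  also have "\<dots> = mul M3 (sw H g (\<lambda>e c. mul M3 (?d l1 l3 e) (l2 c))) (r M3 l2 l3)"
    unfolding d mul_ev_l mul_ev_r AM coassoc ..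
  finally have 1: "mul M3 (r M3 l2 l3) (sw H g (\<lambda>e z. mul M3 (dl e) (l3 z)))
    = mul M3 (sw H g (\<lambda>e c. mul M3 (?d l1 l3 e) (l2 c))) (r M3 l2 l3)" .
  have c: "mul M3 (ri M3 l3 l1) (l2 x) = mul M3 (l2 x) (ri M3 l3 l1)" for x
    by (rule commD[of M3 "lift2 M3 l3 l1" l2]) (rule comm_lift2_l[OF alg_M3 comm_sym[OF l(7)] l(5)])
  have "mul M3 (ri M3 l3 l1) (sw H g (\<lambda>e c. mul M3 (?d l1 l3 e) (l2 c)))
      = sw H g (\<lambda>e c. mul M3 (mul M3 (ri M3 l3 l1) (?d l1 l3 e)) (l2 c))"
    unfolding mul_ev_r AM ..
  also have "\<dots> = sw H g (\<lambda>e c. mul M3 (mul M3 (?d l3 l1 e) (l2 c)) (ri M3 l3 l1))"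
    by (simp only: qt_with_tw_inv[OF q legs2_sym[OF l(12)], symmetric] AM c)
  also have "\<dots> = mul M3 (sw H g (\<lambda>z e. mul M3 (l3 z) (dl e))) (ri M3 l3 l1)"
    unfolding dl d mul_ev_l mul_ev_r AM coassoc ..
  finally have 2: "mul M3 (ri M3 l3 l1) (sw H g (\<lambda>e c. mul M3 (?d l1 l3 e) (l2 c)))
    = mul M3 (sw H g (\<lambda>z e. mul M3 (l3 z) (dl e))) (ri M3 l3 l1)" .
  show ?thesis
    unfolding L_def AM 1 unfolding AM[symmetric] 2 ..
qed

lemma mul_dbl_tv: "mul (dbl H) (tv h a) (tv g b) =
  sw H g (\<lambda>e z. sw H e (\<lambda>x y. sw D a (\<lambda>f w. sw D f (\<lambda>u v.
    pair u x \<odot> pair w (S z) \<odot> tv (mul H h y) (mul D b v)))))"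
  (is "?m h a g b = ?r h a g b")
proof -
  let ?F = "\<lambda>h b u v w x y z. pair u x \<odot> pair w (S z) \<odot> tv (mul H h y) (mul D b v)"
  have 1: "?m (bv h) (bv a) (bv g) (bv b) = ?r (bv h) (bv a) (bv g) (bv b)" for h a g b
  proof (rule ext)
    fix c
    have "?m (bv h) (bv a) (bv g) (bv b) c = dprod H h a g b c"
      by (simp add: bv_pair[symmetric] mul_bv dbl_def)
    also have "\<dots> = (\<Sum>(x, y, z)\<in>UNIV. cop3 H (bv g) (x, y, z) * (\<Sum>(u, v, w)\<in>UNIV. cop3 D (bv a) (u, v, w) *
        ?F (bv h) (bv b) (bv u) (bv v) (bv w) (bv x) (bv y) (bv z) c))"
      unfolding dprod_def antip_H by (simp only: case_prod_unfold sum_distrib_left scal_apply mult.assoc)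
    also have "\<dots> = ?r (bv h) (bv a) (bv g) (bv b) c"
      unfolding cop3_sum[where F = "\<lambda>u v w. ?F (bv h) (bv b) u v w _ _ _"]
      by (rule cop3_sum)
    finally show "?m (bv h) (bv a) (bv g) (bv b) c = ?r (bv h) (bv a) (bv g) (bv b) c" .
  qed
  have 2: "?m (bv h) (bv a) (bv g) b = ?r (bv h) (bv a) (bv g) b" for h a g b
    by (rule lin_eqI[of "\<lambda>b. ?m (bv h) (bv a) (bv g) b"], (intro lins)+) (rule 1)
  have 3: "?m (bv h) (bv a) g b = ?r (bv h) (bv a) g b" for h a g b
    by (rule lin_eqI[of "\<lambda>g. ?m (bv h) (bv a) g b"], (intro lins)+) (rule 2)
  have 4: "?m (bv h) a g b = ?r (bv h) a g b" for h a g b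
    by (rule lin_eqI[of "\<lambda>a. ?m (bv h) a g b"], (intro lins)+) (rule 3)
  show ?thesis
    by (rule lin_eqI[of "\<lambda>h. ?m h a g b"], (intro lins)+) (rule 4)
qed

lemma one_dbl: "one (dbl H) = tv (one H) (one D)"
  by (simp add: one_def dbl_def tens_def op_of_def)

lemma cop_dbl_tv: "cop (dbl H) (tv h a) = sw H h (\<lambda>p q. sw D a (\<lambda>b c. tv (tv p b) (tv q c)))"
proof -
  have "cop (dbl H) = cop (tens H D)"
    by (simp add: fun_eq_iff cop_def dbl_def tens_def op_of_def)
  then show ?thesis by (simp only: cop_tens_tv)
qed

lemma cou_dbl: "cou (dbl H) x = cou (tens H D) x"
  by (simp add: cou_def dbl_def tens_def op_of_def)

lemma coalg_dbl: "coalg (dbl H)"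
proof -
  have "dc (dbl H) = dc (tens H D)" "ec (dbl H) = ec (tens H D)"
    by (simp_all add: dbl_def tens_def op_of_def)
  then show ?thesis
    using coalg_tens[OF H(2) coalg_dualH[OF H(1)]] by (simp add: coalg_def)
qed

text \<open>The composite of \<open>theta\<close> with the inverse of \<open>theta1\<close>, as
  \<open>theta1_inv_theta\<close> confirms. It is introduced in closed form so that the double can
  be treated entirely inside \<open>T\<close>.\<close>

definition theta2 :: "('i \<times> 'i \<Rightarrow> 'k) \<Rightarrow> 'i \<times> 'i \<Rightarrow> 'k" where
  "theta2 X = ev X (\<lambda>h a. mul T (cop H h) (Lslice a))"

lemma lin_theta2 [lins]: "lin theta2" "lin f \<Longrightarrow> lin (\<lambda>x. theta2 (f x))"
  unfolding theta2_def by (intro lins; assumption?)+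

lemma theta2_tv: "theta2 (tv h a) = mul T (cop H h) (Lslice a)"
  unfolding theta2_def by (rule ev_tv) (intro lins)+

lemma cop_mul: "cop H (mul H x y) = mul T (cop H x) (cop H y)"
  by (rule alghom_mul[OF alghom_copT])

text \<open>The cross relation of the double. Moving \<open>L\<close> past g leaves g_1 to the left
  of the third leg of \<open>L\<close> and S(g_3) to its right; pairing with a then produces the
  factors <g_1, a_1> and <S g_3, a_3> of the product in D(H).\<close>

lemma Lslice_cop: "mul T (Lslice a) (cop H g) = sw H g (\<lambda>e z. sw H e (\<lambda>x y. sw D a (\<lambda>f w. sw D f (\<lambda>u v.
    pair u x \<odot> pair w (S z) \<odot> mul T (cop H y) (Lslice v)))))"
proof -
  note AM = alg_assoc[OF alg_M3]
  \<comment> \<open>The trivial third leg is rewritten as g_3 S(g_4), so that a full threefold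
    coproduct is available for \<open>L_tw\<close> and a factor with S stays behind on the
    right.\<close>
  have "dl g = sw H g (\<lambda>d z. cou H z \<odot> dl d)"
    by (rule coalg_counit_r[OF H(2), symmetric]) (intro lins)
  also have "\<dots> = sw H g (\<lambda>d w. sw H w (\<lambda>p z. tv (cop H d) (mul H p (S z))))"
    by (subst antipode_r_lin[OF S, where G = "\<lambda>y. tv (cop H _) y"]) ((intro lins)+, rule refl)
  also have "\<dots> = sw H g (\<lambda>e z. mul M3 (sw H e (\<lambda>d p. mul M3 (dl d) (l3 p))) (l3 (S z)))"
    unfolding mul_ev_l coassoc by simp
  finally have d: "dl g = sw H g (\<lambda>e z. mul M3 (sw H e (\<lambda>d p. mul M3 (dl d) (l3 p))) (l3 (S z)))" .
  have "mul M3 L (dl g) = sw H g (\<lambda>e z. mul M3 (mul M3 L (sw H e (\<lambda>d p. mul M3 (dl d) (l3 p)))) (l3 (S z)))"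
    unfolding d by (simp only: AM mul_ev_r[of M3 L "cop H g"])
  also have "\<dots> = sw H g (\<lambda>e z. sw H e (\<lambda>x y. mul M3 (mul M3 (mul M3 (l3 x) (dl y)) L) (l3 (S z))))"
    unfolding L_tw mul_ev_l ..
  finally have "mul T (Lslice a) (cop H g) = sw H g (\<lambda>e z. sw H e (\<lambda>x y. contract a (mul M3 (mul M3 (mul M3 (l3 x) (dl y)) L) (l3 (S z)))))"
    unfolding contract_mul_r[symmetric] by (simp only: ev_lin[OF lin_contract(1)])
  also have "\<dots> = sw H g (\<lambda>e z. sw H e (\<lambda>x y. ev L (\<lambda>t p. pair a (mul H (mul H x p) (S z)) \<odot> mul T (cop H y) t)))"
  proof -
    have "contract a (mul M3 (mul M3 (mul M3 (l3 x) (dl y)) X) (l3 z)) = ev X (\<lambda>t p. pair a (mul H (mul H x p) z) \<odot> mul T (cop H y) t)" for x y z X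
      by (rule lin_eq_tvI[of "\<lambda>X. contract a (mul M3 (mul M3 (mul M3 (l3 x) (dl y)) X) (l3 z))"], (intro lins)+)
        (subst ev_tv, (intro lins)+, simp add: contract_tv)
    then show ?thesis by simp
  qed
  also have "\<dots> = sw H g (\<lambda>e z. sw H e (\<lambda>x y. sw D a (\<lambda>f w. sw D f (\<lambda>u v.
    ev L (\<lambda>t p. pair u x \<odot> pair v p \<odot> pair w (S z) \<odot> mul T (cop H y) t)))))"
    unfolding pair_mul ev_swap[of L] ..
  also have "\<dots> = sw H g (\<lambda>e z. sw H e (\<lambda>x y. sw D a (\<lambda>f w. sw D f (\<lambda>u v.
    pair u x \<odot> pair w (S z) \<odot> mul T (cop H y) (Lslice v)))))"
    unfolding contract_def[of _ L] mul_ev_r ev_scal by (simp add: mult_ac)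
  finally show ?thesis .
qed

lemma theta2_mul: "theta2 (mul (dbl H) X Y) = mul T (theta2 X) (theta2 Y)"
proof -
  note AT = alg_assoc[OF alg_T]
  have 1: "theta2 (mul (dbl H) (tv h a) (tv g b)) = mul T (theta2 (tv h a)) (theta2 (tv g b))" for h a g b
  proof -
    have "mul T (theta2 (tv h a)) (theta2 (tv g b)) = mul T (cop H h) (mul T (mul T (Lslice a) (cop H g)) (Lslice b))"
      by (simp only: theta2_tv AT)
    also have "\<dots> = sw H g (\<lambda>e z. sw H e (\<lambda>x y. sw D a (\<lambda>f w. sw D f (\<lambda>u v.
        pair u x \<odot> pair w (S z) \<odot> theta2 (tv (mul H h y) (mul D b v))))))"
      unfolding Lslice_cop mul_ev_l mul_ev_r by (simp add: theta2_tv Lslice_mul cop_mul AT)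
    finally show ?thesis
      unfolding mul_dbl_tv by (simp only: ev_lin[OF lin_theta2(1)] lin_scal[OF lin_theta2(1)])
  qed
  have 2: "theta2 (mul (dbl H) (tv h a) Y) = mul T (theta2 (tv h a)) (theta2 Y)" for h a Y
    by (rule lin_eq_tvI, (intro lins)+) (rule 1)
  show ?thesis
    by (rule lin_eq_tvI[of "\<lambda>X. theta2 (mul (dbl H) X Y)"], (intro lins)+) (rule 2)
qed

lemma theta2_one: "theta2 (one (dbl H)) = one T"
  by (simp add: one_dbl theta2_tv Lslice_one alghom_one[OF alghom_copT])

text \<open>The slices of R_32 R_23 yield 1 \<otimes> H only. To reach p \<otimes> g, the range is
  multiplied on the left by coproducts, under which it is closed: p \<otimes> g = \<Delta>(p_1) (1
  \<otimes> S(p_2) g).\<close>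

lemma theta2_surj: assumes f: "factorisable H R" shows "surj theta2"
proof -
  note l = legs3D[OF legs3_M3]
  have h: "r M3 l3 (\<lambda>x. dl x) = mul M3 (r M3 l3 l2) (r M3 l3 l1)"
    using qt_with_hex2[OF q H(1) legs3_M3', unfolded hex2_def lift2_l12] .
  have QL: "mul M3 (r M3 l3 (\<lambda>x. dl x)) L = lift2 M3 l2 l3 Q"
  proof -
    have "mul M3 (r M3 l3 (\<lambda>x. dl x)) L = mul M3 (r M3 l3 l2) (mul M3 (mul M3 (r M3 l3 l1) (ri M3 l3 l1)) (r M3 l2 l3))"
      by (simp only: h L_def alg_assoc[OF alg_M3])
    also have "\<dots> = mul M3 (lift2 M3 l2 l3 (flip R)) (lift2 M3 l2 l3 R)"
      by (simp only: qt_with_inv[OF q legs2_sym[OF l(12)]] alg_one_l[OF alg_M3] lift2_flip[OF l(7)])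
    finally show ?thesis
      by (simp only: Qel_def alghom_mul[OF legs2_alghom_lift2[OF l(13)]])
  qed
  have y: "\<exists>X. theta2 X = tv (one H) y" for y
  proof -
    obtain a where a: "Qt a = y" using surjD[OF Qt_surj[OF f], of y] by auto
    have "contract a (lift2 M3 l2 l3 Q) = tv (one H) y"
      unfolding lift2_def ev_lin[OF lin_contract(1)] a[symmetric] Qt_def tv_ev_r by (simp add: contract_tv)
    \<comment> \<open>The other side of \<open>QL\<close> has slices in the range: splitting a by
      the dual coproduct separates the R factor from \<open>L\<close>, and each term is
      \<open>theta2\<close> of a pure tensor.\<close>
    moreover have "contract a (mul M3 (r M3 l3 (\<lambda>x. dl x)) L) = ev R (\<lambda>x y. sw D a (\<lambda>b c. pair b x \<odot> mul T (cop H y) (Lslice c)))"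
    proof -
      have "contract a (mul M3 (mul M3 (l3 x) (dl y)) X) = sw D a (\<lambda>b c. pair b x \<odot> mul T (cop H y) (contract c X))" for x y X
      proof (rule lin_eq_tvI[of "\<lambda>X. contract a (mul M3 (mul M3 (l3 x) (dl y)) X)"], (intro lins)+)
        show "contract a (mul M3 (mul M3 (l3 x) (dl y)) (tv t z)) = sw D a (\<lambda>b c. pair b x \<odot> mul T (cop H y) (contract c (tv t z)))" for t z
          by (simp add: contract_tv pair_mul)
      qed
      then show ?thesis unfolding lift2_def mul_ev_l ev_lin[OF lin_contract(1)] by simp
    qed
    moreover have "\<dots> = theta2 (ev R (\<lambda>x y. sw D a (\<lambda>b c. pair b x \<odot> tv y c)))"
      by (simp only: ev_lin[OF lin_theta2(1)] lin_scal[OF lin_theta2(1)] theta2_tv)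
    ultimately show ?thesis unfolding QL by metis
  qed
  define X where "X y = (SOME X. theta2 X = tv (one H) y)" for y
  have X: "theta2 (X y) = tv (one H) y" for y unfolding X_def using someI_ex[OF y] .
  have c: "mul T (cop H p) (theta2 X) = theta2 (ev X (\<lambda>h a. tv (mul H p h) a))" for p X
    by (simp only: theta2_def[of X] mul_ev_r ev_lin[OF lin_theta2(1)] theta2_tv cop_mul alg_assoc[OF alg_T])
  have "tv p g \<in> range theta2" for p g
  proof -
    have "sw H p (\<lambda>a b. mul T (cop H a) (tv (one H) (mul H (S b) g))) = sw H p (\<lambda>e b. sw H e (\<lambda>x y. tv x (mul H y (mul H (S b) g))))"
    proof (rule ev_cong)
      fix a b
      have "mul T (sw H (bv a) tv) (tv (one H) (mul H (S (bv b)) g)) = sw H (bv a) (\<lambda>x y. tv x (mul H y (mul H (S (bv b)) g)))"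
        unfolding mul_ev_l by simp
      then show "mul T (cop H (bv a)) (tv (one H) (mul H (S (bv b)) g)) = sw H (bv a) (\<lambda>x y. tv x (mul H y (mul H (S (bv b)) g)))"
        by simp
    qed
    also have "\<dots> = sw H p (\<lambda>x w. sw H w (\<lambda>y b. tv x (mul H (mul H y (S b)) g)))"
      by (simp only: coassoc assoc)
    also have "\<dots> = sw H p (\<lambda>x w. cou H w \<odot> tv x g)"
      by (subst antipode_r_lin[OF S, where G = "\<lambda>y. tv _ (mul H y g)"]) ((intro lins)+, simp)
    also have "\<dots> = tv p g" by (rule coalg_counit_r[OF H(2)]) (intro lins)
    finally have "tv p g = sw H p (\<lambda>a b. mul T (cop H a) (theta2 (X (mul H (S b) g))))" by (simp only: X)
    also have "\<dots> = theta2 (sw H p (\<lambda>a b. ev (X (mul H (S b) g)) (\<lambda>h c. tv (mul H a h) c)))"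
      by (simp only: c ev_lin[OF lin_theta2(1)])
    finally show ?thesis by blast
  qed
  then have "\<exists>X. theta2 X = tv p g" for p g by (metis imageE)
  then obtain Z where Z: "theta2 (Z p g) = tv p g" for p g by metis
  \<comment> \<open>\<open>Z\<close> is any choice of preimages of pure tensors; \<open>ev\<close>
    consults it on basis vectors only, so it need not be linear.\<close>
  have "theta2 (ev X (\<lambda>p g. Z p g)) = X" for X
    by (simp only: ev_lin[OF lin_theta2(1)] Z ev_tv_id')
  then show ?thesis by (rule surjI[of theta2 "\<lambda>X. ev X Z"])
qed

lemma theta2_bij: "factorisable H R \<Longrightarrow> bij theta2"
  using theta2_surj lin_endo_surj_iff_inj[OF lin_theta2(1)] by (simp add: bij_def)

text \<open>Contraction turns the product of T \<otimes> H into convolution over the coproduct of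
  the dual. Hence the slices of \<open>Li\<close> and of \<open>L\<close> are convolution inverse to
  each other.\<close>

lemma theta2_antipode:
  fixes a
  shows "sw D a (\<lambda>b c. mul T (contract b Li) (Lslice c)) = pair a (one H) \<odot> one T"
    and "sw D a (\<lambda>b c. mul T (Lslice b) (contract c Li)) = pair a (one H) \<odot> one T"
proof -
  have "sw D a (\<lambda>b c. mul T (contract b X) (contract c Y)) = contract a (mul M3 X Y)" for X Y
  proof -
    have "contract a (mul M3 X Y) = contract a (mul M3 (ev X tv) (ev Y tv))" by simp
    also have "\<dots> = ev X (\<lambda>t y. ev Y (\<lambda>t' y'. sw D a (\<lambda>b c. pair b y \<odot> pair c y' \<odot> mul T t t')))"
      unfolding mul_ev_l by (simp only: mul_ev_r mul_M3_tv ev_lin[OF lin_contract(1)] contract_tv pair_mul)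
    also have "\<dots> = sw D a (\<lambda>b c. ev X (\<lambda>t y. ev Y (\<lambda>t' y'. pair b y \<odot> pair c y' \<odot> mul T t t')))"
      by (subst ev_swap[of Y]) (rule ev_swap)
    finally show ?thesis
      unfolding contract_def[of _ X] contract_def[of _ Y] mul_ev_l by (simp add: mul_ev_r mult.commute)
  qed
  then show "sw D a (\<lambda>b c. mul T (contract b Li) (Lslice c)) = pair a (one H) \<odot> one T"
    "sw D a (\<lambda>b c. mul T (Lslice b) (contract c Li)) = pair a (one H) \<odot> one T"
    by (simp_all add: L_Li one_tens contract_tv)
qed

end

section \<open>Twisting by an invertible element\<close>

lemma mul_twist [simp]: "mul (twist_bialg K chi) = mul K"
  and one_twist [simp]: "one (twist_bialg K chi) = one K"
  and cou_twist [simp]: "cou (twist_bialg K chi) = cou K"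
  by (intro ext; simp add: mul_def one_def cou_def twist_bialg_def)+

lemma mul_tens_twist: "mul (tens (twist_bialg K chi) (twist_bialg K chi)) = mul (tens K K)"
  by (intro ext) (simp add: mul_def tens_def twist_bialg_def)

lemma alg_twist [simp]: "alg (twist_bialg K chi) = alg K"
  unfolding alg_def mul_twist one_twist ..

lemma cop_twist: "cop (twist_bialg K chi) x =
    mul (tens K K) (mul (tens K K) chi (cop K x)) (inv_el (tens K K) chi)"
  by (rule lin_eqI[of "cop (twist_bialg K chi)"], (intro lins)+)
    (simp only: cop_bv[of "twist_bialg K chi"], simp add: twist_bialg_def)

text \<open>Conjugation by an invertible element is multiplicative and preserves the unit.
  Coassociativity of the twist is obtained from the double instead.\<close>

lemma compat_twist:
  assumes K: "alg K" "compat K"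
    and i: "mul (tens K K) chi chi' = one (tens K K)" "mul (tens K K) chi' chi = one (tens K K)"
  shows "compat (twist_bialg K chi)"
proof -
  let ?m = "mul (tens K K)"
  have KK: "alg (tens K K)" using K by (simp add: alg_tens)
  note AK = alg_assoc[OF KK]
  have inv: "inv_el (tens K K) chi = chi'" by (rule inv_el_eq[OF KK i])
  have c: "?m chi' (?m chi x) = x" for x by (simp only: AK[symmetric] i alg_one_l[OF KK])
  have "?m (?m (?m chi x) chi') (?m (?m chi y) chi') = ?m (?m chi (?m x y)) chi'" for x y
    by (simp only: AK c)
  moreover have "?m (?m chi (one (tens K K))) chi' = one (tens K K)" by (simp add: KK i)
  moreover have "one (tens (twist_bialg K chi) (twist_bialg K chi)) = one (tens K K)" by (simp add: one_tens)
  ultimately have "alghom K (tens (twist_bialg K chi) (twist_bialg K chi)) (cop (twist_bialg K chi))"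
    using alghom_mul[OF alghom_cop[OF K(2)]] alghom_one[OF alghom_cop[OF K(2)]]
    by (simp add: alghom_def lins cop_twist inv mul_tens_twist)
  then show ?thesis
    using K(2) by (simp add: compat_def alghom_def)
qed

lemma bialg_iso_twist:
  assumes f: "bialg_iso K L f" and K: "alg K"
    and i: "mul (tens K K) chi chi' = one (tens K K)" "mul (tens K K) chi' chi = one (tens K K)"
  shows "bialg_iso (twist_bialg K chi) (twist_bialg L (tensmap f f chi)) f"
proof -
  note F = bisoD[OF f]
  have L: "alg L" by (rule bialg_iso_alg[OF f K])
  have KK: "alg (tens K K)" and LL: "alg (tens L L)" using K L by (simp_all add: alg_tens)
  note h = alghom_tensmap[OF L L F(2) F(2)]
  have 1: "inv_el (tens K K) chi = chi'" by (rule inv_el_eq[OF KK i])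
  have 2: "inv_el (tens L L) (tensmap f f chi) = tensmap f f chi'"
    by (rule inv_el_eq[OF LL]) (simp_all only: alghom_mul[OF h, symmetric] i alghom_one[OF h])
  show ?thesis
    using F by (simp add: bialg_iso_def alghom_def cop_twist 1 2 alghom_mul[OF h, symmetric])
qed

context quasitri_hopf
begin

abbreviation "TT \<equiv> tens T T"

text \<open>The coproduct of the first leg of \<open>T\<close> is spread over the legs 3, 1 in this order because that factor
of \<open>T\<close> is \<open>H\<^sup>c\<^sup>o\<^sup>p\<close>.\<close>

lemma five_legs:
  assumes "legs3 H M i1 i2 i3" "legs3 H M i5 i1 i3" "legs3 H M i5 i2 i3" "legs3 H M i2 i4 i5" "legs3 H M i1 i3 i4"
  shows "mul M (mul M (ri M i2 i3) (ri M i1 i3))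
      (mul M (ri M i5 (\<lambda>x. lift2 M i3 i1 (cop H x))) (r M (\<lambda>x. lift2 M i2 i4 (cop H x)) i5))
    = mul M (mul M (mul M (ri M i5 i1) (r M i2 i5)) (mul M (ri M i5 i3) (r M i4 i5)))
      (mul M (ri M i2 i3) (ri M i1 i3))"
proof -
  note L = legs3D[OF assms(1)] and L2 = legs3D[OF assms(2)] and L3 = legs3D[OF assms(3)]
    and L4 = legs3D[OF assms(4)] and L5 = legs3D[OF assms(5)]
  note M = L(1) note AM = alg_assoc[OF M]
  have l': "legs3 H M i5 i3 i1" using assms(2) by (simp add: legs3_def legs2_sym)
  \<comment> \<open>Among these six factors, Yang-Baxter relations are needed only for the triples
    b, c, d and a, c, e. The other exchanges concern factors with disjoint legs.\<close>
  define a b c d e f where "a = ri M i2 i3" and "b = ri M i1 i3" and "c = ri M i5 i3" and "d = ri M i5 i1"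
    and "e = r M i2 i5" and "f = r M i4 i5"
  note defs = a_def b_def c_def d_def e_def f_def
  have y1: "mul M b (mul M c d) = mul M d (mul M c b)" and y2: "mul M a (mul M c e) = mul M e (mul M c a)"
    using ybe_inv(1)[OF assms(2)] ybe_inv(2)[OF assms(3)] by (simp_all only: defs)
  have ad: "mul M a d = mul M d a" unfolding defs
    by (rule lift2_lift2_comm[OF M L3(5)[THEN comm_sym] L(5)[THEN comm_sym] L2(6)[THEN comm_sym] L(6)[THEN comm_sym]])
  have be: "mul M b e = mul M e b" unfolding defs
    by (rule lift2_lift2_comm[OF M L(5) L2(5)[THEN comm_sym] L(7)[THEN comm_sym] L2(6)[THEN comm_sym]])
  have bf: "mul M b f = mul M f b" unfolding defs
    by (rule lift2_lift2_comm[OF M L5(6) L2(5)[THEN comm_sym] L5(7) L2(6)[THEN comm_sym]])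
  have af: "mul M a f = mul M f a" unfolding defs
    by (rule lift2_lift2_comm[OF M L4(5) L4(6) L5(7) L2(6)[THEN comm_sym]])
  have "mul M (mul M a b) (mul M (mul M c d) (mul M e f)) = mul M a (mul M (mul M b (mul M c d)) (mul M e f))"
    by (simp only: AM)
  also have "\<dots> = mul M (mul M a d) (mul M c (mul M (mul M b e) f))" by (simp only: y1 AM)
  also have "\<dots> = mul M d (mul M (mul M a (mul M c e)) (mul M b f))" by (simp only: ad be AM)
  also have "\<dots> = mul M d (mul M e (mul M c (mul M (mul M a f) b)))" by (simp only: y2 bf AM)
  also have "\<dots> = mul M (mul M (mul M d e) (mul M c f)) (mul M a b)" by (simp only: af AM)
  finally show ?thesis
    unfolding qt_with_hex2i[OF H(1,3) q l'] qt_with_hex1[OF q H(1) assms(4), unfolded hex1_def]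
    by (simp only: defs)
qed

text \<open>The image of \<open>chiB\<close> under the inverse of \<open>theta1\<close> on both
  copies. Since that inverse maps 1 \<otimes> h to the coproduct of h and fixes f \<otimes> 1, the
  first leg of R^{-1} is spread over all of the first copy of \<open>T\<close>.\<close>

abbreviation "chiT \<equiv> lift2 TT (\<lambda>x. tv (cop H x) (one T)) (\<lambda>x. tv (one T) (tv x (one H))) Ri"
abbreviation "chiTi \<equiv> lift2 TT (\<lambda>x. tv (cop H x) (one T)) (\<lambda>x. tv (one T) (tv x (one H))) R"

lemma alg_TT [simp]: "alg TT" by (simp add: alg_tens)

lemma legs2_chiT: "legs2 H TT (\<lambda>x. tv (cop H x) (one T)) (\<lambda>x. tv (one T) (tv x (one H)))"
  unfolding legs2_def
  using alghom_compose[OF alghom_copT alghom_inL[OF alg_T, of T]] alghom_compose[OF alghom_t1 alghom_inR[OF alg_T, of T]]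
  by (simp add: comm_def mul_tens_tv)

lemma chiT_inv: "mul TT chiT chiTi = one TT" "mul TT chiTi chiT = one TT"
  by (rule qt_with_inv[OF q legs2_chiT])+

text \<open>Before contraction with a this is an identity in five legs: 1 and 2 from the first copy
  of \<open>T\<close>, 3 and 4 from the second, and the leg 5 that is contracted. The product of two
  copies of \<open>L\<close> sharing leg 5 becomes the coproduct of a.\<close>

lemma chiT_cop_Lslice: "mul TT chiT (cop T (Lslice a)) = mul TT (sw D a (\<lambda>b c. tv (Lslice b) (Lslice c))) chiT"
proof -
  let ?M = "tens TT H"
  let ?k1 = "\<lambda>x::'i \<Rightarrow> 'k. tv (tv (tv x (one H)) (one T)) (one H)"
  let ?k2 = "\<lambda>x::'i \<Rightarrow> 'k. tv (tv (tv (one H) x) (one T)) (one H)"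
  let ?k3 = "\<lambda>x::'i \<Rightarrow> 'k. tv (tv (one T) (tv x (one H))) (one H)"
  let ?k4 = "\<lambda>x::'i \<Rightarrow> 'k. tv (tv (one T) (tv (one H) x)) (one H)"
  let ?k5 = "\<lambda>x::'i \<Rightarrow> 'k. tv (one TT) x"
  have M: "alg ?M" by (simp add: alg_tens)
  note iL = alghom_inL[OF alg_T, of T] and iR = alghom_inR[OF alg_T, of T] and iM = alghom_inL[OF H(1), of TT]
  have h: "alghom H ?M ?k1" "alghom H ?M ?k2" "alghom H ?M ?k3" "alghom H ?M ?k4" "alghom H ?M ?k5"
    by (rule alghom_compose[OF alghom_compose[OF alghom_t1 iL] iM] alghom_compose[OF alghom_compose[OF alghom_t2 iL] iM]
        alghom_compose[OF alghom_compose[OF alghom_t1 iR] iM] alghom_compose[OF alghom_compose[OF alghom_t2 iR] iM]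
        alghom_inR[OF alg_TT])+
  have c: "comm ?M ?k1 ?k2" "comm ?M ?k1 ?k3" "comm ?M ?k1 ?k4" "comm ?M ?k1 ?k5" "comm ?M ?k2 ?k3" "comm ?M ?k2 ?k4"
     "comm ?M ?k2 ?k5" "comm ?M ?k3 ?k4" "comm ?M ?k3 ?k5" "comm ?M ?k4 ?k5"
    by (simp_all add: comm_def mul_tens_tv one_tens)
  have l: "legs3 H ?M ?k1 ?k2 ?k3" "legs3 H ?M ?k5 ?k1 ?k3" "legs3 H ?M ?k5 ?k2 ?k3" "legs3 H ?M ?k2 ?k4 ?k5" "legs3 H ?M ?k1 ?k3 ?k4"
    unfolding legs3_def legs2_def using M h c by (simp_all add: comm_sym)
  have cT: "alghom T TT (cop T)" by (rule alghom_cop[OF compat_T])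
  let ?c = "\<lambda>t. tv (cop T t) (one H)" and ?a = "\<lambda>t. tv (tv t (one T)) (one H)" and ?b = "\<lambda>t. tv (tv (one T) t) (one H)"
  have hh: "alghom T ?M ?c" "alghom T ?M ?a" "alghom T ?M ?b"
    by (rule alghom_compose[OF cT iM] alghom_compose[OF iL iM] alghom_compose[OF iR iM])+
  have cc: "comm ?M ?c ?k5" "comm ?M ?a ?k5" "comm ?M ?b ?k5"
    by (simp_all add: comm_def mul_tens_tv)
  have f: "alghom M3 ?M (lift2 ?M ?c ?k5)" "alghom M3 ?M (lift2 ?M ?a ?k5)" "alghom M3 ?M (lift2 ?M ?b ?k5)"
    by (rule alghom_lift2[OF M hh(1) h(5) cc(1)] alghom_lift2[OF M hh(2) h(5) cc(2)] alghom_lift2[OF M hh(3) h(5) cc(3)])+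
  have g: "lift2 ?M ?c ?k5 (tv t y) = tv (cop T t) y" "lift2 ?M ?a ?k5 (tv t y) = tv (tv t (one T)) y"
    "lift2 ?M ?b ?k5 (tv t y) = tv (tv (one T) t) y" for t y
    by (simp_all add: lift2_tv alghom_lin[OF hh(1)] alghom_lin[OF hh(2)] alghom_lin[OF hh(3)] alghom_lin[OF h(5)] mul_tens_tv)
  have k5: "tv (one TT) y = ?k5 y" for y ..
  have c1: "tv (cop T (tv x (one H))) (one H) = lift2 ?M ?k3 ?k1 (cop H x)" for x
  proof -
    have "cop T (tv x (one H)) = sw H x (\<lambda>a b. tv (tv b (one H)) (tv a (one H)))"
      unfolding cop_tens_tv cop_cop_of ev_flip by (rule ev_cong, subst sw_one[OF H(3)]) ((intro lins)+, rule refl)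
    then show ?thesis by (simp add: lift2_def mul_tens_tv tv_ev_l)
  qed
  have c2: "tv (cop T (tv (one H) x)) (one H) = lift2 ?M ?k2 ?k4 (cop H x)" for x
  proof -
    have "cop T (tv (one H) x) = sw H x (\<lambda>a b. tv (tv (one H) a) (tv (one H) b))"
      unfolding cop_tens_tv cop_cop_of ev_flip by (subst sw_one[OF H(3)]) ((intro lins)+, rule refl)
    then show ?thesis by (simp add: lift2_def mul_tens_tv tv_ev_l)
  qed
  have e0: "lift2 ?M ?c ?k5 L = mul ?M (ri ?M ?k5 (\<lambda>x. lift2 ?M ?k3 ?k1 (cop H x))) (r ?M (\<lambda>x. lift2 ?M ?k2 ?k4 (cop H x)) ?k5)"
    unfolding L_image[OF f(1)] g c1 c2 one_T[symmetric] alghom_one[OF cT] ..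
  have e1: "lift2 ?M ?a ?k5 L = mul ?M (ri ?M ?k5 ?k1) (r ?M ?k2 ?k5)"
    unfolding L_image[OF f(2)] g unfolding one_T[symmetric] one_tens[of T T] ..
  have e2: "lift2 ?M ?b ?k5 L = mul ?M (ri ?M ?k5 ?k3) (r ?M ?k4 ?k5)"
    unfolding L_image[OF f(3)] g unfolding one_T[symmetric] one_tens[of T T] ..
  have ex: "tv chiT (one H) = mul ?M (ri ?M ?k2 ?k3) (ri ?M ?k1 ?k3)"
  proof -
    have 0: "tv (tv (cop H x) (one T)) (one H) = lift2 ?M ?k1 ?k2 (cop H x)" for x
    proof -
      have "lift2 ?M ?k1 ?k2 (cop H x) = tv (tv (sw H x tv) (one T)) (one H)"
        unfolding lift2_def tv_ev_l by (simp add: mul_tens_tv)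
      then show ?thesis by simp
    qed
    show ?thesis
      unfolding alghom_lift2_image[OF iM] 0 by (rule qt_with_hex1i[OF H(1,3) q l(1)])
  qed
  have e: "mul ?M (tv chiT (one H)) (lift2 ?M ?c ?k5 L) = mul ?M (mul ?M (lift2 ?M ?a ?k5 L) (lift2 ?M ?b ?k5 L)) (tv chiT (one H))"
    unfolding ex e0 e1 e2 by (rule five_legs[OF l])
  have "contract a (lift2 ?M ?c ?k5 L) = ev L (\<lambda>t y. pair a y \<odot> cop T t)"
    unfolding lift2_def[of ?M ?c] ev_lin[OF lin_contract(1)] by (simp add: mul_tens_tv contract_tv)
  also have "\<dots> = cop T (Lslice a)"
    unfolding contract_def ev_lin[OF lin_cop'] lin_scal[OF lin_cop'] ..
  finally have 1: "contract a (lift2 ?M ?c ?k5 L) = cop T (Lslice a)" .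
  have "contract a (mul ?M (lift2 ?M ?a ?k5 L) (lift2 ?M ?b ?k5 L)) = ev L (\<lambda>t y. ev L (\<lambda>t' y'. pair a (mul H y y') \<odot> tv t t'))"
    unfolding lift2_def mul_ev_l by (simp only: mul_ev_r ev_lin[OF lin_contract(1)]) (simp add: mul_tens_tv contract_tv)
  also have "\<dots> = sw D a (\<lambda>b c. ev L (\<lambda>t y. ev L (\<lambda>t' y'. pair b y \<odot> pair c y' \<odot> tv t t')))"
    unfolding pair_mul by (rule ev_swap2)
  also have "\<dots> = sw D a (\<lambda>b c. tv (Lslice b) (Lslice c))"
    unfolding contract_def tv_ev_l by (simp add: tv_ev_r mult.commute)
  finally have 2: "contract a (mul ?M (lift2 ?M ?a ?k5 L) (lift2 ?M ?b ?k5 L)) = sw D a (\<lambda>b c. tv (Lslice b) (Lslice c))" .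
  show ?thesis
    using arg_cong[OF e, of "contract a"] by (simp only: contract_mul_l contract_mul_r 1 2)
qed

text \<open>In \<open>T\<close> the coproduct of \<Delta>(h) is (h_2 \<otimes> h_3) \<otimes> (h_1
  \<otimes> h_4), because the first factor is co-opposite. The element R^{-1} in \<open>chiT\<close>
  exchanges h_1 with the block h_2 \<otimes> h_3 and so restores the natural order.\<close>

lemma chiT_cop_cop: "mul TT chiT (cop T (cop H h)) = mul TT (sw H h (\<lambda>p q. tv (cop H p) (cop H q))) chiT"
proof -
  note AT = alg_assoc[OF alg_TT]
  let ?i = "\<lambda>x. tv (cop H x) (one T)" and ?j = "\<lambda>x. tv (one T) (tv x (one H))" and ?k = "\<lambda>x. tv (one T) (tv (one H) x)"
  have d: "mul TT (mul TT (tv (cop H f) (one T)) (tv (one T) (tv a (one H)))) (?k g) = sw H f (\<lambda>b c. tv (tv b c) (tv a g))" for f a g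
    using tv_ev_l[of "cop H f" tv "tv a g"] by (simp add: mul_tens_tv)
  have "cop T (cop H h) = sw H h (\<lambda>u v. cop T (tv u v))"
    using ev_lin[OF lin_cop', of T "cop H h" tv] by simp
  also have "\<dots> = sw H h (\<lambda>u v. sw H u (\<lambda>u1 u2. sw H v (\<lambda>v1 v2. tv (tv u2 v1) (tv u1 v2))))"
    unfolding cop_tens_tv cop_cop_of ev_flip ..
  also have "\<dots> = sw H h (\<lambda>u1 w. sw H w (\<lambda>u2 v. sw H v (\<lambda>v1 v2. tv (tv u2 v1) (tv u1 v2))))"
    by (rule coassoc)
  also have "\<dots> = sw H h (\<lambda>u1 w. sw H w (\<lambda>f v2. sw H f (\<lambda>u2 v1. tv (tv u2 v1) (tv u1 v2))))"
    by (rule ev_cong) (rule coassoc[symmetric])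
  also have "\<dots> = sw H h (\<lambda>e v2. sw H e (\<lambda>u1 f. sw H f (\<lambda>u2 v1. tv (tv u2 v1) (tv u1 v2))))"
    by (rule coassoc[symmetric])
  also have "\<dots> = sw H h (\<lambda>e g. mul TT (lift2 TT ?j ?i (cop H e)) (?k g))"
    unfolding lift2_def mul_ev_l commD[OF comm_sym[OF legs2D(4)[OF legs2_chiT]]] d ..
  finally have "mul TT chiT (cop T (cop H h)) = sw H h (\<lambda>e g. mul TT (mul TT chiT (lift2 TT ?j ?i (cop H e))) (?k g))"
    by (simp only: mul_ev_r AT)
  also have "\<dots> = sw H h (\<lambda>e g. mul TT (lift2 TT ?i ?j (cop H e)) (mul TT chiT (?k g)))"
    by (simp only: qt_with_tw_inv[OF q legs2_chiT, symmetric] AT)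
  also have "\<dots> = sw H h (\<lambda>e g. mul TT (mul TT (lift2 TT ?i ?j (cop H e)) (?k g)) chiT)"
  proof -
    have "comm TT (lift2 TT ?i ?j) ?k"
      by (rule comm_lift2_l[OF alg_TT]) (simp_all add: comm_def mul_tens_tv)
    then have "mul TT chiT (?k g) = mul TT (?k g) chiT" for g by (rule commD)
    then show ?thesis by (simp only: AT)
  qed
  also have "\<dots> = mul TT (sw H h (\<lambda>e g. sw H e (\<lambda>f p. tv (cop H f) (tv p g)))) chiT"
    unfolding lift2_def mul_ev_l[of TT "cop H _"] by (simp add: mul_tens_tv)
  also have "sw H h (\<lambda>e g. sw H e (\<lambda>f p. tv (cop H f) (tv p g))) = sw H h (\<lambda>p q. tv (cop H p) (cop H q))"
    unfolding coassoc using tv_ev_r[of "cop H _" "cop H _" tv] by simp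
  finally show ?thesis .
qed

lemma theta2_cop: "mul TT chiT (cop T (theta2 X)) = mul TT (tensmap theta2 theta2 (cop (dbl H) X)) chiT"
proof (rule lin_eq_tvI[of "\<lambda>X. mul TT chiT (cop T (theta2 X))"], (intro lins)+)
  fix h a
  note AT = alg_assoc[OF alg_TT]
  have t: "tensmap theta2 theta2 (tv x y) = tv (theta2 x) (theta2 y)" for x y by (rule tensmap_tv) (rule lin_theta2(1))+
  have "mul TT chiT (cop T (theta2 (tv h a))) = mul TT (mul TT chiT (cop T (cop H h))) (cop T (Lslice a))"
    by (simp only: theta2_tv alghom_mul[OF alghom_cop[OF compat_T]] AT)
  also have "\<dots> = mul TT (mul TT (sw H h (\<lambda>p q. tv (cop H p) (cop H q))) (sw D a (\<lambda>b c. tv (Lslice b) (Lslice c)))) chiT"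
    by (simp only: chiT_cop_cop AT chiT_cop_Lslice)
  also have "mul TT (sw H h (\<lambda>p q. tv (cop H p) (cop H q))) (sw D a (\<lambda>b c. tv (Lslice b) (Lslice c))) = tensmap theta2 theta2 (cop (dbl H) (tv h a))"
    unfolding mul_ev_l by (simp only: mul_ev_r mul_tens_tv cop_dbl_tv ev_lin[OF lin_tensmap[OF lin_id]] t theta2_tv)
  finally show "mul TT chiT (cop T (theta2 (tv h a))) = mul TT (tensmap theta2 theta2 (cop (dbl H) (tv h a))) chiT" .
qed

lemma inv_chiT: "inv_el TT chiT = chiTi"
  by (rule inv_el_eq[OF alg_TT chiT_inv])

lemma cou_Lslice: "cou T (Lslice a) = pair a (one H)"
proof -
  let ?v = "\<lambda>_::unit. 1::'k"
  have eq: "L = ev Ri (\<lambda>a b. ev R (\<lambda>c d. tv (tv b c) (mul H a d)))"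
    unfolding L_def lift2_def mul_ev_l by (simp add: mul_ev_r)
  have "cou T (Lslice a) \<odot> ?v = ev Ri (\<lambda>m n. ev R (\<lambda>c d. pair a (mul H (cou H n \<odot> m) (cou H c \<odot> d)) \<odot> ?v))"
    unfolding eq ev_lin[OF lin_contract(1)] contract_tv ev_lin[OF lin_cou[OF lin_id]] by (simp add: cou_tens_tv mult_ac)
  also have "\<dots> = pair a (mul H (ev Ri (\<lambda>m n. cou H n \<odot> m)) (ev R (\<lambda>c d. cou H c \<odot> d))) \<odot> ?v"
    unfolding mul_ev_l pair_ev by (simp only: mul_ev_r pair_ev)
  also have "\<dots> = pair a (one H) \<odot> ?v" by (simp only: cou_R cou_Ri alg_one_l[OF H(1)])
  finally show ?thesis by (auto dest: fun_cong[of _ _ "()"])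
qed

lemma cou_cop_H: "cou T (cop H h) = cou H h"
proof -
  let ?v = "\<lambda>_::unit. 1::'k"
  have "cou T (cop H h) \<odot> ?v = cou T (sw H h tv) \<odot> ?v" by simp
  also have "\<dots> = sw H h (\<lambda>a b. cou H a \<odot> cou H b \<odot> ?v)"
    unfolding ev_lin[OF lin_cou[OF lin_id]] by (simp add: cou_tens_tv)
  also have "\<dots> = cou H h \<odot> ?v" by (rule coalg_counit_l[OF H(2)]) (intro lins)
  finally show ?thesis by (auto dest: fun_cong[of _ _ "()"])
qed

lemma theta2_cou: "cou T (theta2 X) = cou (dbl H) X"
proof -
  let ?v = "\<lambda>_::unit. 1::'k"
  have "cou T (theta2 X) \<odot> ?v = cou (dbl H) X \<odot> ?v"
  proof (rule lin_eq_tvI[of "\<lambda>X. cou T (theta2 X) \<odot> ?v"], (intro lins)+)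
    show "cou T (theta2 (tv h a)) \<odot> ?v = cou (dbl H) (tv h a) \<odot> ?v" for h a
      using compat_T by (simp add: compat_def theta2_tv cou_dbl cou_tens_tv cou_Lslice cou_cop_H)
  qed
  then show ?thesis by (auto dest: fun_cong[of _ _ "()"])
qed

lemma bialg_iso_theta2: assumes "factorisable H R" shows "bialg_iso (dbl H) (twist_bialg T chiT) theta2"
proof -
  have "cop (twist_bialg T chiT) (theta2 X) = tensmap theta2 theta2 (cop (dbl H) X)" for X
    unfolding cop_twist inv_chiT theta2_cop
    by (simp only: alg_assoc[OF alg_TT] chiT_inv alg_one_r[OF alg_TT])
  then show ?thesis
    using theta2_bij[OF assms] by (simp add: bialg_iso_def alghom_def lin_theta2(1) theta2_mul theta2_one theta2_cou)
qed

text \<open>Associativity and compatibility are pulled back from the twist of \<open>T\<close> along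
  the inverse of \<open>theta2\<close>. The coalgebra axioms and the antipode are obtained on the
  side of the double.\<close>

lemma hopf_dbl: assumes f: "factorisable H R" shows "is_hopf (dbl H)"
proof -
  note b = bialg_iso_inv[OF bialg_iso_theta2[OF f]]
  have a: "alg (dbl H)" by (rule bialg_iso_alg[OF b]) simp
  have c: "compat (dbl H)" by (rule bialg_iso_compat[OF b _ compat_twist[OF alg_T compat_T chiT_inv]]) simp
  \<comment> \<open>\<open>theta2\<close> of the antipode to be found. As \<open>theta2\<close>
    sends h \<otimes> a to \<Delta>(h) times a slice of \<open>L\<close>, its convolution inverse is
    the slice of \<open>Li\<close> times \<Delta>(S h), in reversed order.\<close>
  define W where "W X = ev X (\<lambda>h a. mul T (contract a Li) (cop H (S h)))" for X
  have lW: "lin W" "lin f \<Longrightarrow> lin (\<lambda>x. W (f x))" for f :: "('i \<times> 'i \<Rightarrow> 'k) \<Rightarrow> _" unfolding W_def by (intro lins; assumption?)+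
  have W: "W (tv h a) = mul T (contract a Li) (cop H (S h))" for h a
    unfolding W_def by (rule ev_tv) (intro lins)+
  have i: "theta2 (inv theta2 x) = x" "inv theta2 (theta2 x) = x" for x
    using theta2_bij[OF f] by (simp_all add: bij_is_surj surj_f_inv_f bij_is_inj)
  have inj: "theta2 x = theta2 y \<Longrightarrow> x = y" for x y by (metis i(2))
  note AT = alg_assoc[OF alg_T]
  have cop1: "cop H (one H) = one T" by (rule alghom_one[OF alghom_copT])
  have sd: "sw (dbl H) (tv h a) F = sw H h (\<lambda>p q. sw D a (\<lambda>b c. F (tv p b) (tv q c)))"
    if "\<And>x. lin (F x)" "\<And>y. lin (\<lambda>x. F x y)" for h a and F :: "_ \<Rightarrow> _ \<Rightarrow> 'i \<times> 'i \<Rightarrow> 'k"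
    by (simp only: cop_dbl_tv ev_ev ev_tv[OF that])
  have 1: "sw (dbl H) X (\<lambda>u v. mul T (W u) (theta2 v)) = cou (dbl H) X \<odot> one T" for X
  proof (rule lin_eq_tvI[of "\<lambda>X. sw (dbl H) X (\<lambda>u v. mul T (W u) (theta2 v))"], (intro lins)+)
    fix h a
    have "sw (dbl H) (tv h a) (\<lambda>u v. mul T (W u) (theta2 v))
       = sw H h (\<lambda>p q. sw D a (\<lambda>b c. mul T (contract b Li) (mul T (cop H (mul H (S p) q)) (Lslice c))))"
      by (subst sd) ((intro lins lW)+, simp only: W theta2_tv cop_mul AT)
    also have "\<dots> = sw D a (\<lambda>b c. sw H h (\<lambda>p q. mul T (contract b Li) (mul T (cop H (mul H (S p) q)) (Lslice c))))"
      by (rule ev_swap)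
    also have "\<dots> = sw D a (\<lambda>b c. cou H h \<odot> mul T (contract b Li) (Lslice c))"
      by (subst antipode_l_lin[OF S, where G = "\<lambda>y. mul T (contract _ Li) (mul T (cop H y) (Lslice _))"]) ((intro lins)+, simp add: cop1)
    also have "\<dots> = cou (dbl H) (tv h a) \<odot> one T"
      unfolding ev_scal[symmetric] theta2_antipode by (simp add: cou_dbl cou_tens_tv)
    finally show "sw (dbl H) (tv h a) (\<lambda>u v. mul T (W u) (theta2 v)) = cou (dbl H) (tv h a) \<odot> one T" .
  qed
  have 2: "sw (dbl H) X (\<lambda>u v. mul T (theta2 u) (W v)) = cou (dbl H) X \<odot> one T" for X
  proof (rule lin_eq_tvI[of "\<lambda>X. sw (dbl H) X (\<lambda>u v. mul T (theta2 u) (W v))"], (intro lins)+)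
    fix h a
    have "sw (dbl H) (tv h a) (\<lambda>u v. mul T (theta2 u) (W v))
       = sw H h (\<lambda>p q. sw D a (\<lambda>b c. mul T (cop H p) (mul T (mul T (Lslice b) (contract c Li)) (cop H (S q)))))"
      by (subst sd) ((intro lins lW)+, simp only: W theta2_tv cop_mul AT)
    also have "\<dots> = sw H h (\<lambda>p q. mul T (cop H p) (mul T (sw D a (\<lambda>b c. mul T (Lslice b) (contract c Li))) (cop H (S q))))"
      by (simp only: mul_ev_l mul_ev_r)
    also have "\<dots> = sw H h (\<lambda>p q. pair a (one H) \<odot> cop H (mul H p (S q)))"
      unfolding theta2_antipode by (simp add: cop_mul)
    also have "\<dots> = cou H h \<odot> pair a (one H) \<odot> cop H (one H)"
      by (rule antipode_r_lin[OF S, where G = "\<lambda>y. pair a (one H) \<odot> cop H y"]) (intro lins)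
    also have "\<dots> = cou (dbl H) (tv h a) \<odot> one T" by (simp add: cou_dbl cou_tens_tv cop1)
    finally show "sw (dbl H) (tv h a) (\<lambda>u v. mul T (theta2 u) (W v)) = cou (dbl H) (tv h a) \<odot> one T" .
  qed
  have "antipode (dbl H) (\<lambda>X. inv theta2 (W X))"
    unfolding antipode_def
  proof (intro conjI allI)
    show "lin (\<lambda>X. inv theta2 (W X))" by (rule lin_compose[OF lin_inv[OF lin_theta2(1) theta2_bij[OF f]] lW(1)])
    show "sw (dbl H) x (\<lambda>a b. mul (dbl H) (inv theta2 (W a)) b) = cou (dbl H) x \<odot> one (dbl H)" for x
      by (rule inj) (simp only: ev_lin[OF lin_theta2(1)] lin_scal[OF lin_theta2(1)] theta2_mul theta2_one i 1)
    show "sw (dbl H) x (\<lambda>a b. mul (dbl H) a (inv theta2 (W b))) = cou (dbl H) x \<odot> one (dbl H)" for x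
      by (rule inj) (simp only: ev_lin[OF lin_theta2(1)] lin_scal[OF lin_theta2(1)] theta2_mul theta2_one i 2)
  qed
  then show ?thesis unfolding is_hopf_iff is_bialg_iff using a c coalg_dbl by blast
qed

end

section \<open>The module algebras\<close>

lemma ev_swap3:
  "ev s (\<lambda>a b. ev (t a b) (\<lambda>c d. ev (t' a b c d) (\<lambda>e f. ev u (\<lambda>p q. F a b c d e f p q)))) =
   ev u (\<lambda>p q. ev s (\<lambda>a b. ev (t a b) (\<lambda>c d. ev (t' a b c d) (\<lambda>e f. F a b c d e f p q))))"
proof -
  have "ev s (\<lambda>a b. ev (t a b) (\<lambda>c d. ev (t' a b c d) (\<lambda>e f. ev u (\<lambda>p q. F a b c d e f p q)))) =
    ev s (\<lambda>a b. ev u (\<lambda>p q. ev (t a b) (\<lambda>c d. ev (t' a b c d) (\<lambda>e f. F a b c d e f p q))))"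
    by (rule ev_cong) (rule ev_swap2)
  then show ?thesis by (simp only: ev_swap[of s])
qed

lemma ev_swap5:
  "ev s (\<lambda>a b. ev (t a b) (\<lambda>c d. ev (t' a b c d) (\<lambda>e f. ev (w a b c d e f) (\<lambda>g h. ev (w' a b c d e f g h) (\<lambda>i j.
      ev u (\<lambda>p q. F a b c d e f g h i j p q)))))) =
   ev u (\<lambda>p q. ev s (\<lambda>a b. ev (t a b) (\<lambda>c d. ev (t' a b c d) (\<lambda>e f. ev (w a b c d e f) (\<lambda>g h. ev (w' a b c d e f g h) (\<lambda>i j.
      F a b c d e f g h i j p q))))))"
  (is "?l = ?r")
proof -
  have "?l = ev s (\<lambda>a b. ev (t a b) (\<lambda>c d. ev u (\<lambda>p q. ev (t' a b c d) (\<lambda>e f. ev (w a b c d e f) (\<lambda>g h. ev (w' a b c d e f g h) (\<lambda>i j.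
      F a b c d e f g h i j p q))))))"
    by (rule ev_cong, rule ev_cong, rule ev_swap3)
  also have "\<dots> = ?r" by (rule ev_swap2)
  finally show ?thesis .
qed

context quasitri_hopf
begin

abbreviation "Qi \<equiv> mul (tens H H) Ri (flip Ri)"

lemma inv_Q: "inv_el (tens H H) Q = Qi"
proof (rule inv_el_eq)
  have HH: "alg (tens H H)" by (simp add: alg_tens)
  note AH = alg_assoc[OF HH] and fh = alghom_flip[OF H(1,1)]
  show "alg (tens H H)" by (rule HH)
  have i: "mul (tens H H) R Ri = one (tens H H)" "mul (tens H H) Ri R = one (tens H H)"
    using q by (simp_all add: qt_with_def)
  have f: "mul (tens H H) (flip R) (flip Ri) = one (tens H H)" "mul (tens H H) (flip Ri) (flip R) = one (tens H H)"
    by (simp_all only: alghom_mul[OF fh, symmetric] i alghom_one[OF fh])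
  have "mul (tens H H) Q Qi = mul (tens H H) (flip R) (mul (tens H H) (mul (tens H H) R Ri) (flip Ri))"
    by (simp only: Qel_def AH)
  then show "mul (tens H H) Q Qi = one (tens H H)" by (simp only: i f alg_one_l[OF HH])
  have "mul (tens H H) Qi Q = mul (tens H H) Ri (mul (tens H H) (mul (tens H H) (flip Ri) (flip R)) R)"
    by (simp only: Qel_def AH)
  then show "mul (tens H H) Qi Q = one (tens H H)" by (simp only: i f alg_one_l[OF HH])
qed

definition thetaA :: "('i \<Rightarrow> 'k) \<Rightarrow> 'i \<times> 'i \<Rightarrow> 'k" where
  "thetaA a = ev Qi (\<lambda>q1 q2. ev R (\<lambda>r1 r2. pair a (mul H q1 r2) \<odot> tv q2 r1))"

text \<open>The conjugation h_1 q S(h_2) in \<open>theta\<close> is the one in the bicrossproduct.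
  Hence \<open>theta\<close> is left multiplication by 1 \<otimes> h applied to the value at 1
  \<otimes> a, which is \<open>thetaA\<close>.\<close>

lemma theta_ev: "theta H R X = ev X (\<lambda>h a. mul B (tv (one H) h) (thetaA a))"
proof (rule ext)
  fix c
  let ?F = "\<lambda>a x y z q1 q2 r1 r2. pair a (mul H q1 r2) \<odot> tv (mul H (mul H x q2) (S y)) (mul H z r1)"
  have "theta H R X c = (\<Sum>(h, a)\<in>UNIV. X (h, a) * (\<Sum>(x, y, z)\<in>UNIV. cop3 H (bv h) (x, y, z) *
      (\<Sum>(q1, q2)\<in>UNIV. Qi (q1, q2) * (\<Sum>(r1, r2)\<in>UNIV. R (r1, r2) * ?F (bv a) (bv x) (bv y) (bv z) (bv q1) (bv q2) (bv r1) (bv r2) c))))"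
    unfolding theta_def antip_H inv_Q by (simp only: case_prod_unfold sum_distrib_left scal_apply mult.assoc)
  also have "\<dots> = (\<Sum>(h, a)\<in>UNIV. X (h, a) * (\<Sum>(x, y, z)\<in>UNIV. cop3 H (bv h) (x, y, z) *
      ev Qi (\<lambda>q1 q2. ev R (\<lambda>r1 r2. ?F (bv a) (bv x) (bv y) (bv z) q1 q2 r1 r2)) c))"
    unfolding cop2_sum[where t = R and F = "\<lambda>r1 r2. ?F _ _ _ _ _ _ r1 r2"]
      cop2_sum[where t = Qi and F = "\<lambda>q1 q2. ev R (\<lambda>r1 r2. ?F _ _ _ _ q1 q2 r1 r2)"] ..
  also have "\<dots> = (\<Sum>(h, a)\<in>UNIV. X (h, a) * sw H (bv h) (\<lambda>e z. sw H e (\<lambda>x y.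
      ev Qi (\<lambda>q1 q2. ev R (\<lambda>r1 r2. ?F (bv a) x y z q1 q2 r1 r2)))) c)"
    unfolding cop3_sum[where F = "\<lambda>x y z. ev Qi (\<lambda>q1 q2. ev R (\<lambda>r1 r2. ?F _ x y z q1 q2 r1 r2))"] ..
  also have "\<dots> = ev X (\<lambda>h a. sw H h (\<lambda>e z. sw H e (\<lambda>x y.
      ev Qi (\<lambda>q1 q2. ev R (\<lambda>r1 r2. ?F a x y z q1 q2 r1 r2))))) c"
    by (rule cop2_sum)
  also have "\<dots> = ev X (\<lambda>h a. mul B (tv (one H) h) (thetaA a)) c"
  proof -
    have "sw H h (\<lambda>e z. sw H e (\<lambda>x y. ev Qi (\<lambda>q1 q2. ev R (\<lambda>r1 r2. ?F a x y z q1 q2 r1 r2)))) = mul B (tv (one H) h) (thetaA a)" for h a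
    proof -
      have "mul B (tv (one H) h) (thetaA a) = ev Qi (\<lambda>q1 q2. ev R (\<lambda>r1 r2. sw H h (\<lambda>e z. sw H e (\<lambda>x y. ?F a x y z q1 q2 r1 r2))))"
        unfolding thetaA_def mul_ev_r by (simp add: mul_B_tv ev_scal)
      also have "\<dots> = sw H h (\<lambda>e z. sw H e (\<lambda>x y. ev Qi (\<lambda>q1 q2. ev R (\<lambda>r1 r2. ?F a x y z q1 q2 r1 r2))))"
        by (subst ev_swap2, rule ev_cong, rule ev_swap2)
      finally show ?thesis ..
    qed
    then show ?thesis by (simp only:)
  qed
  finally show "theta H R X c = ev X (\<lambda>h a. mul B (tv (one H) h) (thetaA a)) c" .
qed

text \<open>The coproduct on the first leg of R is split by the hexagon identity, giving R_31^{-1}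
  R_13^{-1} R_13 R_23. The inner factors cancel and \<open>L\<close> remains.\<close>

lemma theta1_inv_thetaA: "theta1_inv (thetaA a) = Lslice a"
proof -
  note l = legs3D[OF legs3_M3]
  have t: "theta1_inv (tv p h) = sw H h (\<lambda>a b. tv (mul H p a) b)" for p h by (rule theta1_inv_tv)
  have "theta1_inv (thetaA a) = ev Qi (\<lambda>q1 q2. ev R (\<lambda>d c. sw H d (\<lambda>x y. pair a (mul H q1 c) \<odot> tv (mul H q2 x) y)))"
    unfolding thetaA_def ev_lin[OF lin_theta1_inv(1)] lin_scal[OF lin_theta1_inv(1)] t ev_scal ..
  also have "\<dots> = ev Qi (\<lambda>q1 q2. ev R (\<lambda>x c. ev R (\<lambda>y c'. pair a (mul H q1 (mul H c c')) \<odot> tv (mul H q2 x) y)))"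
    by (rule ev_cong, rule hex_ev(1)) (intro lins)+
  also have "\<dots> = contract a (mul M3 (mul M3 (lift2 M3 l3 l1 Qi) (r M3 l1 l3)) (r M3 l2 l3))"
    unfolding lift2_def mul_ev_l by (simp only: mul_ev_r ev_lin[OF lin_contract(1)] mul_ev_l) (simp add: contract_tv assoc, rule ev_cong, rule ev_swap)
  also have "mul M3 (mul M3 (lift2 M3 l3 l1 Qi) (r M3 l1 l3)) (r M3 l2 l3) = L"
  proof -
    have "lift2 M3 l3 l1 Qi = mul M3 (ri M3 l3 l1) (ri M3 l1 l3)"
      by (simp only: alghom_mul[OF legs2_alghom_lift2[OF legs2_sym[OF l(12)]]] lift2_flip[OF comm_sym[OF l(6)]])
    then show ?thesis
      by (simp add: L_def alg_assoc[OF alg_M3] qt_with_inv[OF q l(12)])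
  qed
  finally show ?thesis .
qed

lemma theta1_inv_theta: "theta1_inv (theta H R X) = theta2 X"
proof -
  have 1: "theta1_inv (tv (one H) h) = cop H h" for h by (simp add: theta1_inv_tv)
  show ?thesis
    unfolding theta_ev theta2_def ev_lin[OF lin_theta1_inv(1)] theta1_inv_mul theta1_inv_thetaA 1 ..
qed

lemma theta_eq: "theta H R = (\<lambda>X. theta1 H (theta2 X))"
  using theta1_inv_theta theta1_theta1_inv by metis

lemma chiB_ev: "chiB H R = ev Ri (\<lambda>x y. tv (tv (one H) x) (tv y (one H)))"
proof -
  have "ev Ri (\<lambda>x y. tv (tv (one H) x) (tv y (one H))) ((f, h), (f', h')) = one H f * ev Ri tv (h, f') * one H h'" for f h f' h'
    by (simp only: ev_apply sum_distrib_left sum_distrib_right tv_apply) (simp add: mult_ac)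
  then show ?thesis by (auto simp: fun_eq_iff chiB_def inv_R one_def)
qed

lemma theta1_inv_1: "theta1_inv (tv (one H) h) = cop H h" and theta1_inv_2: "theta1_inv (tv f (one H)) = tv f (one H)"
proof -
  show "theta1_inv (tv (one H) h) = cop H h" by (simp add: theta1_inv_tv)
  show "theta1_inv (tv f (one H)) = tv f (one H)"
    unfolding theta1_inv_tv by (subst sw_one[OF H(3)]) ((intro lins)+, simp)
qed

lemma chiT_eq: "tensmap theta1_inv theta1_inv (ev X (\<lambda>x y. tv (tv (one H) x) (tv y (one H)))) =
  lift2 TT (\<lambda>x. tv (cop H x) (one T)) (\<lambda>x. tv (one T) (tv x (one H))) X"
proof -
  have t: "tensmap theta1_inv theta1_inv (tv x y) = tv (theta1_inv x) (theta1_inv y)" for x y by (rule tensmap_tv) (rule lin_theta1_inv)+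
  show ?thesis
    unfolding ev_lin[OF lin_tensmap[OF lin_id]] t theta1_inv_1 theta1_inv_2 lift2_def by (simp add: mul_tens_tv)
qed

lemma chiB_eq: "tensmap (theta1 H) (theta1 H) chiT = chiB H R"
  and chiBi_eq: "tensmap (theta1 H) (theta1 H) chiTi = ev R (\<lambda>x y. tv (tv (one H) x) (tv y (one H)))"
  unfolding chiB_ev chiT_eq[symmetric] tensmap_tensmap[OF lin_theta1(1) lin_theta1(1)] theta1_theta1_inv tensmap_id by (rule refl)+

lemma inv_chiB: "inv_el (tens B B) (chiB H R) = ev R (\<lambda>x y. tv (tv (one H) x) (tv y (one H)))"
proof -
  note b = bialg_iso_theta1
  have B: "alg B" by (rule bialg_iso_alg[OF b alg_T])
  note h = alghom_tensmap[OF B B bisoD(2)[OF b] bisoD(2)[OF b]]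
  show ?thesis
    unfolding chiB_eq[symmetric] chiBi_eq[symmetric]
    by (rule inv_el_eq[OF alg_tens[OF B B]])
      (simp_all only: alghom_mul[OF h, symmetric] chiT_inv alghom_one[OF h])
qed

lemma bialg_iso_theta: "factorisable H R \<Longrightarrow> bialg_iso (dbl H) (twist_bialg B (chiB H R)) (theta H R)"
  unfolding theta_eq chiB_eq[symmetric]
  by (rule bialg_iso_compose[OF bialg_iso_theta2 bialg_iso_twist[OF bialg_iso_theta1 alg_T chiT_inv]])

lemma antip_D: "antip D = app (\<lambda>a b. S (bv b) a)"
  by (rule antip_eq[OF alg_dualH[OF H(2)] coalg_dualH[OF H(1)] antipode_dualH[OF S]])

lemma pair_antip_D: "pair (antip D a) x \<odot> v = pair a (S x) \<odot> v"
  unfolding antip_D by (rule antipode_dual_pair[OF lin_S(1)])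

lemma bact_ev: "bact H X a = ev X (\<lambda>f h. sw H h (\<lambda>x y. sw D a (\<lambda>e w. sw D e (\<lambda>u v.
    pair u (mul H (S x) (S f)) \<odot> pair w y \<odot> v))))"
proof (rule ext)
  fix j
  let ?F = "\<lambda>f x y u v w. pair u (mul H (S x) (S f)) \<odot> pair w y \<odot> v"
  have "bact H X a j = (\<Sum>(f, h)\<in>UNIV. X (f, h) * (\<Sum>(x, y)\<in>UNIV. cop H (bv h) (x, y) *
      (\<Sum>(u, v, w)\<in>UNIV. cop3 D a (u, v, w) * ?F (bv f) (bv x) (bv y) (bv u) (bv v) (bv w) j)))"
    unfolding bact_def antip_H by (simp only: case_prod_unfold sum_distrib_left scal_apply mult.assoc mult.commute[of "bv _ _" "pair _ _"])
  also have "\<dots> = (\<Sum>(f, h)\<in>UNIV. X (f, h) * sw H (bv h) (\<lambda>x y. sw D a (\<lambda>e w. sw D e (\<lambda>u v. ?F (bv f) x y u v w))) j)"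
    unfolding cop3_sum[where F = "\<lambda>u v w. ?F _ _ _ u v w"]
      cop2_sum[where F = "\<lambda>x y. sw D a (\<lambda>e w. sw D e (\<lambda>u v. ?F _ x y u v w))"] ..
  also have "\<dots> = ev X (\<lambda>f h. sw H h (\<lambda>x y. sw D a (\<lambda>e w. sw D e (\<lambda>u v. ?F f x y u v w)))) j"
    by (rule cop2_sum)
  finally show "bact H X a j = \<dots>" .
qed

lemma lin_bact [lins]: "lin f \<Longrightarrow> lin (\<lambda>x. bact H (f x) a)"
  unfolding bact_ev by (intro lins)

text \<open>For X = f \<otimes> h the inverse of \<open>theta1\<close> gives u \<otimes> v = f h_1
  \<otimes> h_2, and S(f h_1) = S(h_1) S(f) is the factor in the action. Thus the bicrossproduct
  acts by the transpose of p \<mapsto> S(u) p v.\<close>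

lemma pair_bact: "pair (bact H X a) p \<odot> V = ev (theta1_inv X) (\<lambda>u v. pair a (mul H (mul H (S u) p) v) \<odot> V)"
proof -
  have "pair (bact H X a) p \<odot> V = ev X (\<lambda>f h. sw H h (\<lambda>x y. pair a (mul H (mul H (mul H (S x) (S f)) p) y) \<odot> V))"
    unfolding bact_ev pair_mul ev_lin[OF lin_pair_l[OF lin_id]] by (simp add: mult_ac)
  also have "\<dots> = ev (theta1_inv X) (\<lambda>u v. pair a (mul H (mul H (S u) p) v) \<odot> V)"
    unfolding theta1_inv_def ev_ev
    by (intro ev_cong, subst ev_tv, (intro lins)+, simp only: S_mul)
  finally show ?thesis .
qed

lemma Rform_ev: "Rform R x y \<odot> V = ev R (\<lambda>s t. pair x s \<odot> pair y t \<odot> V)"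
  by (simp add: Rform_def ev_sum sum_UNIV_pair sum_scal mult_ac)

text \<open>The inverse of \<open>chiB\<close> is R in the inner two factors, so 1 \<otimes> s acts
  on a and t \<otimes> 1 acts on b, where R = s \<otimes> t. Paired with p, both products become <a,
  S(s_1) p_1 s_2> <b, S(t) p_2>.\<close>

lemma umul_eq: "umul H R a b = twist_mul B (mul D) (bact H) (chiB H R) a b"
proof (rule pair_eqI)
  fix p
  let ?v = "\<lambda>_::unit. 1::'k"
  let ?F = "\<lambda>a1 a2 a3 b1 b2. Rform R (mul D (antip D a1) a3) (antip D b1) \<odot> mul D a2 b2"
  have "umul H R a b = sw D a (\<lambda>e a3. sw D e (\<lambda>a1 a2. sw D b (\<lambda>b1 b2. ?F a1 a2 a3 b1 b2)))"
  proof (rule ext)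
    fix j
    have "umul H R a b j = (\<Sum>(a1, a2, a3)\<in>UNIV. cop3 D a (a1, a2, a3) * (\<Sum>(b1, b2)\<in>UNIV. cop D b (b1, b2) *
       ?F (bv a1) (bv a2) (bv a3) (bv b1) (bv b2) j))"
      unfolding umul_def by (simp only: case_prod_unfold sum_distrib_left scal_apply mult.assoc)
    also have "\<dots> = sw D a (\<lambda>e a3. sw D e (\<lambda>a1 a2. sw D b (\<lambda>b1 b2. ?F a1 a2 a3 b1 b2))) j"
      unfolding cop2_sum[where F = "\<lambda>b1 b2. ?F _ _ _ b1 b2"]
      by (rule cop3_sum)
    finally show "umul H R a b j = \<dots>" .
  qed
  then have "pair (umul H R a b) p \<odot> ?v = sw D a (\<lambda>e a3. sw D e (\<lambda>a1 a2. sw D b (\<lambda>b1 b2.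
      Rform R (mul D (antip D a1) a3) (antip D b1) \<odot> pair (mul D a2 b2) p \<odot> ?v)))"
    by (simp add: ev_lin[OF lin_pair_l[OF lin_id]])
  also have "\<dots> = sw D a (\<lambda>e a3. sw D e (\<lambda>a1 a2. sw D b (\<lambda>b1 b2. ev R (\<lambda>s t. sw H s (\<lambda>s1 s2. sw H p (\<lambda>p1 p2.
      pair a1 (S s1) \<odot> pair a3 s2 \<odot> pair b1 (S t) \<odot> pair a2 p1 \<odot> pair b2 p2 \<odot> ?v))))))"
    unfolding Rform_ev pair_mul_dual pair_antip_D by (simp only: ev_scal)
  \<comment> \<open>Only the order of the sums changes: those over R, s and p move outside, so that
    the coproducts of a and b can be undone by \<open>pair_mul\<close>.\<close>
  also have "\<dots> = ev R (\<lambda>s t. sw H s (\<lambda>s1 s2. sw H p (\<lambda>p1 p2. sw D a (\<lambda>e a3. sw D e (\<lambda>a1 a2. sw D b (\<lambda>b1 b2.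
      pair a1 (S s1) \<odot> pair a2 p1 \<odot> pair a3 s2 \<odot> pair b1 (S t) \<odot> pair b2 p2 \<odot> ?v))))))"
  proof -
    let ?F = "\<lambda>a1 a2 a3 b1 b2 s1 s2 t p1 p2. pair a1 (S s1) \<odot> pair a3 s2 \<odot> pair b1 (S t) \<odot> pair a2 p1 \<odot> pair b2 p2 \<odot> ?v"
    have "sw D a (\<lambda>e a3. sw D e (\<lambda>a1 a2. sw D b (\<lambda>b1 b2. ev R (\<lambda>s t. sw H s (\<lambda>s1 s2. sw H p (\<lambda>p1 p2. ?F a1 a2 a3 b1 b2 s1 s2 t p1 p2))))))
      = ev R (\<lambda>s t. sw D a (\<lambda>e a3. sw D e (\<lambda>a1 a2. sw D b (\<lambda>b1 b2. sw H s (\<lambda>s1 s2. sw H p (\<lambda>p1 p2. ?F a1 a2 a3 b1 b2 s1 s2 t p1 p2))))))"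
      by (rule ev_swap3)
    also have "\<dots> = ev R (\<lambda>s t. sw H s (\<lambda>s1 s2. sw D a (\<lambda>e a3. sw D e (\<lambda>a1 a2. sw D b (\<lambda>b1 b2. sw H p (\<lambda>p1 p2. ?F a1 a2 a3 b1 b2 s1 s2 t p1 p2))))))"
      by (rule ev_cong, rule ev_swap3)
    also have "\<dots> = ev R (\<lambda>s t. sw H s (\<lambda>s1 s2. sw H p (\<lambda>p1 p2. sw D a (\<lambda>e a3. sw D e (\<lambda>a1 a2. sw D b (\<lambda>b1 b2. ?F a1 a2 a3 b1 b2 s1 s2 t p1 p2))))))"
      by (rule ev_cong, rule ev_cong, rule ev_swap3)
    finally show ?thesis by (simp add: mult_ac)
  qed
  also have "\<dots> = ev R (\<lambda>s t. sw H s (\<lambda>s1 s2. sw H p (\<lambda>p1 p2.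
      pair a (mul H (mul H (S s1) p1) s2) \<odot> pair b (mul H (S t) p2) \<odot> ?v)))"
    unfolding pair_mul by (simp add: ev_scal)
  also have "\<dots> = ev R (\<lambda>s t. sw H p (\<lambda>p1 p2. pair (bact H (tv (one H) s) a) p1 \<odot> pair (bact H (tv t (one H)) b) p2 \<odot> ?v))"
  proof (rule ev_cong)
    fix s t
    have 2: "pair (bact H (tv t (one H)) b) p2 \<odot> V = pair b (mul H (S t) p2) \<odot> V" for t p2 V
      unfolding pair_bact theta1_inv_2 by (subst ev_tv) ((intro lins)+, simp)
    show "sw H (bv s) (\<lambda>s1 s2. sw H p (\<lambda>p1 p2. pair a (mul H (mul H (S s1) p1) s2) \<odot> pair b (mul H (S (bv t)) p2) \<odot> ?v))
      = sw H p (\<lambda>p1 p2. pair (bact H (tv (one H) (bv s)) a) p1 \<odot> pair (bact H (tv (bv t) (one H)) b) p2 \<odot> ?v)"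
      unfolding 2 unfolding pair_bact theta1_inv_1 by (rule ev_swap)
  qed
  also have "\<dots> = pair (ev R (\<lambda>s t. mul D (bact H (tv (one H) s) a) (bact H (tv t (one H)) b))) p \<odot> ?v"
    unfolding ev_lin[OF lin_pair_l[OF lin_id]] pair_mul_dual ..
  also have "ev R (\<lambda>s t. mul D (bact H (tv (one H) s) a) (bact H (tv t (one H)) b)) = twist_mul B (mul D) (bact H) (chiB H R) a b"
  proof -
    have "twist_mul B (mul D) (bact H) (chiB H R) a b = ev (ev R (\<lambda>s t. tv (tv (one H) s) (tv t (one H)))) (\<lambda>X Y. mul D (bact H X a) (bact H Y b))"
      unfolding twist_mul_def inv_chiB by (rule ext) (rule cop2_sum)
    also have "\<dots> = ev R (\<lambda>s t. mul D (bact H (tv (one H) s) a) (bact H (tv t (one H)) b))"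
      unfolding ev_ev by (intro ev_cong, subst ev_tv) ((intro lins)+, rule refl)
    finally show ?thesis ..
  qed
  finally show "pair (umul H R a b) p \<odot> ?v = pair (twist_mul B (mul D) (bact H) (chiB H R) a b) p \<odot> ?v" .
qed

lemma L_ev: "L = ev Ri (\<lambda>a b. ev R (\<lambda>c d. tv (tv b c) (mul H a d)))"
  unfolding L_def lift2_def mul_ev_l by (simp add: mul_ev_r)

lemma uact_ev: "uact H R X b = ev X (\<lambda>h a. sw D a (\<lambda>a1 a2. sw D b (\<lambda>e b5. sw D e (\<lambda>d b4. sw D d (\<lambda>f b3. sw D f (\<lambda>b1 b2.
    pair (mul D (antip D b2) b4) h \<odot> Rform R a1 b1 \<odot> Rform R b5 a2 \<odot> b3))))))"
proof (rule ext)
  fix j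
  let ?F = "\<lambda>h a1 a2 b1 b2 b3 b4 b5. pair (mul D (antip D b2) b4) h \<odot> Rform R a1 b1 \<odot> Rform R b5 a2 \<odot> b3"
  have "uact H R X b j = (\<Sum>(h, a)\<in>UNIV. X (h, a) * (\<Sum>(a1, a2)\<in>UNIV. cop D (bv a) (a1, a2) *
     (\<Sum>(b1, b2, b3, b4, b5)\<in>UNIV. cop5 D b (b1, b2, b3, b4, b5) *
       ?F (bv h) (bv a1) (bv a2) (bv b1) (bv b2) (bv b3) (bv b4) (bv b5) j)))"
    unfolding uact_def by (simp only: case_prod_unfold sum_distrib_left scal_apply mult.assoc)
  also have "\<dots> = (\<Sum>(h, a)\<in>UNIV. X (h, a) * sw D (bv a) (\<lambda>a1 a2. sw D b (\<lambda>e b5. sw D e (\<lambda>d b4. sw D d (\<lambda>f b3. sw D f (\<lambda>b1 b2.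
       ?F (bv h) a1 a2 b1 b2 b3 b4 b5))))) j)"
    unfolding cop5_sum[where F = "\<lambda>b1 b2 b3 b4 b5. ?F _ _ _ b1 b2 b3 b4 b5"]
      cop2_sum[where F = "\<lambda>a1 a2. sw D b (\<lambda>e b5. sw D e (\<lambda>d b4. sw D d (\<lambda>f b3. sw D f (\<lambda>b1 b2. ?F _ a1 a2 b1 b2 b3 b4 b5))))"] ..
  also have "\<dots> = ev X (\<lambda>h a. sw D a (\<lambda>a1 a2. sw D b (\<lambda>e b5. sw D e (\<lambda>d b4. sw D d (\<lambda>f b3. sw D f (\<lambda>b1 b2.
       ?F h a1 a2 b1 b2 b3 b4 b5)))))) j"
    by (rule cop2_sum)
  finally show "uact H R X b j = \<dots>" .
qed

text \<open>Paired with p, both sides become <a, m d> <b, n S(h_1) p h_2 c> for two copies m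
  \<otimes> n and c \<otimes> d of R. These give the factors R(a_1, b_1) and R(b_5, a_2) of the
  braided action.\<close>

lemma uact_eq: "uact H R X b = bact H (theta H R X) b"
proof (rule pair_eqI)
  fix p
  let ?v = "\<lambda>_::unit. 1::'k"
  have "pair (bact H (theta H R X) b) p \<odot> ?v = ev (theta2 X) (\<lambda>u v. pair b (mul H (mul H (S u) p) v) \<odot> ?v)"
    by (simp only: pair_bact theta1_inv_theta)
  also have "\<dots> = ev X (\<lambda>h a. sw H h (\<lambda>h1 h2. ev Ri (\<lambda>m n. ev R (\<lambda>c d. pair a (mul H m d) \<odot>
      pair b (mul H (mul H (mul H (S n) (S h1)) p) (mul H h2 c)) \<odot> ?v))))"
  proof -
    let ?G = "\<lambda>u v. pair b (mul H (mul H (S u) p) v) \<odot> ?v"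
    have TL: "mul T (cop H h) (Lslice a) = sw H h (\<lambda>h1 h2. ev Ri (\<lambda>m n. ev R (\<lambda>c d. pair a (mul H m d) \<odot> tv (mul H h1 n) (mul H h2 c))))" for h a
    proof -
      have "mul T (sw H h tv) (Lslice a) = sw H h (\<lambda>h1 h2. ev Ri (\<lambda>m n. ev R (\<lambda>c d. pair a (mul H m d) \<odot> tv (mul H h1 n) (mul H h2 c))))"
        unfolding L_ev ev_lin[OF lin_contract(1)] contract_tv mul_ev_l by (simp add: mul_ev_r)
      then show ?thesis by simp
    qed
    have GT: "ev (tv x y) ?G = ?G x y" for x y
      by (rule ev_tv) (intro lins)+
    show ?thesis
      unfolding theta2_def TL ev_ev ev_scal_arg GT S_mul ..
  qed
  \<comment> \<open>The antipode on n is absorbed by (id \<otimes> S) R^{-1} = R, which replaces the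
    R^{-1} coming from \<open>L\<close> by R.\<close>
  also have "\<dots> = ev X (\<lambda>h a. sw H h (\<lambda>h1 h2. ev R (\<lambda>m n. ev R (\<lambda>c d. pair a (mul H m d) \<odot>
      pair b (mul H (mul H (mul H n (S h1)) p) (mul H h2 c)) \<odot> ?v))))"
  proof -
    have RR: "ev R F = ev Ri (\<lambda>m n. F m (S n))" if "\<And>a. lin (F a)" "\<And>b. lin (\<lambda>a. F a b)" for F :: "_ \<Rightarrow> _ \<Rightarrow> unit \<Rightarrow> 'k"
      using ev_tensmap[OF that, of "\<lambda>x. x" S Ri] by (simp only: S_Ri)
    show ?thesis by (intro ev_cong, rule sym, rule RR) (intro lins)+
  qed
  also have "\<dots> = pair (uact H R X b) p \<odot> ?v"
  proof -
    let ?F = "\<lambda>h1 h2 s t s' t' a1 a2 b1 b2 b3 b4 b5. pair a1 s \<odot> pair a2 t' \<odot>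
      (pair b1 t \<odot> pair b2 (S h1) \<odot> pair b3 p \<odot> pair b4 h2 \<odot> pair b5 s' \<odot> ?v)"
    have "pair (uact H R X b) p \<odot> ?v = ev X (\<lambda>h a. sw D a (\<lambda>a1 a2. sw D b (\<lambda>e b5. sw D e (\<lambda>d b4. sw D d (\<lambda>f b3. sw D f (\<lambda>b1 b2.
      pair (mul D (antip D b2) b4) h \<odot> Rform R a1 b1 \<odot> Rform R b5 a2 \<odot> pair b3 p \<odot> ?v))))))"
      unfolding uact_ev ev_lin[OF lin_pair_l[OF lin_id]] by (simp add: mult.assoc)
    \<comment> \<open>From here on the sums are only reordered, until those over the parts of a and
      b are innermost and fold into products in \<open>H\<close>.\<close>
    also have "\<dots> = ev X (\<lambda>h a. sw D a (\<lambda>a1 a2. sw D b (\<lambda>e b5. sw D e (\<lambda>d b4. sw D d (\<lambda>f b3. sw D f (\<lambda>b1 b2. ev R (\<lambda>s' t'. ev R (\<lambda>s t. sw H h (\<lambda>h1 h2. ?F h1 h2 s t s' t' a1 a2 b1 b2 b3 b4 b5)))))))))"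
      unfolding pair_mul_dual pair_antip_D Rform_ev ev_scal by (simp add: mult_ac)
    also have "\<dots> = ev X (\<lambda>h a. ev R (\<lambda>s' t'. sw D a (\<lambda>a1 a2. sw D b (\<lambda>e b5. sw D e (\<lambda>d b4. sw D d (\<lambda>f b3. sw D f (\<lambda>b1 b2. ev R (\<lambda>s t. sw H h (\<lambda>h1 h2. ?F h1 h2 s t s' t' a1 a2 b1 b2 b3 b4 b5)))))))))"
      by (rule ev_cong, rule ev_swap5)
    also have "\<dots> = ev X (\<lambda>h a. ev R (\<lambda>s' t'. ev R (\<lambda>s t. sw D a (\<lambda>a1 a2. sw D b (\<lambda>e b5. sw D e (\<lambda>d b4. sw D d (\<lambda>f b3. sw D f (\<lambda>b1 b2. sw H h (\<lambda>h1 h2. ?F h1 h2 s t s' t' a1 a2 b1 b2 b3 b4 b5)))))))))"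
      by (rule ev_cong, rule ev_cong, rule ev_swap5)
    also have "\<dots> = ev X (\<lambda>h a. ev R (\<lambda>s' t'. ev R (\<lambda>s t. sw H h (\<lambda>h1 h2. sw D a (\<lambda>a1 a2. sw D b (\<lambda>e b5. sw D e (\<lambda>d b4. sw D d (\<lambda>f b3. sw D f (\<lambda>b1 b2. ?F h1 h2 s t s' t' a1 a2 b1 b2 b3 b4 b5)))))))))"
      by (rule ev_cong, rule ev_cong, rule ev_cong, rule ev_swap5)
    also have "\<dots> = ev X (\<lambda>h a. sw H h (\<lambda>h1 h2. ev R (\<lambda>s' t'. ev R (\<lambda>s t. sw D a (\<lambda>a1 a2. sw D b (\<lambda>e b5. sw D e (\<lambda>d b4. sw D d (\<lambda>f b3. sw D f (\<lambda>b1 b2. ?F h1 h2 s t s' t' a1 a2 b1 b2 b3 b4 b5)))))))))"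
      by (rule ev_cong, rule ev_swap2)
    also have "\<dots> = ev X (\<lambda>h a. sw H h (\<lambda>h1 h2. ev R (\<lambda>s t. ev R (\<lambda>s' t'. sw D a (\<lambda>a1 a2. sw D b (\<lambda>e b5. sw D e (\<lambda>d b4. sw D d (\<lambda>f b3. sw D f (\<lambda>b1 b2. ?F h1 h2 s t s' t' a1 a2 b1 b2 b3 b4 b5)))))))))"
      by (rule ev_cong, rule ev_cong, rule ev_swap)
    also have "\<dots> = ev X (\<lambda>h a. sw H h (\<lambda>h1 h2. ev R (\<lambda>s t. ev R (\<lambda>s' t'. pair a (mul H s t') \<odot>
      (pair b (mul H (mul H (mul H (mul H t (S h1)) p) h2) s') \<odot> ?v)))))"
      unfolding pair_mul unfolding ev_scal ..
    finally show ?thesis by (simp only: assoc)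
  qed
  finally show "pair (uact H R X b) p \<odot> ?v = pair (bact H (theta H R X) b) p \<odot> ?v" ..
qed

end

theorem theorem2p2:
  fixes H :: "('i::finite, 'k::field) bialg" and R :: "'i \<times> 'i \<Rightarrow> 'k"
  assumes "is_hopf H" and "qt H R" and "factorisable H R"
  shows "covsys_iso (dbl H) (umul H R) (one (dualH H)) (uact H R)
           (twist_bialg (bicross H) (chiB H R))
           (twist_mul (bicross H) (mul (dualH H)) (bact H) (chiB H R)) (one (dualH H)) (bact H)
           (theta H R) id
       \<and> is_hopf (bicross H)
       \<and> qt (bicross H) (tensmap (theta1 H) (theta1 H) (mul (tens4 H) (R13inv H R) (R24 H R)))
       \<and> qt (bicross H) (tensmap (theta1 H) (theta1 H) (mul (tens4 H) (R31 H R) (R24 H R)))"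
proof -
  obtain S where S: "antipode H S" and h: "alg H" "coalg H" "compat H"
    using assms(1) unfolding is_hopf_iff is_bialg_iff by blast
  obtain Ri where q: "qt_with H R Ri"
    using assms(2) unfolding qt_iff by blast
  interpret quasitri_hopf H R Ri S
    by unfold_locales (rule h S q)+
  have "covsys_iso (dbl H) (umul H R) (one D) (uact H R)
           (twist_bialg B (chiB H R))
           (twist_mul B (mul D) (bact H) (chiB H R)) (one D) (bact H)
           (theta H R) id"
    \<comment> \<open>With the identity on H^* as algebra map, the algebra part is the equality of
      the two products and the intertwining property is the equality of the two actions.\<close>
    unfolding covsys_iso_def alg_iso_def
    using bialg_iso_hopf_iso[OF bialg_iso_theta[OF assms(3)] hopf_dbl[OF assms(3)]]
    by (simp add: umul_eq uact_eq lin_id')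
  then show ?thesis using hopf_B[OF assms(3)] qt_B by blast
qed

end
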